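(* Assume the following. (1) $(\lambda_n)_{n\in\mathbb N}$ is a sequence of positive reals with $\sum_n\lambda_n=+\infty$ and $\sum_n\lambda_n^2<\infty$; the random variables $(\xi_n)_{n\ge1}$ are independent and identically distributed with distribution $\mu$. (2) $f:E\times\mathcal H\to(-\infty,+\infty]$ is a normal convex integrand; $F(x)=\int f(s,x)\,d\mu(s)$ is proper and lower semicontinuous; for all $x\in\mathcal H$, $\partial F(x)=\int\partial f(s,x)\,d\mu(s)$ (Aumann integral); and the set of minimizers of $F$ is non-empty and included in $\mathcal Z_{\partial f}(2)$. (3) The domains $D_s=\mathrm{dom}(\partial f(s,\cdot))$ coincide for all $s$ outside a $\mu$-negligible set. (4) For every bounded set $K\subset\mathcal H$, the family $(\|\partial f_0(\cdot,x)\|:x\in K\cap\mathcal D)$ is uniformly integrable with respect to $\mu$. Let $x_0\in\mathcal H$ be fixed and let $(x_n)$ be the random sequence defined by $x_{n+1}=\mathrm{prox}_{\lambda_nf(\xi_{n+1},\cdot)}(x_n)$, $n\in\mathbb N$, with weighted averages $\overline x_n=\sum_{k=1}^n\lambda_kx_k/\sum_{k=1}^n\lambda_k$. Then, almost surely, $(\overline x_n)$ converges weakly to a minimizer of $F$.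
   Context: $(E,\mathcal E,\mu)$ is a complete probability space, $\mathcal H$ is a separable Hilbert space with Borel $\sigma$-algebra $\mathcal B(\mathcal H)$, $(\Omega,\mathcal F,\mathbb P)$ is a probability space and $\xi_n:\Omega\to E$ ($n\ge1$) are random variables. $f:E\times\mathcal H\to(-\infty,+\infty]$ is a normal convex integrand if it is $\mathcal E\otimes\mathcal B(\mathcal H)$-measurable and $f(s,\cdot)$ is lower semicontinuous, proper and convex for each $s\in E$. The integral $\int f(s,x)\,d\mu(s)$ is defined as $\int f(s,x)^+d\mu(s)-\int f(s,x)^-d\mu(s)$ with $a^\pm=\max(\pm a,0)$ and the convention $(+\infty)-(+\infty)=+\infty$. $\partial f(s,x)=\{u\in\mathcal H:\forall y\in\mathcal H,\ f(s,y)\ge f(s,x)+\langle u,y-x\rangle\}$ is the subdifferential in the second variable, $\mathrm{dom}(\partial f(s,\cdot))=\{x:\partial f(s,x)\neq\emptyset\}$, and $\partial f_0(s,x)$ is the element of $\partial f(s,x)$ with smallest norm. $\mathrm{prox}_{\lambda g}(x)=\arg\min_{t\in\mathcal H}\ \lambda g(t)+\tfrac12\|t-x\|^2$. $\mathcal D$ is the essential intersection of the sets $D_s=\mathrm{dom}(\partial f(s,\cdot))$: the set of $x\in\mathcal H$ such that $x\in D_s$ for all $s$ outside some $\mu$-negligible set (depending on $x$). For $x\in\mathcal H$ and $p\ge1$, $S_{\partial f}^p(x)$ is the set of measurable $\phi:E\to\mathcal H$ with $\phi(s)\in\partial f(s,x)$ for $\mu$-a.e. $s$ and $\int\|\phi\|^pd\mu<\infty$.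 The Aumann integral is $\int\partial f(s,x)\,d\mu(s)=\{\int\phi\,d\mu:\phi\in S_{\partial f}^1(x)\}$, and $\mathcal Z_{\partial f}(p)=\{x:\exists\phi\in S_{\partial f}^p(x),\ \int\phi\,d\mu=0\}$. A family $(f_i)_{i\in I}$ of ($\mu$-a.e. defined) measurable functions $E\to\mathbb R_+$ is uniformly integrable if $\lim_{a\to+\infty}\sup_i\int_{\{f_i>a\}}f_i\,d\mu=0$. *)

theory Defs
  imports "HOL-Probability.Probability"
begin

section \<open>Extended-real-valued functions on a Hilbert space\<close>

text \<open>
  The codomain \<open>(-\<infinity>, +\<infinity>]\<close> is rendered as \<^typ>\<open>ereal\<close>; the exclusion of \<open>-\<infinity>\<close> is part of properness.
\<close>

definition proper :: "('h \<Rightarrow> ereal) \<Rightarrow> bool" where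
  "proper g \<longleftrightarrow> (\<forall>x. g x \<noteq> -\<infinity>) \<and> (\<exists>x. g x \<noteq> \<infinity>)"

definition lsc :: "('h::topological_space \<Rightarrow> ereal) \<Rightarrow> bool" where
  "lsc g \<longleftrightarrow> (\<forall>x. g x \<le> Liminf (at x) g)"

text \<open>Convexity of the epigraph; \<^const>\<open>convex_on\<close> only covers real-valued functions.\<close>

definition convex_fun :: "('h::real_vector \<Rightarrow> ereal) \<Rightarrow> bool" where
  "convex_fun g \<longleftrightarrow> convex {(x, r :: real). g x \<le> ereal r}"

definition minimizers :: "('h \<Rightarrow> ereal) \<Rightarrow> 'h set" where
  "minimizers g = {x. is_arg_min g (\<lambda>_. True) x}"

definition subdiff :: "('h::real_inner \<Rightarrow> ereal) \<Rightarrow> 'h \<Rightarrow> 'h set" where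
  "subdiff g x = {u. \<forall>y. g y \<ge> g x + ereal (inner u (y - x))}"

definition dom_subdiff :: "('h::real_inner \<Rightarrow> ereal) \<Rightarrow> 'h set" where
  "dom_subdiff g = {x. subdiff g x \<noteq> {}}"

text \<open>Only meaningful for \<open>x \<in> dom_subdiff g\<close>, and unspecified elsewhere.\<close>

definition subdiff_min :: "('h::real_inner \<Rightarrow> ereal) \<Rightarrow> 'h \<Rightarrow> 'h" where
  "subdiff_min g x = arg_min_on norm (subdiff g x)"

definition prox :: "real \<Rightarrow> ('h::real_inner \<Rightarrow> ereal) \<Rightarrow> 'h \<Rightarrow> 'h" where
  "prox c g x = arg_min (\<lambda>t. ereal c * g t + ereal (1/2 * (norm (t - x))\<^sup>2)) (\<lambda>_. True)"

definition weakly_converges :: "(nat \<Rightarrow> 'h::real_inner) \<Rightarrow> 'h \<Rightarrow> bool" where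
  "weakly_converges X x \<longleftrightarrow> (\<forall>y. (\<lambda>n. inner (X n) y) \<longlonglongrightarrow> inner x y)"

section \<open>Integrands\<close>

definition normal_convex_integrand ::
    "'e measure \<Rightarrow> ('e \<Rightarrow> 'h::{real_normed_vector, second_countable_topology} \<Rightarrow> ereal) \<Rightarrow> bool" where
  "normal_convex_integrand M f \<longleftrightarrow>
     (\<lambda>(s, x). f s x) \<in> borel_measurable (M \<Otimes>\<^sub>M borel) \<and>
     (\<forall>s\<in>space M. lsc (f s) \<and> proper (f s) \<and> convex_fun (f s))"

text \<open>The required convention \<open>(+\<infinity>) - (+\<infinity>) = +\<infinity>\<close> is that of subtraction on \<^typ>\<open>ereal\<close>.\<close>

definition ext_integral :: "'e measure \<Rightarrow> ('e \<Rightarrow> ereal) \<Rightarrow> ereal" where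
  "ext_integral M g =
     enn2ereal (\<integral>\<^sup>+ s. e2ennreal (max (g s) 0) \<partial>M) - enn2ereal (\<integral>\<^sup>+ s. e2ennreal (max (- g s) 0) \<partial>M)"

lemma infinity_minus_infinity_ereal: "(\<infinity>::ereal) - \<infinity> = \<infinity>"
  by simp

definition ess_dom :: "'e measure \<Rightarrow> ('e \<Rightarrow> 'h::real_inner \<Rightarrow> ereal) \<Rightarrow> 'h set" where
  "ess_dom M f = {x. AE s in M. x \<in> dom_subdiff (f s)}"

definition selections ::
    "'e measure \<Rightarrow> ('e \<Rightarrow> 'h::{real_inner, second_countable_topology} \<Rightarrow> ereal) \<Rightarrow> real \<Rightarrow> 'h \<Rightarrow> ('e \<Rightarrow> 'h) set" where
  "selections M f p x =
     {\<phi>. \<phi> \<in> borel_measurable M \<and> (AE s in M. \<phi> s \<in> subdiff (f s) x) \<and>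
         (\<integral>\<^sup>+ s. ennreal (norm (\<phi> s) powr p) \<partial>M) < \<infinity>}"

definition aumann_integral ::
    "'e measure \<Rightarrow> ('e \<Rightarrow> 'h::{real_inner, banach, second_countable_topology} \<Rightarrow> ereal) \<Rightarrow> 'h \<Rightarrow> 'h set" where
  "aumann_integral M f x = {\<integral>s. \<phi> s \<partial>M | \<phi>. \<phi> \<in> selections M f 1 x}"

definition zero_set ::
    "'e measure \<Rightarrow> ('e \<Rightarrow> 'h::{real_inner, banach, second_countable_topology} \<Rightarrow> ereal) \<Rightarrow> real \<Rightarrow> 'h set" where
  "zero_set M f p = {x. \<exists>\<phi>\<in>selections M f p x. (\<integral>s. \<phi> s \<partial>M) = 0}"

text \<open>
  On a complete measure space the values of a function on a null set do not affect its
  measurability, so almost everywhere defined functions may be given as total ones.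
\<close>

definition uniformly_integrable_family :: "'e measure \<Rightarrow> 'i set \<Rightarrow> ('i \<Rightarrow> 'e \<Rightarrow> real) \<Rightarrow> bool" where
  "uniformly_integrable_family M I g \<longleftrightarrow>
     (\<forall>i\<in>I. g i \<in> borel_measurable M) \<and>
     ((\<lambda>a::real. SUP i\<in>I. \<integral>\<^sup>+ s\<in>{s \<in> space M. g i s > a}. ennreal (g i s) \<partial>M) \<longlongrightarrow> 0) at_top"

end

theory Submission
  imports Defs "HOL-Library.Diagonal_Subsequence"
begin

text \<open>
  Let \<open>z\<close> be a minimizer of \<open>F\<close> and \<open>\<phi>\<close> a square integrable selection of \<open>\<partial>f(\<cdot>, z)\<close> with mean zero. Write
  \<open>e\<^sub>n(s, \<cdot>)\<close> for the Moreau envelope of \<open>f(s, \<cdot>)\<close> with parameter \<open>\<lambda>\<^sub>n\<close>. One proximal step satisfies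

  \<open>\<bar>x\<^sub>n\<^sub>+\<^sub>1 - z\<bar>\<^sup>2 \<le> \<bar>x\<^sub>n - z\<bar>\<^sup>2 - 2 \<lambda>\<^sub>n (e\<^sub>n(\<xi>\<^sub>n\<^sub>+\<^sub>1, x\<^sub>n) - f(\<xi>\<^sub>n\<^sub>+\<^sub>1, z))\<close>

  without any remainder (\<open>prox_step_inequality\<close>), and everything is extracted from this inequality.

  Bounding the envelope below by the affine minorant that belongs to \<open>\<phi>\<close> turns the right-hand side into
  \<open>\<bar>x\<^sub>n - z\<bar>\<^sup>2\<close> plus a martingale increment plus \<open>\<lambda>\<^sub>n\<^sup>2 \<bar>\<phi>(\<xi>\<^sub>n\<^sub>+\<^sub>1)\<bar>\<^sup>2\<close>. The increments have summable second
  moments, so the martingale converges almost surely and with it \<open>\<bar>x\<^sub>n - z\<bar>\<close>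
  (\<open>distance_converges\<close>). What the bound throws away is the excess of the envelope over the minorant;
  it is nonnegative, and on taking expectations its mean, weighted by \<open>\<lambda>\<^sub>n\<close>, turns out to be summable
  (\<open>mean_excess_summable\<close>).

  The mean excess at \<open>x\<^sub>n\<close> differs from \<open>F(x\<^sub>n) - min F\<close> essentially by the mean of
  \<open>f(s, x\<^sub>n) - e\<^sub>n(s, x\<^sub>n)\<close>. This difference is at most \<open>\<lambda>\<^sub>n u\<^sup>2 / 2\<close>, where \<open>u\<close> is the norm of the smallest
  subgradient at \<open>x\<^sub>n\<close>, and also at most a linear function of \<open>u\<close>; truncating at a level of \<open>u\<close> and using
  uniform integrability, its mean tends to zero along the bounded sequence \<open>x\<^sub>n\<close>
  (\<open>expected_gap\<close>). The common domain of the subdifferentials guarantees that every \<open>x\<^sub>n\<close> with \<open>n \<ge> 1\<close>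
  is a point to which this applies. By Jensen's inequality and \<open>\<Sum> \<lambda>\<^sub>n = \<infinity>\<close> the averages
  therefore form a minimizing sequence, so their weak cluster points are minimizers
  (\<open>weak_limit_of_minimizing_sequence\<close>), and convergence of the distances to all minimizers leaves room
  for only one cluster point (\<open>ergodic_opial\<close>).

  To take expectations at all, the iterates must be measurable. The integrand is only jointly
  measurable, so measurability of its proximal map in \<open>s\<close> rests on the measurable projection theorem
  for complete measure spaces (\<open>measurable_projection\<close>), which is derived from Suslin's operation. Facts
  about Hilbert spaces (points of least norm, Riesz representation, weak compactness) all rest on
  the existence of proximal points.
\<close>

section \<open>Measurable projection\<close>

text \<open>
  Dependent choice for sequences that are built one entry at a time, when each requirement only
  looks at a finite prefix. It serves both the inner approximation of Suslin sets and the
  compactness argument of \<open>koenig_box\<close>.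
\<close>

lemma prefix_choice:
  fixes P :: "nat \<Rightarrow> (nat \<Rightarrow> 'a) \<Rightarrow> bool"
  assumes cong: "\<And>n c d. (\<And>i. i < n \<Longrightarrow> c i = d i) \<Longrightarrow> P n c \<Longrightarrow> P n d"
    and start: "P 0 c0"
    and step: "\<And>n c. P n c \<Longrightarrow> \<exists>j. P (Suc n) (c(n := j))"
  obtains k where "\<And>n. P n k"
proof -
  have "\<exists>h. \<forall>n. P n (h n) \<and> (\<forall>i<n. h (Suc n) i = h n i)"
  proof (rule dependent_nat_choice)
    show "\<exists>c. P 0 c" using start by blast
    show "\<exists>d. P (Suc n) d \<and> (\<forall>i<n. d i = c i)" if "P n c" for c n
      using step[OF that] by (metis fun_upd_other nat_neq_iff)
  qed
  then obtain h where h: "\<And>n. P n (h n)" "\<And>n i. i < n \<Longrightarrow> h (Suc n) i = h n i" by blast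
  define k where "k i = h (Suc i) i" for i
  have stable: "h n i = h (Suc i) i" if "i < n" for n i
    using that
  proof (induction n)
    case (Suc n)
    then show ?case using h(2)[of i n] by (cases "i = n") auto
  qed simp
  have "P n k" for n
    unfolding k_def by (rule cong[OF stable h(1)[of n]])
  with that show ?thesis by blast
qed

text \<open>
  The sets obtained from \<open>\<C>\<close> by Suslin's operation. A scheme indexed by finite sequences is encoded
  as a function of an infinite sequence of which only the entries up to \<open>n\<close> matter at level \<open>n\<close>;
  the dependence is inclusive, so that level \<open>0\<close> already sees one entry.
\<close>

definition suslin :: "'a set set \<Rightarrow> 'a set \<Rightarrow> bool" where
  "suslin \<C> S \<longleftrightarrow> (\<exists>A :: nat \<Rightarrow> (nat \<Rightarrow> nat) \<Rightarrow> 'a set.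
     (\<forall>n a. A n a \<in> \<C>) \<and> (\<forall>n a b. (\<forall>i\<le>n. a i = b i) \<longrightarrow> A n a = A n b) \<and>
     S = {w. \<exists>a. \<forall>n. w \<in> A n a})"

lemma suslinI:
  fixes A :: "nat \<Rightarrow> (nat \<Rightarrow> nat) \<Rightarrow> 'a set"
  assumes "\<And>n a. A n a \<in> \<C>" "\<And>n a b. (\<And>i. i \<le> n \<Longrightarrow> a i = b i) \<Longrightarrow> A n a = A n b"
    "S = {w. \<exists>a. \<forall>n. w \<in> A n a}"
  shows "suslin \<C> S"
  unfolding suslin_def using assms by (intro exI[of _ A]) blast

lemma suslin_base: "C \<in> \<C> \<Longrightarrow> suslin \<C> C"
  by (rule suslinI[of "\<lambda>_ _. C"]) auto

lemma suslinE:
  assumes "suslin \<C> S"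
  obtains A :: "nat \<Rightarrow> (nat \<Rightarrow> nat) \<Rightarrow> 'a set" where "\<And>n a. A n a \<in> \<C>"
    "\<And>n a b. (\<forall>i\<le>n. a i = b i) \<Longrightarrow> A n a = A n b"
    "S = {w. \<exists>a. \<forall>n. w \<in> A n a}"
  using assms unfolding suslin_def by (elim exE conjE) (rule that, simp_all)

lemma suslin_schemes:
  assumes "\<And>k::nat. suslin \<C> (S k)"
  obtains A :: "nat \<Rightarrow> nat \<Rightarrow> (nat \<Rightarrow> nat) \<Rightarrow> 'a set" where "\<And>k n a. A k n a \<in> \<C>"
    "\<And>k n a b. (\<forall>i\<le>n. a i = b i) \<Longrightarrow> A k n a = A k n b"
    "\<And>k. S k = {w. \<exists>a. \<forall>n. w \<in> A k n a}"
proof -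
  have "\<forall>k. \<exists>A :: nat \<Rightarrow> (nat \<Rightarrow> nat) \<Rightarrow> 'a set.
     (\<forall>n a. A n a \<in> \<C>) \<and> (\<forall>n a b. (\<forall>i\<le>n. a i = b i) \<longrightarrow> A n a = A n b) \<and>
     S k = {w. \<exists>a. \<forall>n. w \<in> A n a}"
    using assms unfolding suslin_def by blast
  from choice[OF this] obtain A :: "nat \<Rightarrow> nat \<Rightarrow> (nat \<Rightarrow> nat) \<Rightarrow> 'a set"
    where A: "\<forall>k. (\<forall>n a. A k n a \<in> \<C>) \<and>
     (\<forall>n a b. (\<forall>i\<le>n. a i = b i) \<longrightarrow> A k n a = A k n b) \<and>
     S k = {w. \<exists>a. \<forall>n. w \<in> A k n a}" by auto
  show ?thesis by (rule that[of A]) (use A in blast)+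
qed

text \<open>
  The index of the member of the union is carried along in the entries of the branch, of which
  only the first one is consulted.
\<close>

lemma suslin_UN:
  assumes "\<And>k::nat. suslin \<C> (S k)"
  shows "suslin \<C> (\<Union>k. S k)"
proof -
  obtain A :: "nat \<Rightarrow> nat \<Rightarrow> (nat \<Rightarrow> nat) \<Rightarrow> _" where A: "\<And>k n a. A k n a \<in> \<C>"
    "\<And>k n a b. (\<forall>i\<le>n. a i = b i) \<Longrightarrow> A k n a = A k n b"
    "\<And>k. S k = {w. \<exists>a. \<forall>n. w \<in> A k n a}"
    by (rule suslin_schemes[of \<C> S, OF assms]) (rule that; assumption)
  define B where "B n a = A (fst (prod_decode (a 0))) n (\<lambda>i. snd (prod_decode (a i)))" for n a
  show ?thesis
  proof (rule suslinI[of B])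
    show "B n a \<in> \<C>" for n a by (simp add: B_def A)
    show "B n a = B n b" if "\<And>i. i \<le> n \<Longrightarrow> a i = b i" for n a b
    proof -
      have "a 0 = b 0" using that by simp
      have "\<forall>i\<le>n. snd (prod_decode (a i)) = snd (prod_decode (b i))" using that by simp
      then show ?thesis unfolding B_def \<open>a 0 = b 0\<close> by (rule A(2))
    qed
    show "(\<Union>k. S k) = {w. \<exists>a. \<forall>n. w \<in> B n a}"
    proof safe
      fix w k assume "w \<in> S k"
      then obtain a where "\<And>n. w \<in> A k n a" unfolding A(3) by auto
      then have "\<forall>n. w \<in> B n (\<lambda>i. prod_encode (k, a i))" by (simp add: B_def)
      then show "\<exists>a. \<forall>n. w \<in> B n a" by blast
    next
      fix w a assume "\<forall>n. w \<in> B n a"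
      then show "w \<in> (\<Union>k. S k)" unfolding A(3) B_def by blast
    qed
  qed
qed

text \<open>
  One branch encodes countably many branches through the pairing function. The level
  \<open>prod_encode (k, n)\<close> may look at the entries \<open>prod_encode (k, j)\<close> with \<open>j \<le> n\<close> because the pairing
  function is monotone in its second argument.
\<close>

lemma suslin_INT:
  assumes "\<And>k::nat. suslin \<C> (S k)"
  shows "suslin \<C> (\<Inter>k. S k)"
proof -
  obtain A :: "nat \<Rightarrow> nat \<Rightarrow> (nat \<Rightarrow> nat) \<Rightarrow> _" where A: "\<And>k n a. A k n a \<in> \<C>"
    "\<And>k n a b. (\<forall>i\<le>n. a i = b i) \<Longrightarrow> A k n a = A k n b"
    "\<And>k. S k = {w. \<exists>a. \<forall>n. w \<in> A k n a}"
    by (rule suslin_schemes[of \<C> S, OF assms]) (rule that; assumption)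
  define B where "B m a = (case prod_decode m of (k, n) \<Rightarrow> A k n (\<lambda>j. a (prod_encode (k, j))))" for m a
  have B: "B (prod_encode (k, n)) a = A k n (\<lambda>j. a (prod_encode (k, j)))" for k n a
    by (simp add: B_def)
  show ?thesis
  proof (rule suslinI[of B])
    show "B n a \<in> \<C>" for n a by (simp add: B_def A split: prod.split)
    show "B m a = B m b" if *: "\<And>i. i \<le> m \<Longrightarrow> a i = b i" for m a b
    proof -
      obtain k n where m: "m = prod_encode (k, n)" by (metis prod_decode_inverse surj_pair)
      have mono: "mono triangle" by (rule incseq_SucI) simp
      have le: "prod_encode (k, j) \<le> m" if "j \<le> n" for j
        using monoD[OF mono, of "k + j" "k + n"] that by (simp add: m prod_encode_def)
      have "\<forall>j\<le>n. a (prod_encode (k, j)) = b (prod_encode (k, j))" using *[OF le] by simp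
      then show ?thesis unfolding m B by (rule A(2))
    qed
    show "(\<Inter>k. S k) = {w. \<exists>a. \<forall>n. w \<in> B n a}"
    proof safe
      fix w assume "w \<in> (\<Inter>k. S k)"
      then have "\<forall>k. \<exists>a. \<forall>n. w \<in> A k n a" unfolding A(3) by simp
      from choice[OF this] obtain a where a: "\<And>k n. w \<in> A k n (a k)" by auto
      have "\<forall>n. w \<in> B n (\<lambda>m. case prod_decode m of (k, j) \<Rightarrow> a k j)"
        using a by (auto simp: B_def split: prod.split)
      then show "\<exists>a. \<forall>n. w \<in> B n a" by blast
    next
      fix w a k assume *: "\<forall>n. w \<in> B n a"
      have "\<forall>n. w \<in> A k n (\<lambda>j. a (prod_encode (k, j)))" using * by (simp flip: B)
      then show "w \<in> S k" unfolding A(3) by blast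
    qed
  qed
qed

lemma suslin_Un:
  assumes "suslin \<C> S" "suslin \<C> T" shows "suslin \<C> (S \<union> T)"
proof -
  have "S \<union> T = (\<Union>k::nat. if k = 0 then S else T)" by (auto split: if_splits)
  then show ?thesis using suslin_UN[of \<C> "\<lambda>k. if k = 0 then S else T"] assms by auto
qed

text \<open>
  The sets that are Suslin together with their complements form a \<open>\<sigma>\<close>-algebra, by closure under
  countable unions and intersections.
\<close>

lemma suslin_sigma_sets:
  assumes \<C>: "\<C> \<subseteq> Pow \<Omega>" "{} \<in> \<C>" "\<And>C. C \<in> \<C> \<Longrightarrow> suslin \<C> (\<Omega> - C)"
    and S: "S \<in> sigma_sets \<Omega> \<C>"
  shows "suslin \<C> S"
proof -
  have "suslin \<C> S \<and> suslin \<C> (\<Omega> - S)" using S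
  proof (induction S rule: sigma_sets.induct)
    case (Basic a) then show ?case using \<C> suslin_base by blast
  next
    case Empty then show ?case using \<C> suslin_base[of "{}" \<C>] by blast
  next
    case (Compl a)
    moreover from this have "\<Omega> - (\<Omega> - a) = a" using \<C> sigma_sets_into_sp by blast
    ultimately show ?case by simp
  next
    case (Union a)
    have "\<Omega> - (\<Union>i. a i) = (\<Inter>i. \<Omega> - a i)" by auto
    then show ?case using Union suslin_UN[of \<C> a] suslin_INT[of \<C> "\<lambda>i. \<Omega> - a i"] by auto
  qed
  then show ?thesis ..
qed

text \<open>
  Koenig's lemma: the box \<open>\<Prod>i. {0..k i}\<close> is compact. At each stage one of the finitely many
  admissible next entries keeps arbitrarily high levels reachable.
\<close>

lemma koenig_box:
  fixes D :: "nat \<Rightarrow> (nat \<Rightarrow> nat) \<Rightarrow> bool" and k :: "nat \<Rightarrow> nat"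
  assumes dep: "\<And>n a b. (\<And>i. i \<le> n \<Longrightarrow> a i = b i) \<Longrightarrow> D n a \<Longrightarrow> D n b"
    and mono: "\<And>m n a. m \<le> n \<Longrightarrow> D n a \<Longrightarrow> D m a"
    and ex: "\<And>n. \<exists>a. (\<forall>i\<le>n. a i \<le> k i) \<and> D n a"
  shows "\<exists>a. \<forall>n. D n a"
proof -
  define P where "P n c \<longleftrightarrow> (\<forall>m. \<exists>a. (\<forall>i<n. a i = c i) \<and> (\<forall>i\<le>m. a i \<le> k i) \<and> D m a)" for n c
  obtain c where c: "\<And>n. P n c"
  proof (rule prefix_choice[of P])
    show "P n d" if "\<And>i. i < n \<Longrightarrow> c i = d i" "P n c" for n c d
      using that unfolding P_def by metis
    show "P 0 (\<lambda>_. 0)" using ex by (auto simp: P_def)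
    show "\<exists>j. P (Suc n) (c(n := j))" if "P n c" for n c
    proof (rule ccontr)
      assume "\<not> ?thesis"
      then have "\<forall>j. \<exists>m. \<not> (\<exists>a. (\<forall>i<Suc n. a i = (c(n:=j)) i) \<and> (\<forall>i\<le>m. a i \<le> k i) \<and> D m a)"
        unfolding P_def by blast
      then obtain m where m: "\<And>j. \<not> (\<exists>a. (\<forall>i<Suc n. a i = (c(n:=j)) i) \<and> (\<forall>i\<le>m j. a i \<le> k i)
        \<and> D (m j) a)"
        by metis
      define N where "N = max n (Max (m ` {..k n}))"
      obtain a where a: "\<forall>i<n. a i = c i" "\<forall>i\<le>N. a i \<le> k i" "D N a"
        using \<open>P n c\<close> unfolding P_def by blast
      have "a n \<le> k n" using a(2) by (simp add: N_def)
      then have "m (a n) \<le> N" by (simp add: N_def le_max_iff_disj)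
      then have "(\<forall>i<Suc n. a i = (c(n:=a n)) i) \<and> (\<forall>i\<le>m (a n). a i \<le> k i) \<and> D (m (a n)) a"
        using a mono by (auto simp: less_Suc_eq)
      then show False using m by blast
    qed
  qed (use that in blast)
  have "D n c" for n
  proof -
    obtain a where "\<forall>i<Suc n. a i = c i" "D n a" using c[of "Suc n"] unfolding P_def by blast
    then show ?thesis using dep[of n a c] by simp
  qed
  then show ?thesis by blast
qed

text \<open>
  The heart of the measurability of Suslin sets. Restricting the branches to \<open>a 0 \<le> k 0\<close>, then to
  \<open>a 1 \<le> k 1\<close>, and so on, exhausts the set from below, so continuity of the outer measure allows the
  bounds to be chosen without falling below \<open>r\<close>. What remains is contained in finite unions
  \<open>U n k\<close> of measurable sets, and by compactness of the box the intersection of these unions lies in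
  the Suslin set again.
\<close>

lemma suslin_inner_approx:
  assumes "finite_measure M" and S: "suslin (sets M) S" and r: "r < outer_measure_of M S"
  shows "\<exists>B\<in>sets M. B \<subseteq> S \<and> r \<le> emeasure M B"
proof -
  interpret finite_measure M by fact
  obtain A :: "nat \<Rightarrow> (nat \<Rightarrow> nat) \<Rightarrow> _" where A: "\<And>n a. A n a \<in> sets M"
    "\<And>n a b. (\<forall>i\<le>n. a i = b i) \<Longrightarrow> A n a = A n b" "S = {w. \<exists>a. \<forall>n. w \<in> A n a}"
    by (rule suslinE[OF S]) (rule that; assumption)
  define D where "D n a = (\<Inter>m\<in>{..n}. A m a)" for n a
  have D_sets: "D n a \<in> sets M" for n a unfolding D_def using A by auto
  have D_dep: "D n a = D n b" if "\<And>i. i \<le> n \<Longrightarrow> a i = b i" for n a b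
    unfolding D_def using A(2) that by (intro INF_cong) auto
  have D_mono: "D n a \<subseteq> D m a" if "m \<le> n" for m n a unfolding D_def using that by auto
  have S_D: "S = {w. \<exists>a. \<forall>n. w \<in> D n a}" unfolding A(3) D_def by auto
  define T where "T n k = {w. \<exists>a. (\<forall>i<n. a i \<le> k i) \<and> (\<forall>m. w \<in> D m a)}" for n k
  define U where "U n k = {w. \<exists>a. (\<forall>i\<le>n. a i \<le> k i) \<and> w \<in> D n a}" for n k
  have T_space: "T n k \<subseteq> space M" for n k
    unfolding T_def using D_sets sets.sets_into_space by blast
  obtain k where k: "\<And>n. r < outer_measure_of M (T n k)"
  proof (rule prefix_choice[of "\<lambda>n k. r < outer_measure_of M (T n k)"])
    show "r < outer_measure_of M (T n d)"
      if "\<And>i. i < n \<Longrightarrow> c i = d i" "r < outer_measure_of M (T n c)" for n c d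
    proof -
      have "T n c = T n d" unfolding T_def using that(1) by auto
      then show ?thesis using that by simp
    qed
    have "T 0 (\<lambda>_. 0) = S" by (simp add: T_def S_D)
    then show "r < outer_measure_of M (T 0 (\<lambda>_. 0))" using r by simp
    show "\<exists>j. r < outer_measure_of M (T (Suc n) (c(n := j)))"
      if "r < outer_measure_of M (T n c)" for n c
    proof -
      have T_mono: "T m b \<subseteq> T m b'" if "\<And>i. i < m \<Longrightarrow> b i \<le> b' i" for m b b'
        unfolding T_def using that order_trans by blast
      have "incseq (\<lambda>j. T (Suc n) (c(n := j)))"
        by (intro incseq_SucI T_mono) (simp add: less_Suc_eq)
      moreover have "(\<Union>j. T (Suc n) (c(n := j))) = T n c"
      proof
        show "T n c \<subseteq> (\<Union>j. T (Suc n) (c(n := j)))"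
        proof
          fix w assume "w \<in> T n c"
          then obtain a where a: "\<forall>i<n. a i \<le> c i" "\<forall>m. w \<in> D m a" unfolding T_def by blast
          then have "\<forall>i<Suc n. a i \<le> (c(n := a n)) i" by (simp add: less_Suc_eq)
          then have "w \<in> T (Suc n) (c(n := a n))" using a unfolding T_def by blast
          then show "w \<in> (\<Union>j. T (Suc n) (c(n := j)))" by blast
        qed
        have "T (Suc n) (c(n := j)) \<subseteq> T n c" for j
        proof
          fix w assume "w \<in> T (Suc n) (c(n := j))"
          then obtain a where a: "\<forall>i<Suc n. a i \<le> (c(n := j)) i" "\<forall>m. w \<in> D m a" unfolding T_def
            by blast
          have "\<forall>i<n. a i \<le> c i" using a(1) by (metis fun_upd_other less_SucI nat_neq_iff)
          then show "w \<in> T n c" using a(2) unfolding T_def by blast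
        qed
        then show "(\<Union>j. T (Suc n) (c(n := j))) \<subseteq> T n c" by blast
      qed
      ultimately have "(SUP j. outer_measure_of M (T (Suc n) (c(n := j)))) = outer_measure_of M (T n c)"
        using SUP_outer_measure_of_incseq[of "\<lambda>j. T (Suc n) (c(n := j))" M] T_space by simp
      then show ?thesis using that by (metis less_SUP_iff)
    qed
  qed (use that in blast)
  have U_sets: "U n k \<in> sets M" for n
  proof -
    have "U n k = (\<Union>a\<in>Pi\<^sub>E {..n} (\<lambda>i. {..k i}). D n a)"
    proof safe
      fix w assume "w \<in> U n k"
      then obtain a where a: "\<forall>i\<le>n. a i \<le> k i" "w \<in> D n a" by (auto simp: U_def)
      have "w \<in> D n (restrict a {..n})" using a(2) D_dep[of n a "restrict a {..n}"] by simp
      moreover have "restrict a {..n} \<in> Pi\<^sub>E {..n} (\<lambda>i. {..k i})" using a by auto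
      ultimately show "w \<in> (\<Union>a\<in>Pi\<^sub>E {..n} (\<lambda>i. {..k i}). D n a)" by blast
    qed (auto simp: U_def PiE_def Pi_def)
    then show ?thesis
      using D_sets by (auto intro!: sets.finite_UN finite_PiE)
  qed
  have "decseq (\<lambda>n. U n k)"
  proof (intro decseq_SucI subsetI)
    fix n w assume "w \<in> U (Suc n) k"
    then obtain a where a: "\<forall>i\<le>Suc n. a i \<le> k i" "w \<in> D (Suc n) a" unfolding U_def by blast
    then have "w \<in> D n a" using D_mono[of n "Suc n" a] by auto
    moreover have "\<forall>i\<le>n. a i \<le> k i" using a(1) by simp
    ultimately show "w \<in> U n k" unfolding U_def by blast
  qed
  have "r \<le> emeasure M (U n k)" for n
  proof -
    have "T (Suc n) k \<subseteq> U n k" unfolding T_def U_def by (auto simp: less_Suc_eq_le)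
    then have "outer_measure_of M (T (Suc n) k) \<le> emeasure M (U n k)"
      using outer_measure_of_mono[of _ _ M] U_sets by (metis outer_measure_of_eq)
    then show ?thesis using k[of "Suc n"] by order
  qed
  then have "r \<le> (INF n. emeasure M (U n k))" by (intro INF_greatest)
  also have "\<dots> = emeasure M (\<Inter>n. U n k)"
    by (rule INF_emeasure_decseq) (use U_sets \<open>decseq _\<close> in auto)
  finally have "r \<le> emeasure M (\<Inter>n. U n k)" .
  moreover have "(\<Inter>n. U n k) \<subseteq> S"
  proof
    fix w assume w: "w \<in> (\<Inter>n. U n k)"
    have "\<exists>a. \<forall>n. w \<in> D n a"
    proof (rule koenig_box[of "\<lambda>n a. w \<in> D n a" k])
      show "w \<in> D n b" if "\<And>i. i \<le> n \<Longrightarrow> a i = b i" "w \<in> D n a" for n a b using D_dep that by blast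
      show "w \<in> D m a" if "m \<le> n" "w \<in> D n a" for m n a using D_mono that by blast
      show "\<exists>a. (\<forall>i\<le>n. a i \<le> k i) \<and> w \<in> D n a" for n using w by (auto simp: U_def)
    qed
    then show "w \<in> S" by (simp add: S_D)
  qed
  ultimately show ?thesis using U_sets by (intro bexI[of _ "\<Inter>n. U n k"]) auto
qed

lemma suslin_sets:
  assumes "finite_measure M" "complete_measure M" and S: "suslin (sets M) S"
  shows "S \<in> sets M"
proof -
  interpret finite_measure M by fact
  interpret complete_measure M by fact
  have "S \<subseteq> space M" using S sets.sets_into_space unfolding suslin_def by blast
  then obtain V where V: "V \<in> sets M" "S \<subseteq> V" "outer_measure_of M S = emeasure M V"
    using outer_measure_of_attain[of S M] by blast
  define v where "v = measure M V"
  have v: "outer_measure_of M S = ennreal v" by (simp add: V v_def emeasure_eq_measure)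
  show ?thesis
  proof (cases "v = 0")
    case True
    then have "V \<in> null_sets M" using V v by auto
    then show ?thesis using V complete by blast
  next
    case False
    then have "v > 0" using v_def by (simp add: zero_less_measure_iff)
    have "\<exists>B\<in>sets M. B \<subseteq> S \<and> ennreal (v - 1 / Suc j) \<le> emeasure M B" for j
      by (rule suslin_inner_approx) (use \<open>v > 0\<close> S assms in \<open>auto simp: v ennreal_less_iff intro!:
        ennreal_lessI\<close>)
    then obtain B where B: "\<And>j. B j \<in> sets M" "\<And>j. B j \<subseteq> S" "\<And>j. ennreal (v - 1 / Suc j)
      \<le> emeasure M (B j)"
      by metis
    have "v - 1 / Suc j \<le> measure M (\<Union>j. B j)" for j
    proof -
      have "v - 1 / Suc j \<le> measure M (B j)"
        using B(3)[of j] by (simp add: emeasure_eq_measure ennreal_le_iff)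
      also have "\<dots> \<le> measure M (\<Union>j. B j)" using B by (intro finite_measure_mono) auto
      finally show ?thesis .
    qed
    moreover have "(\<lambda>j. v - 1 / Suc j) \<longlonglongrightarrow> v - 0"
      by (intro tendsto_diff tendsto_const LIMSEQ_Suc[OF lim_1_over_n])
    ultimately have "v \<le> measure M (\<Union>j. B j)"
      by (intro LIMSEQ_le_const2[of _ v]) auto
    moreover have "(\<Union>j. B j) \<subseteq> V" using B V by blast
    then have "measure M (\<Union>j. B j) \<le> v" unfolding v_def using V by (intro finite_measure_mono) auto
    ultimately have "emeasure M (\<Union>j. B j) = emeasure M V" by (simp add: v_def emeasure_eq_measure)
    then show ?thesis
      using V B by (intro complete_sets_sandwich[of "\<Union>j. B j" V S]) (auto simp: less_top[symmetric])
  qed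
qed

text \<open>
  Complements of rectangles with a closed side are Suslin since open sets of a metric space are
  countable unions of closed ones.
\<close>

lemma suslin_pair_sets:
  fixes G :: "('e \<times> 'x :: metric_space) set"
  assumes G: "G \<in> sets (M \<Otimes>\<^sub>M borel)"
  shows "suslin {B \<times> C | B C. B \<in> sets M \<and> closed C} G"
proof -
  let ?\<C> = "{B \<times> C | B C. B \<in> sets M \<and> closed (C :: 'x set)}"
  let ?\<Omega> = "space M \<times> (UNIV :: 'x set)"
  have rect: "suslin ?\<C> (B \<times> C)" if "B \<in> sets M" "closed C" for B and C :: "'x set"
    using that by (intro suslin_base) blast
  have "sets (M \<Otimes>\<^sub>M (borel :: 'x measure)) = sigma_sets ?\<Omega> ?\<C>"
  proof -
    have "sets (M \<Otimes>\<^sub>M (borel :: 'x measure))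
      = sets (sigma (space M \<times> space (borel :: 'x measure)) {a \<times> b | a b. a \<in> sets M
        \<and> b \<in> Collect closed})"
      by (rule sets_pair_eq[where Ca="{space M}" and Cb="{UNIV}"])
         (auto simp: borel_eq_closed sets.sigma_sets_eq sets.space_closed)
    then show ?thesis
      using sets.sets_into_space by (subst (asm) sets_measure_of) auto
  qed
  moreover have "suslin ?\<C> (?\<Omega> - R)" if "R \<in> ?\<C>" for R
  proof -
    obtain B and C :: "'x set" where R: "R = B \<times> C" "B \<in> sets M" "closed C" using \<open>R \<in> ?\<C>\<close> by blast
    have "gdelta_in euclidean C"
      using R(3) by (metis closed_closedin closed_imp_gdelta_in metrizable_space_euclidean)
    then have "fsigma_in euclidean (- C)"
      by (simp add: R(3) open_imp_fsigma_in metrizable_space_euclidean open_Compl)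
    then obtain K where K: "\<And>n. closed (K n)" "(\<Union>n::nat. K n) = - C"
      unfolding fsigma_in_ascending by (metis closed_closedin)
    have "?\<Omega> - R = (space M - B) \<times> UNIV \<union> (\<Union>n. space M \<times> K n)"
      using K sets.sets_into_space[OF R(2)] unfolding R(1) by auto
    then show ?thesis using R K by (auto intro!: suslin_Un suslin_UN rect)
  qed
  ultimately show ?thesis
    using G by (intro suslin_sigma_sets[of ?\<C> ?\<Omega> G]) (auto dest: sets.sets_into_space)
qed

lemma dense_sequence:
  obtains d :: "nat \<Rightarrow> 'x::{metric_space, second_countable_topology}"
    where "\<And>x e. e > 0 \<Longrightarrow> \<exists>n. dist (d n) x < e"
proof -
  obtain Q :: "'x set" where Q: "countable Q" "\<And>X. open X \<Longrightarrow> X \<noteq> {} \<Longrightarrow> \<exists>q\<in>Q. q \<in> X"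
    using countable_dense_exists by blast
  have "Q \<noteq> {}" using Q(2)[of UNIV] by auto
  have "\<exists>n. dist (from_nat_into Q n) x < e" if e: "e > 0" for x e
  proof -
    obtain q where "q \<in> Q" "q \<in> ball x e" using Q(2)[of "ball x e"] e
      by (metis centre_in_ball empty_iff open_ball)
    then show ?thesis using from_nat_into_surj[OF Q(1)] by (metis dist_commute mem_ball)
  qed
  then show ?thesis using that by blast
qed

text \<open>
  Intersecting the closed sides with balls of radius \<open>2\<^sup>-\<^sup>m\<close> around points of a dense sequence makes
  them shrink along every branch. In a complete space such a branch has a point in the intersection
  as soon as all its closed sides are nonempty, and this condition no longer mentions the point: it
  is absorbed into the sides in \<open>M\<close>.
\<close>

lemma suslin_projection:
  fixes G :: "('e \<times> 'x :: {complete_space, second_countable_topology}) set"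
  assumes G: "suslin {B \<times> C | B C. B \<in> sets M \<and> closed C} G"
  shows "suslin (sets M) (fst ` G)"
proof -
  obtain A :: "nat \<Rightarrow> (nat \<Rightarrow> nat) \<Rightarrow> _" where A: "\<And>n a. A n a \<in> {B \<times> C | B C. B \<in> sets M
    \<and> closed (C :: 'x set)}"
    "\<And>n a b. (\<forall>i\<le>n. a i = b i) \<Longrightarrow> A n a = A n b" "G = {w. \<exists>a. \<forall>n. w \<in> A n a}"
    by (rule suslinE[OF G]) (rule that; assumption)
  have "\<forall>R. \<exists>b. R \<in> {B \<times> C | B C. B \<in> sets M \<and> closed (C :: 'x set)} \<longrightarrow>
      fst b \<in> sets M \<and> closed (snd b) \<and> R = fst b \<times> snd b"
    by fastforce
  from choice[OF this] obtain side :: "('e \<times> 'x) set \<Rightarrow> 'e set \<times> 'x set"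
    where side: "\<And>R. R \<in> {B \<times> C | B C. B \<in> sets M \<and> closed (C :: 'x set)} \<Longrightarrow>
      fst (side R) \<in> sets M \<and> closed (snd (side R)) \<and> R = fst (side R) \<times> snd (side R)"
    by blast
  define B where "B n a = fst (side (A n a))" for n a
  define C where "C n a = snd (side (A n a))" for n a
  have BC: "B n a \<in> sets M" "closed (C n a)" "A n a = B n a \<times> C n a" for n a
    using side[OF A(1)[of n a]] by (auto simp: B_def C_def)
  have BC_dep: "B n a = B n b" "C n a = C n b" if "\<forall>i\<le>n. a i = b i" for n a b
    using A(2)[OF that] by (simp_all add: B_def C_def)
  obtain d :: "nat \<Rightarrow> 'x" where d: "\<And>x e. e > 0 \<Longrightarrow> \<exists>n. dist (d n) x < e"
    by (rule dense_sequence) (rule that; assumption)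
  define K where "K n a b = (\<Inter>m\<in>{..n}. C m a \<inter> cball (d (b m)) ((1/2)^m))" for n and a b :: "nat \<Rightarrow> nat"
  define l where "l c i = fst (prod_decode (c i))" for c :: "nat \<Rightarrow> nat" and i :: nat
  define r where "r c i = snd (prod_decode (c i))" for c :: "nat \<Rightarrow> nat" and i :: nat
  define R where "R n c = (if K n (l c) (r c) = {} then {} else B n (l c))" for n c
  show ?thesis
  proof (rule suslinI[of R])
    show "R n c \<in> sets M" for n c by (simp add: R_def BC)
    show "R n c = R n c'" if c: "\<And>i. i \<le> n \<Longrightarrow> c i = c' i" for n c c'
    proof -
      have "K n (l c) (r c) = K n (l c') (r c')"
        unfolding K_def using c by (intro INF_cong arg_cong2[where f="(\<inter>)"] BC_dep)
          (auto simp: l_def r_def)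
      moreover have "B n (l c) = B n (l c')" using c by (intro BC_dep) (auto simp: l_def)
      ultimately show ?thesis by (simp add: R_def)
    qed
    show "fst ` G = {s. \<exists>c. \<forall>n. s \<in> R n c}"
    proof safe
      fix s t assume "(s, t) \<in> G"
      then have "\<exists>a. \<forall>n. s \<in> B n a \<and> t \<in> C n a" unfolding A(3) BC(3) by simp
      then obtain a where a: "\<And>n. s \<in> B n a" "\<And>n. t \<in> C n a" by blast
      have "\<forall>m. \<exists>i. dist (d i) t < (1/2)^m" using d by simp
      then obtain b where b: "\<And>m. dist (d (b m)) t < (1/2)^m" by metis
      define c where "c i = prod_encode (a i, b i)" for i
      have "l c = a" "r c = b" by (auto simp: l_def r_def c_def)
      moreover have "t \<in> K n a b" for n unfolding K_def using a(2) b by (auto intro: less_imp_le)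
      ultimately have "\<forall>n. s \<in> R n c" using a(1) by (auto simp: R_def)
      then show "\<exists>c. \<forall>n. fst (s, t) \<in> R n c" by auto
    next
      fix s c assume c: "\<forall>n. s \<in> R n c"
      obtain t where t: "\<And>n. t \<in> K n (l c) (r c)"
      proof (rule decreasing_closed_nest[of "\<lambda>n. K n (l c) (r c)"])
        show "closed (K n (l c) (r c))" for n
          unfolding K_def by (intro closed_INT ballI closed_Int BC closed_cball)
        show "K n (l c) (r c) \<noteq> {}" for n using c by (auto simp: R_def split: if_splits)
        show "K n (l c) (r c) \<subseteq> K m (l c) (r c)" if "m \<le> n" for m n unfolding K_def using that by auto
        show "\<exists>n. \<forall>x\<in>K n (l c) (r c). \<forall>y\<in>K n (l c) (r c). dist x y < e" if e: "e > 0" for e :: real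
        proof -
          obtain n where n: "(1/2)^n < e / 2" using real_arch_pow_inv[of "e/2" "1/2"] e by auto
          have "dist x y < e" if "x \<in> K n (l c) (r c)" "y \<in> K n (l c) (r c)" for x y
          proof -
            have "dist (d (r c n)) x \<le> (1/2)^n" "dist (d (r c n)) y \<le> (1/2)^n"
              using that unfolding K_def by auto
            then show ?thesis using dist_triangle3[of x y "d (r c n)"] n by linarith
          qed
          then show ?thesis by blast
        qed
      qed (use that in blast)
      have "t \<in> C n (l c)" for n using t[of n] by (auto simp: K_def)
      moreover have "s \<in> B n (l c)" for n using c by (auto simp: R_def split: if_splits)
      ultimately have "(s, t) \<in> G" unfolding A(3) BC(3) by blast
      then show "s \<in> fst ` G" by force
    qed
  qed
qed

text \<open>
  A section-wise existential quantifier over a Polish space preserves measurability on a complete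
  finite measure space. It is needed because minimizing a jointly measurable integrand over the
  Hilbert space takes an uncountable infimum.
\<close>

theorem measurable_projection:
  fixes G :: "('e \<times> 'x :: {complete_space, second_countable_topology}) set"
  assumes "finite_measure M" "complete_measure M" "G \<in> sets (M \<Otimes>\<^sub>M borel)"
  shows "fst ` G \<in> sets M"
  using suslin_sets suslin_projection suslin_pair_sets assms by blast

section \<open>Proximal points of convex functions\<close>

lemma lsc_eventually_gt:
  assumes "lsc g" "r < g x"
  shows "\<forall>\<^sub>F y in nhds x. r < g y"
proof -
  have "r < Liminf (at x) g" using assms unfolding lsc_def by (meson order_less_le_trans)
  then have "\<forall>\<^sub>F y in at x. r < g y" by (rule less_LiminfD)
  then show ?thesis
    unfolding eventually_at_filter by eventually_elim (use assms(2) in auto)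
qed

lemma lsc_le_lim:
  assumes g: "lsc g" and X: "(X \<longlongrightarrow> x) A" and c: "(c \<longlongrightarrow> l) A" and A: "A \<noteq> bot"
    and le: "\<forall>\<^sub>F n in A. g (X n) \<le> ereal (c n)"
  shows "g x \<le> ereal l"
proof (rule ccontr)
  assume "\<not> ?thesis"
  then obtain r where r: "l < r" "ereal r < g x"
    by (metis ereal_dense2 less_ereal.simps(1) not_le_imp_less)
  have "\<forall>\<^sub>F n in A. ereal r < g (X n)"
    using lsc_eventually_gt[OF g r(2)] X by (rule eventually_compose_filterlim)
  moreover have "\<forall>\<^sub>F n in A. c n < r" using c r(1) by (rule order_tendstoD)
  ultimately have "\<forall>\<^sub>F n in A. False"
    using le
  proof eventually_elim
    case (elim n)
    then have "ereal r < ereal (c n)" by order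
    then show ?case using elim(2) by simp
  qed
  then show False using A by simp
qed

lemma closed_epigraph:
  fixes g :: "'h::first_countable_topology \<Rightarrow> ereal"
  assumes "lsc g"
  shows "closed {(x, r :: real). g x \<le> ereal r}"
  unfolding closed_sequential_limits
proof (intro allI impI, elim conjE)
  fix X l assume X: "\<forall>n. X n \<in> {(x, r). g x \<le> ereal r}" and l: "X \<longlonglongrightarrow> l"
  have "g (fst l) \<le> ereal (snd l)"
    by (rule lsc_le_lim[OF assms tendsto_fst[OF l] tendsto_snd[OF l]])
      (use X in \<open>auto simp: case_prod_beta\<close>)
  then show "l \<in> {(x, r). g x \<le> ereal r}" by (simp add: case_prod_beta)
qed

lemma convex_funD:
  assumes "convex_fun g" "g x \<le> ereal r" "g y \<le> ereal t" "0 \<le> u" "u \<le> 1"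
  shows "g ((1 - u) *\<^sub>R x + u *\<^sub>R y) \<le> ereal ((1 - u) * r + u * t)"
proof -
  have "(1 - u) *\<^sub>R (x, r) + u *\<^sub>R (y, t) \<in> {(x, r). g x \<le> ereal r}"
    using assms unfolding convex_fun_def by (intro convexD) auto
  then show ?thesis by simp
qed

text \<open>
  Near a point \<open>x0\<close> of the domain lower semicontinuity bounds \<open>g\<close> below by \<open>g x0 - 1\<close>, and convexity
  along the segments from \<open>x0\<close> propagates this to a bound that decreases at most linearly. This
  replaces an affine minorant obtained from the Hahn-Banach theorem.
\<close>

lemma lsc_convex_lower_bound:
  fixes g :: "'h::real_normed_vector \<Rightarrow> ereal"
  assumes lsc: "lsc g" and "proper g" and conv: "convex_fun g"
  obtains a b x0 where "b \<ge> 0" "\<And>t. ereal (a - b * norm (t - x0)) \<le> g t"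
proof -
  obtain x0 g0 where g0: "g x0 = ereal g0"
    using \<open>proper g\<close> unfolding proper_def by (metis ereal_cases)
  have "ereal (g0 - 1) < g x0" by (simp add: g0)
  from lsc_eventually_gt[OF lsc this] obtain d
    where d: "d > 0" "\<And>y. dist y x0 < d \<Longrightarrow> ereal (g0 - 1) < g y"
    unfolding eventually_nhds_metric by blast
  define \<delta> where "\<delta> = d / 2"
  have \<delta>: "0 < \<delta>" "\<delta> < d" using d by (auto simp: \<delta>_def)
  have "ereal (g0 - 1 - 1 / \<delta> * norm (t - x0)) \<le> g t" for t
  proof (cases "norm (t - x0) \<le> \<delta>")
    case True
    then have "ereal (g0 - 1) < g t" using d(2) \<delta> by (simp add: dist_norm)
    moreover have "g0 - 1 - 1 / \<delta> * norm (t - x0) \<le> g0 - 1" using \<delta> by simp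
    ultimately show ?thesis by (meson ereal_less_eq(3) le_less order_trans)
  next
    case False
    show ?thesis
    proof (cases "g t")
      case (real r)
      define \<theta> where "\<theta> = \<delta> / norm (t - x0)"
      have n: "norm (t - x0) > 0" using False \<delta> by linarith
      have \<theta>: "0 < \<theta>" "\<theta> \<le> 1" using False \<delta> n by (auto simp: \<theta>_def)
      have "(1 - \<theta>) *\<^sub>R x0 + \<theta> *\<^sub>R t - x0 = \<theta> *\<^sub>R (t - x0)" by (simp add: algebra_simps)
      then have "dist ((1 - \<theta>) *\<^sub>R x0 + \<theta> *\<^sub>R t) x0 = \<delta>" using \<theta> n \<delta> by (simp add: dist_norm \<theta>_def)
      then have "ereal (g0 - 1) < g ((1 - \<theta>) *\<^sub>R x0 + \<theta> *\<^sub>R t)" using d(2) \<delta> by simp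
      also have "\<dots> \<le> ereal ((1 - \<theta>) * g0 + \<theta> * r)"
        using conv g0 real \<theta> by (intro convex_funD) auto
      finally have "\<theta> * g0 - 1 \<le> \<theta> * r" by (simp add: algebra_simps)
      then have "(\<theta> * g0 - 1) / \<theta> \<le> r" using \<theta> by (simp add: divide_le_eq mult.commute)
      moreover have "(\<theta> * g0 - 1) / \<theta> = g0 - 1 / \<delta> * norm (t - x0)"
        using \<theta> n \<delta> by (simp add: \<theta>_def field_simps)
      ultimately show ?thesis using real by simp
    next
      case MInf then show ?thesis using \<open>proper g\<close> by (simp add: proper_def)
    qed simp
  qed
  then show ?thesis using that[of "1 / \<delta>" "g0 - 1" x0] \<delta> by auto
qed

text \<open>
  A minimizing sequence of a linear functional plus a squared distance over a closed convex set is
  Cauchy by the parallelogram identity. It is stated for sets in the product space so that it covers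
  epigraphs, for proximal points, and cylinders over closed convex sets, for points of least norm.
\<close>

lemma proximal_point_exists:
  fixes K :: "('h::{real_inner, banach} \<times> real) set"
  assumes K: "closed K" "convex K" "K \<noteq> {}" and "c > 0" "b \<ge> 0"
    and bound: "\<And>t r. (t, r) \<in> K \<Longrightarrow> a - b * norm (t - x0) \<le> r"
  shows "\<exists>p r. (p, r) \<in> K \<and> (\<forall>t v. (t, v) \<in> K \<longrightarrow>
           c * r + 1/2 * (norm (p - x))\<^sup>2 \<le> c * v + 1/2 * (norm (t - x))\<^sup>2)"
proof -
  define h where "h = (\<lambda>(t, r). c * r + 1/2 * (norm (t - x))\<^sup>2)"
  \<comment> \<open>Completing the square in \<open>norm (t - x)\<close> bounds the objective below by \<open>B\<close>.\<close>
  define B where "B = c * a - c * b * norm (x - x0) - 1/2 * (c * b)\<^sup>2"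
  have "B \<le> h k" if "k \<in> K" for k
  proof -
    obtain t r where k: "k = (t, r)" by force
    have "norm (t - x0) \<le> norm (t - x) + norm (x - x0)"
      using norm_triangle_ineq[of "t - x" "x - x0"] by simp
    then have "b * norm (t - x0) \<le> b * norm (t - x) + b * norm (x - x0)"
      using \<open>b \<ge> 0\<close> by (metis mult_left_mono distrib_left)
    moreover have "a - b * norm (t - x0) \<le> r" using bound that k by simp
    ultimately have "c * (a - b * norm (t - x) - b * norm (x - x0)) \<le> c * r"
      using \<open>c > 0\<close> by (intro mult_left_mono) auto
    moreover have "0 \<le> (norm (t - x) - c * b)\<^sup>2" by simp
    ultimately show ?thesis
      by (simp add: B_def h_def k power2_eq_square algebra_simps)
  qed
  then have bdd: "bdd_below (h ` K)" by (rule bdd_belowI2)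
  define m where "m = Inf (h ` K)"
  have m_le: "m \<le> h k" if "k \<in> K" for k unfolding m_def using bdd that by (intro cINF_lower)
  have "\<exists>k\<in>K. h k < m + 1 / Suc n" for n
  proof -
    have "Inf (h ` K) < m + 1 / Suc n" by (simp add: m_def)
    then show ?thesis using K bdd by (subst (asm) cInf_less_iff) auto
  qed
  then obtain k where k: "\<And>n. k n \<in> K" "\<And>n. h (k n) < m + 1 / Suc n" by metis
  define t r where "t n = fst (k n)" and "r n = snd (k n)" for n
  have h_k: "h (k n) = c * r n + 1/2 * (norm (t n - x))\<^sup>2" for n
    by (simp add: h_def t_def r_def case_prod_beta)
  have parallelogram: "(norm (t i - t j))\<^sup>2 \<le> 4 * (h (k i) - m) + 4 * (h (k j) - m)" for i j
  proof -
    define q where "q = (1/2) *\<^sub>R k i + (1/2) *\<^sub>R k j"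
    have "q \<in> K" unfolding q_def using K k by (intro convexD) auto
    then have "m \<le> h q" by (rule m_le)
    also have "h q = c * (1/2 * r i + 1/2 * r j) + 1/2 * (norm ((1/2) *\<^sub>R (t i - x)
      + (1/2) *\<^sub>R (t j - x)))\<^sup>2"
    proof -
      have "(1/2) *\<^sub>R (t i - x) + (1/2) *\<^sub>R (t j - x) = (1/2) *\<^sub>R t i + (1/2) *\<^sub>R t j - x"
        by (simp add: algebra_simps flip: scaleR_add_left)
      then show ?thesis by (simp add: h_def q_def t_def r_def case_prod_beta)
    qed
    also have "1/2 * (norm ((1/2) *\<^sub>R (t i - x) + (1/2) *\<^sub>R (t j - x)))\<^sup>2
        = 1/4 * (norm (t i - x))\<^sup>2 + 1/4 * (norm (t j - x))\<^sup>2 - 1/8 * (norm ((t i - x) - (t j - x)))\<^sup>2"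
      unfolding power2_norm_eq_inner by (simp add: inner_add inner_diff inner_commute algebra_simps)
    finally show ?thesis by (simp add: h_k algebra_simps)
  qed
  have "Cauchy t"
  proof (rule metric_CauchyI)
    fix e :: real assume "e > 0"
    obtain N where "8 / e\<^sup>2 < real N" using reals_Archimedean2 by blast
    then have "8 / e\<^sup>2 < real (Suc N)" by simp
    then have N: "8 / Suc N < e\<^sup>2" using \<open>e > 0\<close>
      by (simp add: divide_less_eq mult.commute del: of_nat_Suc)
    have "dist (t i) (t j) < e" if "i \<ge> N" "j \<ge> N" for i j
    proof -
      have "h (k i') - m \<le> 1 / Suc N" if "i' \<ge> N" for i'
      proof -
        have "1 / Suc i' \<le> 1 / Suc N" using that by (simp add: frac_le)
        then show ?thesis using k(2)[of i'] by linarith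
      qed
      from this[OF that(1)] this[OF that(2)] have "(norm (t i - t j))\<^sup>2 \<le> 8 / Suc N"
        using parallelogram[of i j] by simp
      then have "(norm (t i - t j))\<^sup>2 < e\<^sup>2" using N by linarith
      then show ?thesis using \<open>e > 0\<close> by (simp add: dist_norm power_less_imp_less_base)
    qed
    then show "\<exists>M. \<forall>i\<ge>M. \<forall>j\<ge>M. dist (t i) (t j) < e" by blast
  qed
  then obtain p where p: "t \<longlonglongrightarrow> p" using Cauchy_convergent convergentD by blast
  have h_lim: "(\<lambda>n. h (k n)) \<longlonglongrightarrow> m"
  proof (rule tendsto_sandwich[of "\<lambda>_. m" _ _ "\<lambda>n. m + 1 / Suc n"])
    show "(\<lambda>n. m + 1 / Suc n) \<longlonglongrightarrow> m"
      using tendsto_add[OF tendsto_const[of m] LIMSEQ_Suc[OF lim_1_over_n[where 'a=real]]] by simp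
  qed (use k m_le in \<open>auto intro!: always_eventually less_imp_le\<close>)
  define r' where "r' = (m - 1/2 * (norm (p - x))\<^sup>2) / c"
  have "(\<lambda>n. (h (k n) - 1/2 * (norm (t n - x))\<^sup>2) / c) \<longlonglongrightarrow> r'"
    unfolding r'_def using \<open>c > 0\<close> by (intro tendsto_intros h_lim p) auto
  then have "r \<longlonglongrightarrow> r'" using \<open>c > 0\<close> by (simp add: h_k)
  then have "(\<lambda>n. (t n, r n)) \<longlonglongrightarrow> (p, r')" using p by (intro tendsto_Pair)
  then have "(p, r') \<in> K"
    by (rule closed_sequentially[OF K(1), rotated]) (simp add: t_def r_def k)
  moreover have "c * r' + 1/2 * (norm (p - x))\<^sup>2 = m" using \<open>c > 0\<close> by (simp add: r'_def)
  ultimately show ?thesis using m_le unfolding h_def by (intro exI[of _ p] exI[of _ r']) fastforce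
qed

lemma proper_not_MInf: "proper g \<Longrightarrow> g x \<noteq> -\<infinity>"
  by (simp add: proper_def)

lemma prox_is_arg_min:
  fixes g :: "'h::{real_inner, banach} \<Rightarrow> ereal"
  assumes g: "lsc g" "proper g" "convex_fun g" and c: "c > 0"
  shows "is_arg_min (\<lambda>t. ereal c * g t + ereal (1/2 * (norm (t - x))\<^sup>2)) (\<lambda>_. True) (prox c g x)"
proof -
  obtain a b x0 where ab: "b \<ge> 0" "\<And>t. ereal (a - b * norm (t - x0)) \<le> g t"
    by (rule lsc_convex_lower_bound[OF g]) (rule that; assumption)
  have "\<exists>p r. (p, r) \<in> {(x, r :: real). g x \<le> ereal r}
    \<and> (\<forall>t v. (t, v) \<in> {(x, r :: real). g x \<le> ereal r} \<longrightarrow>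
           c * r + 1/2 * (norm (p - x))\<^sup>2 \<le> c * v + 1/2 * (norm (t - x))\<^sup>2)"
  proof (rule proximal_point_exists[OF closed_epigraph[OF g(1)] _ _ c ab(1), of a x0])
    show "convex {(x, r :: real). g x \<le> ereal r}" using g by (simp add: convex_fun_def)
    obtain y r where "g y = ereal r" using g(2) unfolding proper_def by (metis ereal_cases)
    then have "(y, r) \<in> {(x, r). g x \<le> ereal r}" by simp
    then show "{(x, r :: real). g x \<le> ereal r} \<noteq> {}" by blast
    show "a - b * norm (t - x0) \<le> r" if "(t, r) \<in> {(x, r). g x \<le> ereal r}" for t r
      using order_trans[OF ab(2)[of t]] that
        by (metis (mono_tags) case_prodD ereal_less_eq(3) mem_Collect_eq)
  qed
  then obtain p r where p: "g p \<le> ereal r" and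
    min: "\<And>t v. g t \<le> ereal v \<Longrightarrow> c * r + 1/2 * (norm (p - x))\<^sup>2 \<le> c * v + 1/2 * (norm (t - x))\<^sup>2"
    by auto
  obtain r' where r': "g p = ereal r'"
    using p proper_not_MInf[OF g(2), of p] by (cases "g p") auto
  have "is_arg_min (\<lambda>t. ereal c * g t + ereal (1/2 * (norm (t - x))\<^sup>2)) (\<lambda>_. True) p"
    unfolding is_arg_min_linorder
  proof (intro conjI allI impI)
    fix y
    show "ereal c * g p + ereal (1/2 * (norm (p - x))\<^sup>2)
      \<le> ereal c * g y + ereal (1/2 * (norm (y - x))\<^sup>2)"
    proof (cases "g y")
      case (real v)
      have "c * r' \<le> c * r" using p r' c by simp
      then show ?thesis using min[of y v] real r' by simp
    next
      case MInf then show ?thesis using g(2) by (simp add: proper_def)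
    qed (use c in simp)
  qed simp
  then show ?thesis unfolding prox_def arg_min_def by (rule someI)
qed

lemma subdiff_finite:
  assumes "proper g" "u \<in> subdiff g x"
  obtains r where "g x = ereal r"
proof -
  obtain y where "g y \<noteq> \<infinity>" using assms(1) unfolding proper_def by blast
  moreover have "g x + ereal (inner u (y - x)) \<le> g y" using assms(2) by (simp add: subdiff_def)
  ultimately have "g x \<noteq> \<infinity>" by auto
  then show ?thesis using that proper_not_MInf[OF assms(1), of x] by (cases "g x") auto
qed

lemma subdiffD:
  assumes "proper g" "u \<in> subdiff g x" "g y \<le> ereal t"
  shows "real_of_ereal (g x) + inner u (y - x) \<le> t"
proof -
  obtain r where r: "g x = ereal r" by (rule subdiff_finite[OF assms(1,2)])
  have "g x + ereal (inner u (y - x)) \<le> g y" using assms(2) by (simp add: subdiff_def)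
  then have "g x + ereal (inner u (y - x)) \<le> ereal t" using assms(3) by (rule order_trans)
  then show ?thesis by (simp add: r)
qed

text \<open>
  The optimality condition of the proximal problem: compare the minimizer \<open>p\<close> with the points
  \<open>p + \<theta> (y - p)\<close>, divide by \<open>\<theta>\<close> and let \<open>\<theta>\<close> tend to \<open>0\<close>.
\<close>

lemma arg_min_subgradient:
  fixes g :: "'h::real_inner \<Rightarrow> ereal"
  assumes g: "proper g" "convex_fun g" and c: "c > 0"
    and min: "is_arg_min (\<lambda>t. ereal c * g t + ereal (1/2 * (norm (t - x))\<^sup>2)) (\<lambda>_. True) p"
  shows "(1 / c) *\<^sub>R (x - p) \<in> subdiff g p"
proof -
  have le: "ereal c * g p + ereal (1/2 * (norm (p - x))\<^sup>2)
    \<le> ereal c * g y + ereal (1/2 * (norm (y - x))\<^sup>2)" for y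
    using min unfolding is_arg_min_linorder by blast
  obtain y0 r0 where y0: "g y0 = ereal r0" using g(1) unfolding proper_def by (metis ereal_cases)
  have "g p \<noteq> \<infinity>" using le[of y0] y0 c by auto
  then obtain r where r: "g p = ereal r" using proper_not_MInf[OF g(1), of p] by (cases "g p") auto
  have "g p + ereal (inner ((1 / c) *\<^sub>R (x - p)) (y - p)) \<le> g y" for y
  proof (cases "g y")
    case (real v)
    have "c * r \<le> c * v + inner (p - x) (y - p) + \<theta> * (1/2 * (norm (y - p))\<^sup>2)" if \<theta>: "0 < \<theta>" "\<theta>
      \<le> 1" for \<theta>
    proof -
      define q where "q = (1 - \<theta>) *\<^sub>R p + \<theta> *\<^sub>R y"
      have gq: "g q \<le> ereal ((1 - \<theta>) * r + \<theta> * v)"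
        unfolding q_def using g r real \<theta> by (intro convex_funD) auto
      then obtain w where w: "g q = ereal w" using proper_not_MInf[OF g(1), of q] by (cases "g q") auto
      have qx: "q - x = (p - x) + \<theta> *\<^sub>R (y - p)" by (simp add: q_def algebra_simps)
      have nq: "(norm (q - x))\<^sup>2 = (norm (p - x))\<^sup>2 + 2 * \<theta> * inner (p - x) (y - p)
        + \<theta>\<^sup>2 * (norm (y - p))\<^sup>2"
        unfolding qx power2_norm_eq_inner
        by (simp add: inner_add_left inner_add_right inner_commute[of "y - p" "p - x"] power2_eq_square
              distrib_left mult.assoc)
      have "c * r + 1/2 * (norm (p - x))\<^sup>2 \<le> c * w + 1/2 * (norm (q - x))\<^sup>2"
        using le[of q] by (simp add: r w)
      moreover have "c * w \<le> c * ((1 - \<theta>) * r + \<theta> * v)" using gq w c by simp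
      ultimately have "\<theta> * (c * r) \<le> \<theta> * (c * v + inner (p - x) (y - p) + \<theta> * (1/2 * (norm (y - p))\<^sup>2))"
        unfolding nq by (simp add: algebra_simps power2_eq_square)
      then show ?thesis using \<theta> by simp
    qed
    then have ev: "\<forall>\<^sub>F \<theta> in at_right 0. c * r
      \<le> c * v + inner (p - x) (y - p) + \<theta> * (1/2 * (norm (y - p))\<^sup>2)"
      unfolding eventually_at_right_field by (intro exI[of _ 1]) auto
    have "c * r \<le> c * v + inner (p - x) (y - p) + 0 * (1/2 * (norm (y - p))\<^sup>2)"
      by (rule tendsto_lowerbound[OF _ ev])
        (intro tendsto_add tendsto_mult_right tendsto_const tendsto_ident_at, simp)
    then have "r + inner ((1 / c) *\<^sub>R (x - p)) (y - p) \<le> v"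
      using c by (simp add: field_simps inner_diff_left)
    then show ?thesis by (simp add: r real)
  next
    case MInf then show ?thesis using g(1) by (simp add: proper_def)
  qed simp
  then show ?thesis by (simp add: subdiff_def)
qed

lemma prox_subgradient:
  fixes g :: "'h::{real_inner, banach} \<Rightarrow> ereal"
  assumes "lsc g" "proper g" "convex_fun g" "c > 0"
  shows "(1 / c) *\<^sub>R (x - prox c g x) \<in> subdiff g (prox c g x)"
  using arg_min_subgradient prox_is_arg_min assms by blast

text \<open>
  Monotonicity of the subdifferential. The points \<open>p\<close> and \<open>q\<close> are characterized by their subgradients
  instead of as values of \<^const>\<open>prox\<close>, so that the lemma also yields uniqueness of the minimizer.
\<close>

lemma resolvent_nonexpansive:
  assumes g: "proper g" and c: "c > 0"
    and p: "(1 / c) *\<^sub>R (x - p) \<in> subdiff g p" and q: "(1 / c) *\<^sub>R (y - q) \<in> subdiff g q"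
  shows "norm (p - q) \<le> norm (x - y)"
proof -
  obtain r where r: "g p = ereal r" by (rule subdiff_finite[OF g p])
  obtain v where v: "g q = ereal v" by (rule subdiff_finite[OF g q])
  have "r + inner ((1 / c) *\<^sub>R (x - p)) (q - p) \<le> v" using subdiffD[OF g p, of q v] r v by simp
  moreover have "v + inner ((1 / c) *\<^sub>R (y - q)) (p - q) \<le> r" using subdiffD[OF g q, of p r] r v by simp
  ultimately have "inner ((1 / c) *\<^sub>R (x - p)) (q - p) + inner ((1 / c) *\<^sub>R (y - q)) (p - q) \<le> 0"
    by linarith
  moreover have "inner ((1 / c) *\<^sub>R (x - p)) (q - p) + inner ((1 / c) *\<^sub>R (y - q)) (p - q)
    = (1 / c) * ((norm (p - q))\<^sup>2 - inner (x - y) (p - q))"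
    unfolding power2_norm_eq_inner by (simp add: inner_diff inner_commute algebra_simps)
  ultimately have "(norm (p - q))\<^sup>2 \<le> inner (x - y) (p - q)"
    using c by (simp add: divide_le_0_iff)
  also have "\<dots> \<le> norm (x - y) * norm (p - q)" by (rule norm_cauchy_schwarz)
  finally show ?thesis by (cases "norm (p - q) = 0") (auto simp: power2_eq_square)
qed

lemma prox_unique:
  fixes g :: "'h::{real_inner, banach} \<Rightarrow> ereal"
  assumes g: "lsc g" "proper g" "convex_fun g" and c: "c > 0"
    and "is_arg_min (\<lambda>t. ereal c * g t + ereal (1/2 * (norm (t - x))\<^sup>2)) (\<lambda>_. True) p"
  shows "p = prox c g x"
  using resolvent_nonexpansive[OF g(2) c arg_min_subgradient[OF g(2,3) c assms(5)]
    prox_subgradient[OF g c, of x]]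
  by simp

text \<open>
  The subdifferential is closed and convex, hence contains an element of smallest norm.
\<close>

lemma subdiff_min_in:
  fixes g :: "'h::{real_inner, banach} \<Rightarrow> ereal"
  assumes g: "proper g" and x: "x \<in> dom_subdiff g"
  shows "subdiff_min g x \<in> subdiff g x"
proof -
  obtain u0 where "u0 \<in> subdiff g x" using x by (auto simp: dom_subdiff_def)
  then obtain r where r: "g x = ereal r" by (rule subdiff_finite[OF g])
  have eq: "subdiff g x = (\<Inter>y\<in>{y. g y \<noteq> \<infinity>}. {u. inner u (y - x) \<le> real_of_ereal (g y) - r})"
  proof (intro equalityI subsetI)
    fix u assume u: "u \<in> subdiff g x"
    show "u \<in> (\<Inter>y\<in>{y. g y \<noteq> \<infinity>}. {u. inner u (y - x) \<le> real_of_ereal (g y) - r})"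
    proof safe
      fix y assume "g y \<noteq> \<infinity>"
      then have "g y \<le> ereal (real_of_ereal (g y))" using proper_not_MInf[OF g, of y]
        by (cases "g y") auto
      from subdiffD[OF g u this] show "inner u (y - x) \<le> real_of_ereal (g y) - r" by (simp add: r)
    qed
  next
    fix u assume u: "u \<in> (\<Inter>y\<in>{y. g y \<noteq> \<infinity>}. {u. inner u (y - x) \<le> real_of_ereal (g y) - r})"
    then have *: "inner u (y - x) \<le> real_of_ereal (g y) - r" if "g y \<noteq> \<infinity>" for y using that by blast
    have "ereal (r + inner u (y - x)) \<le> g y" for y
      using *[of y] proper_not_MInf[OF g, of y] by (cases "g y") auto
    then show "u \<in> subdiff g x" by (simp add: subdiff_def r)
  qed
  have "closed (subdiff g x)"
    unfolding eq by (intro closed_INT ballI closed_Collect_le continuous_intros)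
  moreover have "convex (subdiff g x)"
    unfolding eq by (intro convex_INT) (simp add: inner_commute[of _ "_ - x"] convex_halfspace_le)
  ultimately have "\<exists>p r. (p, r) \<in> subdiff g x \<times> {0::real..}
    \<and> (\<forall>t v. (t, v) \<in> subdiff g x \<times> {0::real..} \<longrightarrow>
           1 * r + 1/2 * (norm (p - 0))\<^sup>2 \<le> 1 * v + 1/2 * (norm (t - 0))\<^sup>2)"
    using \<open>u0 \<in> _\<close>
    by (intro proximal_point_exists[where a=0 and b=0 and x0=0]) (auto intro: closed_Times convex_Times)
  then obtain p s where p: "p \<in> subdiff g x" "0 \<le> s" and
     min: "\<And>t v. t \<in> subdiff g x \<Longrightarrow> v \<ge> 0 \<Longrightarrow> s + 1/2 * (norm p)\<^sup>2 \<le> v + 1/2 * (norm t)\<^sup>2"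
    by auto
  have "is_arg_min norm (\<lambda>u. u \<in> subdiff g x) p"
    unfolding is_arg_min_linorder
  proof (intro conjI allI impI p)
    fix y assume "y \<in> subdiff g x"
    from min[OF this order_refl] have "(norm p)\<^sup>2 \<le> (norm y)\<^sup>2" using p(2) by linarith
    then show "norm p \<le> norm y" by (rule power2_le_imp_le) simp
  qed
  then have "is_arg_min norm (\<lambda>u. u \<in> subdiff g x) (subdiff_min g x)"
    unfolding subdiff_min_def arg_min_on_def arg_min_def by (rule someI)
  then show ?thesis by (simp add: is_arg_min_def)
qed

text \<open>
  The Moreau envelope of \<open>g\<close>: the infimum of \<open>g t + \<bar>t - x\<bar>\<^sup>2 / (2 c)\<close>, which is attained at the
  proximal point.
\<close>

definition moreau_envelope :: "real \<Rightarrow> ('h::real_inner \<Rightarrow> ereal) \<Rightarrow> 'h \<Rightarrow> real" where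
  "moreau_envelope c g x = real_of_ereal (g (prox c g x)) + (norm (prox c g x - x))\<^sup>2 / (2 * c)"

text \<open>
  The basic estimate of the proximal point method. With the envelope instead of the value of \<open>g\<close> at
  the new point it has no remainder term.
\<close>

lemma prox_step_inequality:
  fixes g :: "'h::{real_inner, banach} \<Rightarrow> ereal"
  assumes g: "lsc g" "proper g" "convex_fun g" and c: "c > 0" and y: "g y \<le> ereal t"
  shows "(norm (prox c g x - y))\<^sup>2 \<le> (norm (x - y))\<^sup>2 - 2 * c * (moreau_envelope c g x - t)"
proof -
  define p where "p = prox c g x"
  have "real_of_ereal (g p) + inner ((1 / c) *\<^sub>R (x - p)) (y - p) \<le> t"
    unfolding p_def by (rule subdiffD[OF g(2) prox_subgradient[OF g c] y])
  then have "c * (real_of_ereal (g p) + inner ((1 / c) *\<^sub>R (x - p)) (y - p)) \<le> c * t" using c by simp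
  then have "c * real_of_ereal (g p) + inner (x - p) (y - p) \<le> c * t"
    using c by (simp add: algebra_simps)
  moreover have "(norm (x - y))\<^sup>2 = (norm (x - p))\<^sup>2 + (norm (p - y))\<^sup>2 - 2 * inner (x - p) (y - p)"
    unfolding power2_norm_eq_inner by (simp add: inner_diff inner_commute algebra_simps)
  moreover have "2 * c * moreau_envelope c g x = 2 * (c * real_of_ereal (g p)) + (norm (x - p))\<^sup>2"
    using c by (simp add: moreau_envelope_def p_def field_simps norm_minus_commute)
  ultimately show ?thesis by (simp add: algebra_simps flip: p_def)
qed

text \<open>
  The affine minorant of \<open>g\<close> given by the subgradient \<open>u\<close> has the envelope on the left-hand side.
\<close>

lemma moreau_ge_affine:
  fixes g :: "'h::{real_inner, banach} \<Rightarrow> ereal"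
  assumes g: "lsc g" "proper g" "convex_fun g" and c: "c > 0" and u: "u \<in> subdiff g z"
  shows "real_of_ereal (g z) + inner u (x - z) - c / 2 * (norm u)\<^sup>2 \<le> moreau_envelope c g x"
proof -
  define p where "p = prox c g x"
  obtain r where r: "g p = ereal r" unfolding p_def
    by (rule subdiff_finite[OF g(2) prox_subgradient[OF g c]])
  have "real_of_ereal (g z) + inner u (p - z) \<le> r" by (rule subdiffD[OF g(2) u]) (simp add: r)
  moreover have "inner u (p - z) = inner u (x - z) + inner u (p - x)" by (simp add: inner_diff)
  moreover have "0 \<le> (norm (p - x + c *\<^sub>R u))\<^sup>2 / (2 * c)" using c by simp
  moreover have "(norm (p - x + c *\<^sub>R u))\<^sup>2 / (2 * c)
    = (norm (p - x))\<^sup>2 / (2 * c) + inner u (p - x) + c / 2 * (norm u)\<^sup>2"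
  proof -
    have "(norm (p - x + c *\<^sub>R u))\<^sup>2 = (norm (p - x))\<^sup>2 + 2 * c * inner u (p - x) + c\<^sup>2 * (norm u)\<^sup>2"
      unfolding power2_norm_eq_inner
      by (simp add: inner_add_left inner_add_right inner_commute[of "p - x" u] power2_eq_square
            distrib_left mult.assoc)
    then show ?thesis using c by (simp add: field_simps power2_eq_square)
  qed
  ultimately show ?thesis unfolding moreau_envelope_def p_def[symmetric] r by simp
qed

section \<open>Weak convergence of weighted averages\<close>

lemma lsc_continuous:
  assumes "\<And>x. isCont \<phi> x"
  shows "lsc (\<lambda>x. ereal (\<phi> x))"
  unfolding lsc_def
proof
  fix x
  show "ereal (\<phi> x) \<le> Liminf (at x) (\<lambda>x. ereal (\<phi> x))"
  proof (cases "at x = bot")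
    case False
    have "((\<lambda>x. ereal (\<phi> x)) \<longlongrightarrow> ereal (\<phi> x)) (at x)" using assms by (simp add: isCont_def)
    then have "Liminf (at x) (\<lambda>x. ereal (\<phi> x)) = ereal (\<phi> x)" by (rule lim_imp_Liminf[OF False])
    then show ?thesis by simp
  qed simp
qed

text \<open>
  The proximal point \<open>p\<close> of \<open>L\<close> at \<open>0\<close> exists by completeness, and its optimality condition says that
  \<open>- p\<close> is a subgradient of \<open>L\<close>, hence represents \<open>L\<close>.
\<close>

lemma riesz_representation:
  fixes L :: "'h::{real_inner, banach} \<Rightarrow> real"
  assumes "bounded_linear L"
  shows "\<exists>y. \<forall>w. L w = inner y w"
proof -
  interpret bounded_linear L by fact
  \<comment> \<open>A continuous linear functional is itself a convex function to which proximal points apply.\<close>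
  define g where "g x = ereal (L x)" for x
  define p where "p = prox 1 g 0"
  have "lsc g" unfolding g_def by (rule lsc_continuous) (rule isCont, simp)
  moreover have proper: "proper g" by (simp add: proper_def g_def)
  moreover have "convex_fun g"
    unfolding convex_fun_def g_def
    by (rule convexI) (auto simp: add scaleR intro!: add_mono mult_left_mono)
  ultimately have "(1 / 1) *\<^sub>R (0 - p) \<in> subdiff g p"
    unfolding p_def by (intro prox_subgradient) auto
  then have le: "L p + inner (- p) (w - p) \<le> L w" for w
    using subdiffD[OF proper, of "- p" p w "L w"] by (simp add: g_def)
  have le': "- inner p w \<le> L w" for w using le[of "p + w"] by (simp add: add)
  have "L w = inner (- p) w" for w using le'[of w] le'[of "- w"] by (simp add: neg)
  then show ?thesis by blast
qed

text \<open>
  A diagonal subsequence makes the inner products with a dense sequence converge; boundedness extends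
  this to all vectors, and the limit functional is represented by Riesz' theorem.
\<close>

lemma weakly_convergent_subsequence:
  fixes X :: "nat \<Rightarrow> 'h::{real_inner, banach, second_countable_topology}"
  assumes B: "\<And>n. norm (X n) \<le> B"
  obtains r y where "strict_mono r" "weakly_converges (X \<circ> r) y"
proof -
  obtain d :: "nat \<Rightarrow> 'h" where d: "\<And>x e. e > 0 \<Longrightarrow> \<exists>n. dist (d n) x < e"
    by (rule dense_sequence) (rule that; assumption)
  have "B \<ge> 0" using B[of 0] norm_ge_zero order_trans by blast
  have X_le: "\<bar>inner (X n) w\<bar> \<le> B * norm w" for n w
    using Cauchy_Schwarz_ineq2[of "X n" w] B[of n] mult_right_mono[of "norm (X n)" B "norm w"] by simp
  interpret subseqs "\<lambda>i s. convergent (\<lambda>k. inner (X (s k)) (d i))"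
  proof
    fix i and s :: "nat \<Rightarrow> nat"
    have "bounded (range (\<lambda>k. inner (X (s k)) (d i)))"
      by (rule boundedI[of _ "B * norm (d i)"]) (use X_le in auto)
    then obtain l r where "strict_mono (r :: nat \<Rightarrow> nat)" "((\<lambda>k. inner (X (s k)) (d i)) \<circ> r) \<longlonglongrightarrow> l"
      using bounded_imp_convergent_subsequence by blast
    then show "\<exists>r'. strict_mono r' \<and> convergent (\<lambda>k. inner (X ((s \<circ> r') k)) (d i))"
      by (intro exI[of _ r]) (auto simp: o_def convergent_def)
  qed
  define Y where "Y k = X (diagseq k)" for k
  have conv_d: "convergent (\<lambda>k. inner (Y k) (d i))" for i
  proof -
    have "convergent (\<lambda>k. inner (X ((diagseq \<circ> (+) (Suc i)) k)) (d i))"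
    proof (rule diagseq_holds)
      show "convergent (\<lambda>k. inner (X ((s \<circ> r) k)) (d n))"
        if "strict_mono r" "convergent (\<lambda>k. inner (X (s k)) (d n))" for s r :: "nat \<Rightarrow> nat" and n
        using convergent_subseq_convergent[OF that(2,1)] by (simp add: o_def)
    qed
    then have "convergent (\<lambda>k. inner (Y (k + Suc i)) (d i))" by (simp add: Y_def add.commute)
    then show ?thesis by (subst (asm) convergent_ignore_initial_segment)
  qed
  have conv: "convergent (\<lambda>k. inner (Y k) w)" for w
  proof (rule Cauchy_convergent, rule metric_CauchyI)
    fix e :: real assume "e > 0"
    define \<delta> where "\<delta> = e / (4 * (B + 1))"
    have "\<delta> > 0" using \<open>e > 0\<close> \<open>B \<ge> 0\<close> by (simp add: \<delta>_def)
    then obtain i where i: "dist (d i) w < \<delta>" using d by blast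
    have near: "\<bar>inner (Y k) w - inner (Y k) (d i)\<bar> \<le> e / 4" for k
    proof -
      have "\<bar>inner (Y k) w - inner (Y k) (d i)\<bar> \<le> B * norm (w - d i)"
        using X_le[of "diagseq k" "w - d i"] by (simp add: Y_def inner_diff_right)
      also have "\<dots> \<le> (B + 1) * \<delta>"
        using i \<open>B \<ge> 0\<close> by (intro mult_mono) (auto simp: dist_norm norm_minus_commute)
      also have "\<dots> = e / 4" using \<open>B \<ge> 0\<close> by (simp add: \<delta>_def field_simps)
      finally show ?thesis .
    qed
    obtain N where N: "\<And>k l. k \<ge> N \<Longrightarrow> l \<ge> N \<Longrightarrow> dist (inner (Y k) (d i)) (inner (Y l) (d i)) < e / 4"
      using metric_CauchyD[OF convergent_Cauchy[OF conv_d[of i]], of "e / 4"] \<open>e > 0\<close> by auto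
    have "dist (inner (Y k) w) (inner (Y l) w) < e" if "k \<ge> N" "l \<ge> N" for k l
      using near[of k] near[of l] N[OF that] \<open>e > 0\<close> unfolding dist_real_def by linarith
    then show "\<exists>M. \<forall>k\<ge>M. \<forall>l\<ge>M. dist (inner (Y k) w) (inner (Y l) w) < e" by blast
  qed
  define L where "L w = lim (\<lambda>k. inner (Y k) w)" for w
  have L: "(\<lambda>k. inner (Y k) w) \<longlonglongrightarrow> L w" for w
    unfolding L_def using conv by (simp add: convergent_LIMSEQ_iff)
  have "bounded_linear L"
  proof (rule bounded_linear_intro)
    show "L (v + w) = L v + L w" for v w
      using tendsto_add[OF L[of v] L[of w]] L[of "v + w"] by (simp add: inner_add_right LIMSEQ_unique)
    show "L (c *\<^sub>R w) = c *\<^sub>R L w" for c w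
      using tendsto_mult_left[OF L[of w], of c] L[of "c *\<^sub>R w"] by (simp add: LIMSEQ_unique)
    show "norm (L w) \<le> norm w * B" for w
      by (rule tendsto_upperbound[OF tendsto_norm[OF L[of w]]])
         (use X_le in \<open>auto simp: Y_def mult.commute\<close>)
  qed
  then obtain y where "\<And>w. L w = inner y w" using riesz_representation by blast
  then have "weakly_converges (X \<circ> diagseq) y" using L by (simp add: weakly_converges_def Y_def)
  then show ?thesis using that subseq_diagseq by blast
qed

lemma weighted_mean_tendsto:
  fixes a lam :: "nat \<Rightarrow> real"
  assumes lam: "\<And>n. lam n > 0" and S: "filterlim (\<lambda>n. \<Sum>k=1..n. lam k) at_top sequentially"
    and a: "a \<longlonglongrightarrow> l"
  shows "(\<lambda>n. (\<Sum>k=1..n. lam k * a k) / (\<Sum>k=1..n. lam k)) \<longlonglongrightarrow> l"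
proof (rule tendstoI)
  fix e :: real assume e: "e > 0"
  let ?S = "\<lambda>n. \<Sum>k=1..n. lam k"
  have "\<forall>\<^sub>F k in sequentially. dist (a k) l < e / 2" using a e by (intro tendstoD) auto
  then obtain N where N: "\<And>k. k \<ge> N \<Longrightarrow> \<bar>a k - l\<bar> < e / 2"
    unfolding eventually_sequentially dist_real_def by blast
  define C where "C = (\<Sum>k=1..N. lam k * \<bar>a k - l\<bar>)"
  have C0: "C \<ge> 0" unfolding C_def using lam
    by (intro sum_nonneg mult_nonneg_nonneg) (auto intro: less_imp_le)
  have "\<forall>\<^sub>F n in sequentially. ?S n > 2 * C / e" using S by (simp add: filterlim_at_top_dense)
  moreover have "\<forall>\<^sub>F n in sequentially. n \<ge> N" by (rule eventually_ge_at_top)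
  ultimately show "\<forall>\<^sub>F n in sequentially. dist ((\<Sum>k=1..n. lam k * a k) / ?S n) l < e"
  proof eventually_elim
    case (elim n)
    have "0 \<le> 2 * C / e" using C0 e by simp
    then have pos: "?S n > 0" using elim by linarith
    have "\<bar>(\<Sum>k=1..n. lam k * a k) - ?S n * l\<bar> = \<bar>\<Sum>k=1..n. lam k * (a k - l)\<bar>"
      by (simp add: sum_subtractf sum_distrib_right right_diff_distrib)
    also have "\<dots> \<le> (\<Sum>k=1..n. lam k * \<bar>a k - l\<bar>)"
      by (rule order_trans[OF sum_abs]) (use lam in \<open>simp add: abs_mult less_imp_le\<close>)
    also have "\<dots> = C + (\<Sum>k=N+1..n. lam k * \<bar>a k - l\<bar>)"
      unfolding C_def using elim(2) sum.ub_add_nat[of 1 N "\<lambda>k. lam k * \<bar>a k - l\<bar>" "n - N"] by simp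
    also have "(\<Sum>k=N+1..n. lam k * \<bar>a k - l\<bar>) \<le> (\<Sum>k=N+1..n. lam k * (e / 2))"
      using lam N by (intro sum_mono mult_left_mono) (auto intro: less_imp_le)
    also have "\<dots> \<le> (\<Sum>k=1..n. lam k * (e / 2))"
      using lam e by (intro sum_mono2) (auto intro: less_imp_le)
    also have "\<dots> = ?S n * (e / 2)" by (simp add: sum_distrib_right)
    also have "C + ?S n * (e / 2) < ?S n * e" using elim(1) e by (simp add: field_simps)
    finally have "\<bar>(\<Sum>k=1..n. lam k * a k) - ?S n * l\<bar> < ?S n * e" by simp
    moreover have "(\<Sum>k=1..n. lam k * a k) / ?S n - l = ((\<Sum>k=1..n. lam k * a k) - ?S n * l) / ?S n"
      using pos by (simp add: field_simps)
    ultimately show ?case using pos by (simp add: dist_real_def divide_less_eq mult.commute)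
  qed
qed

text \<open>
  The analogue of Opial's lemma for averages. For \<open>u, v \<in> Z\<close> the inner product \<open>X n \<bullet> (u - v)\<close> is a
  combination of squared distances to \<open>u\<close> and \<open>v\<close>, so it converges, and the averages inherit the
  limit. Two weak cluster points \<open>u, v\<close> of the averages thus satisfy \<open>u \<bullet> (u - v) = v \<bullet> (u - v)\<close>, that
  is \<open>u = v\<close>.
\<close>

lemma ergodic_opial:
  fixes X xbar :: "nat \<Rightarrow> 'h::{real_inner, banach, second_countable_topology}"
  assumes lam: "\<And>n. lam n > 0" and S: "filterlim (\<lambda>n. \<Sum>k=1..n. lam k) at_top sequentially"
    and xbar: "\<And>n. xbar n = (\<Sum>k=1..n. lam k *\<^sub>R X k) /\<^sub>R (\<Sum>k=1..n. lam k)"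
    and Z: "Z \<noteq> {}" and conv: "\<And>z. z \<in> Z \<Longrightarrow> convergent (\<lambda>n. norm (X n - z))"
    and cluster: "\<And>r y. strict_mono r \<Longrightarrow> weakly_converges (xbar \<circ> r) y \<Longrightarrow> y \<in> Z"
  shows "\<exists>y\<in>Z. weakly_converges xbar y"
proof -
  obtain z where z: "z \<in> Z" using Z by blast
  have "Bseq (\<lambda>n. norm (X n - z))" using conv[OF z] by (rule convergent_imp_Bseq)
  then obtain B where "\<And>n. norm (norm (X n - z)) \<le> B" unfolding Bseq_def by blast
  then have B: "norm (X n) \<le> B + norm z" for n using norm_triangle_sub[of "X n" z]
    by (smt (verit) real_norm_def)
  have "B + norm z \<ge> 0" using B[of 0] norm_ge_zero order_trans by blast
  have xbar_le: "norm (xbar n) \<le> B + norm z" for n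
  proof (cases "n = 0")
    case False
    have pos: "(\<Sum>k=1..n. lam k) > 0" using False lam by (intro sum_pos) auto
    have "norm (\<Sum>k=1..n. lam k *\<^sub>R X k) \<le> (\<Sum>k=1..n. lam k * (B + norm z))"
      by (rule sum_norm_le) (use B lam in \<open>auto intro!: mult_left_mono simp: less_imp_le\<close>)
    also have "\<dots> = (\<Sum>k=1..n. lam k) * (B + norm z)" by (simp add: sum_distrib_right)
    finally show ?thesis using pos unfolding xbar by (simp add: field_simps)
  qed (use \<open>B + norm z \<ge> 0\<close> xbar in simp)
  have conv_bar: "convergent (\<lambda>n. inner (xbar n) (u - v))" if "u \<in> Z" "v \<in> Z" for u v
  proof -
    have "inner (X n) (u - v) = 1/2 * ((norm (X n - v))\<^sup>2 - (norm (X n - u))\<^sup>2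
      + (norm u)\<^sup>2 - (norm v)\<^sup>2)" for n
      unfolding power2_norm_eq_inner by (simp add: inner_diff inner_commute algebra_simps)
    moreover
    from conv[OF that(1)] conv[OF that(2)]
    obtain lu lv where "(\<lambda>n. norm (X n - u)) \<longlonglongrightarrow> lu" "(\<lambda>n. norm (X n - v)) \<longlonglongrightarrow> lv"
      unfolding convergent_def by blast
    then have "(\<lambda>n. 1/2 * ((norm (X n - v))\<^sup>2 - (norm (X n - u))\<^sup>2 + (norm u)\<^sup>2 - (norm v)\<^sup>2)) \<longlonglongrightarrow>
        1/2 * (lv\<^sup>2 - lu\<^sup>2 + (norm u)\<^sup>2 - (norm v)\<^sup>2)"
      by (intro tendsto_intros)
    ultimately have "(\<lambda>n. inner (X n) (u - v)) \<longlonglongrightarrow> 1/2 * (lv\<^sup>2 - lu\<^sup>2 + (norm u)\<^sup>2 - (norm v)\<^sup>2)"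
      by (simp only:)
    from weighted_mean_tendsto[OF lam S this]
    have "convergent (\<lambda>n. (\<Sum>k=1..n. lam k * inner (X k) (u - v)) / (\<Sum>k=1..n. lam k))"
      unfolding convergent_def by blast
    moreover have "inner (xbar n) (u - v)
      = (\<Sum>k=1..n. lam k * inner (X k) (u - v)) / (\<Sum>k=1..n. lam k)" for n
      unfolding xbar inner_scaleR_left inner_sum_left by (simp add: divide_inverse mult.commute)
    ultimately show ?thesis by (simp only:)
  qed
  obtain r0 y where r0: "strict_mono r0" "weakly_converges (xbar \<circ> r0) y"
    by (rule weakly_convergent_subsequence[OF xbar_le]) (rule that; assumption)
  have y: "y \<in> Z" using cluster r0 by blast
  have unique: "v = y" if r: "strict_mono r" "weakly_converges (xbar \<circ> r) v" for r v
  proof -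
    have "v \<in> Z" using cluster r by blast
    then obtain l where l: "(\<lambda>n. inner (xbar n) (v - y)) \<longlonglongrightarrow> l"
      using conv_bar[OF _ y] unfolding convergent_def by blast
    have "inner v (v - y) = l"
      using r(2) LIMSEQ_subseq_LIMSEQ[OF l r(1)] unfolding weakly_converges_def
      by (intro LIMSEQ_unique) (auto simp: o_def)
    moreover have "inner y (v - y) = l"
      using r0(2) LIMSEQ_subseq_LIMSEQ[OF l r0(1)] unfolding weakly_converges_def
      by (intro LIMSEQ_unique) (auto simp: o_def)
    ultimately have "inner (v - y) (v - y) = 0" by (simp add: inner_diff_left)
    then show ?thesis by simp
  qed
  have "(\<lambda>n. inner (xbar n) w) \<longlonglongrightarrow> inner y w" for w
  proof (rule ccontr)
    assume "\<not> ?thesis"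
    then obtain e where e: "e > 0" "\<not> (\<forall>\<^sub>F n in sequentially. dist (inner (xbar n) w) (inner y w) < e)"
      unfolding tendsto_iff by blast
    define I where "I = {n. e \<le> dist (inner (xbar n) w) (inner y w)}"
    have "infinite I"
      unfolding infinite_nat_iff_unbounded_le I_def using e(2)
      by (auto simp: eventually_sequentially not_less)
    define s where "s = enumerate I"
    have s: "strict_mono s" "\<And>n. s n \<in> I"
      unfolding s_def using \<open>infinite I\<close> by (auto simp: strict_mono_enumerate enumerate_in_set)
    have "norm ((xbar \<circ> s) n) \<le> B + norm z" for n using xbar_le by simp
    then obtain t v where t: "strict_mono t" "weakly_converges (xbar \<circ> s \<circ> t) v"
      by (rule weakly_convergent_subsequence) (rule that; assumption)
    have "v = y" using unique[of "s \<circ> t" v] s(1) t by (simp add: strict_mono_o o_assoc)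
    then have "(\<lambda>n. inner (xbar (s (t n))) w) \<longlonglongrightarrow> inner y w"
      using t(2) by (simp add: weakly_converges_def)
    then have "\<forall>\<^sub>F n in sequentially. dist (inner (xbar (s (t n))) w) (inner y w) < e"
      using e(1) by (rule tendstoD)
    then obtain n where "dist (inner (xbar (s (t n))) w) (inner y w) < e"
      unfolding eventually_sequentially by blast
    then show False using s(2)[of "t n"] by (simp add: I_def)
  qed
  then show ?thesis using y unfolding weakly_converges_def by blast
qed

text \<open>
  Weak lower semicontinuity at the level of the minimum, without separation of convex sets. With the
  proximal point \<open>p\<close> of \<open>F\<close> at \<open>y\<close>, the subgradient inequality at \<open>p\<close> passes to the weak limit and
  gives \<open>F p + \<bar>y - p\<bar>\<^sup>2 \<le> m\<close>, whence \<open>y = p\<close>.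
\<close>

lemma weak_limit_of_minimizing_sequence:
  fixes F :: "'h::{real_inner, banach} \<Rightarrow> ereal"
  assumes F: "lsc F" "proper F" "convex_fun F" and m: "\<And>y. ereal m \<le> F y"
    and X: "weakly_converges X y" and le: "\<And>n. F (X n) \<le> ereal (c n)" and c: "c \<longlonglongrightarrow> m"
  shows "F y \<le> ereal m"
proof -
  define p where "p = prox 1 F y"
  have sub: "(1 / 1) *\<^sub>R (y - p) \<in> subdiff F p"
    unfolding p_def using F by (intro prox_subgradient) auto
  obtain r where r: "F p = ereal r" by (rule subdiff_finite[OF F(2) sub])
  have "r + inner (y - p) (X n - p) \<le> c n" for n
    using subdiffD[OF F(2) sub le[of n]] r by simp
  moreover have "(\<lambda>n. r + inner (y - p) (X n - p)) \<longlonglongrightarrow> r + inner (y - p) (y - p)"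
  proof -
    have "(\<lambda>n. inner (X n) (y - p)) \<longlonglongrightarrow> inner y (y - p)" using X by (simp add: weakly_converges_def)
    then have "(\<lambda>n. r + (inner (X n) (y - p) - inner p (y - p))) \<longlonglongrightarrow> r
      + (inner y (y - p) - inner p (y - p))"
      by (intro tendsto_add tendsto_diff tendsto_const)
    moreover have "inner (X n) (y - p) - inner p (y - p) = inner (y - p) (X n - p)" for n
      by (metis inner_commute inner_diff_left)
    ultimately show ?thesis by (simp only: inner_diff_left[symmetric])
  qed
  ultimately have "r + inner (y - p) (y - p) \<le> m" by (intro LIMSEQ_le[OF _ c]) auto
  moreover have "m \<le> r" using m[of p] r by simp
  ultimately have "inner (y - p) (y - p) \<le> 0" "r \<le> m"
    using inner_ge_zero[of "y - p"] by linarith+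
  moreover from this have "y = p" using inner_ge_zero[of "y - p"] inner_eq_zero_iff[of "y - p"] by simp
  ultimately show ?thesis using r by simp
qed

section \<open>Measurability of the proximal map\<close>

lemma normal_convex_integrandD:
  assumes "normal_convex_integrand M f"
  shows "(\<lambda>(s, x). f s x) \<in> borel_measurable (M \<Otimes>\<^sub>M borel)"
    and "s \<in> space M \<Longrightarrow> lsc (f s)" "s \<in> space M \<Longrightarrow> proper (f s)" "s \<in> space M \<Longrightarrow> convex_fun (f s)"
  using assms by (auto simp: normal_convex_integrand_def)

lemma section_measurable:
  assumes "normal_convex_integrand M f"
  shows "(\<lambda>s. f s y) \<in> borel_measurable M"
proof -
  have "(\<lambda>s. (s, y)) \<in> measurable M (M \<Otimes>\<^sub>M borel)" by measurable
  from measurable_compose[OF this normal_convex_integrandD(1)[OF assms]] show ?thesis by simp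
qed

text \<open>
  By the projection theorem the optimal value \<open>m\<close> of the proximal problem is measurable in \<open>s\<close>. By
  uniqueness of the minimizer, the proximal point lies in \<open>B\<close> exactly if some \<open>t \<in> B\<close> attains \<open>m\<close>, so
  a second projection applies.
\<close>

lemma prox_measurable_fixed_point:
  fixes f :: "'e \<Rightarrow> 'h::{real_inner, banach, second_countable_topology} \<Rightarrow> ereal"
  assumes M: "finite_measure M" "complete_measure M" and f: "normal_convex_integrand M f" and c: "c > 0"
  shows "(\<lambda>s. prox c (f s) x) \<in> borel_measurable M"
proof -
  note f_meas[measurable] = normal_convex_integrandD(1)[OF f]
  define h where "h s t = ereal c * f s t + ereal (1/2 * (norm (t - x))\<^sup>2)" for s t
  have h_meas[measurable]: "(\<lambda>w. h (fst w) (snd w)) \<in> borel_measurable (M \<Otimes>\<^sub>M borel)"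
  proof -
    have "(\<lambda>w. f (fst w) (snd w)) \<in> borel_measurable (M \<Otimes>\<^sub>M borel)"
      using f_meas by (simp add: case_prod_beta')
    then show ?thesis unfolding h_def by measurable
  qed
  define m where "m s = h s (prox c (f s) x)" for s
  have arg_min: "is_arg_min (h s) (\<lambda>_. True) (prox c (f s) x)" if "s \<in> space M" for s
    unfolding h_def using prox_is_arg_min normal_convex_integrandD[OF f] that c by blast
  have m_le: "m s \<le> h s t" if "s \<in> space M" for s t
    using arg_min[OF that] unfolding is_arg_min_linorder m_def by blast
  have m_meas[measurable]: "m \<in> borel_measurable M"
  proof (rule borel_measurableI_less)
    fix r
    have "{s \<in> space M. m s < r} = fst ` {w \<in> space (M \<Otimes>\<^sub>M borel). h (fst w) (snd w) < r}"
    proof (intro equalityI subsetI)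
      fix s assume "s \<in> {s \<in> space M. m s < r}"
      then have "(s, prox c (f s) x) \<in> {w \<in> space (M \<Otimes>\<^sub>M borel). h (fst w) (snd w) < r}"
        by (simp add: space_pair_measure m_def)
      then show "s \<in> fst ` {w \<in> space (M \<Otimes>\<^sub>M borel). h (fst w) (snd w) < r}" by force
    next
      fix s assume "s \<in> fst ` {w \<in> space (M \<Otimes>\<^sub>M borel). h (fst w) (snd w) < r}"
      then obtain t where "s \<in> space M" "h s t < r" by (auto simp: space_pair_measure)
      then show "s \<in> {s \<in> space M. m s < r}" using m_le[of s t] by simp
    qed
    also have "\<dots> \<in> sets M" by (rule measurable_projection[OF M]) measurable
    finally show "{s \<in> space M. m s < r} \<in> sets M" .
  qed
  show ?thesis
  proof (rule measurableI)
    fix B :: "'h set" assume B[measurable]: "B \<in> sets borel"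
    have "(\<lambda>s. prox c (f s) x) -` B \<inter> space M =
        fst ` {w \<in> space (M \<Otimes>\<^sub>M borel). h (fst w) (snd w) \<le> m (fst w) \<and> snd w \<in> B}"
    proof (intro equalityI subsetI)
      fix s assume "s \<in> (\<lambda>s. prox c (f s) x) -` B \<inter> space M"
      then have "(s, prox c (f s) x) \<in> {w \<in> space (M \<Otimes>\<^sub>M borel). h (fst w) (snd w) \<le> m (fst w)
        \<and> snd w \<in> B}"
        by (simp add: space_pair_measure m_def)
      then show "s \<in> fst ` {w \<in> space (M \<Otimes>\<^sub>M borel). h (fst w) (snd w) \<le> m (fst w) \<and> snd w \<in> B}"
        by force
    next
      fix s assume "s \<in> fst ` {w \<in> space (M \<Otimes>\<^sub>M borel). h (fst w) (snd w) \<le> m (fst w) \<and> snd w \<in> B}"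
      then obtain t where t: "s \<in> space M" "h s t \<le> m s" "t \<in> B" by (auto simp: space_pair_measure)
      have "h s t \<le> h s y" for y using t(2) m_le[OF t(1), of y] by (rule order_trans)
      then have "is_arg_min (h s) (\<lambda>_. True) t" by (simp add: is_arg_min_linorder)
      then have "t = prox c (f s) x"
        unfolding h_def by (intro prox_unique normal_convex_integrandD[OF f] t(1) c)
      then show "s \<in> (\<lambda>s. prox c (f s) x) -` B \<inter> space M" using t by simp
    qed
    also have "\<dots> \<in> sets M" by (rule measurable_projection[OF M]) measurable
    finally show "(\<lambda>s. prox c (f s) x) -` B \<inter> space M \<in> sets M" .
  qed simp
qed

text \<open>
  The second argument is replaced by the first element of a dense sequence within distance
  \<open>1 / (n + 1)\<close>, which only takes countably many values.
\<close>

lemma caratheodory_measurable: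
  fixes G :: "'e \<Rightarrow> 'x::{metric_space, second_countable_topology} \<Rightarrow> 'y::metric_space"
  assumes meas: "\<And>x. (\<lambda>s. G s x) \<in> borel_measurable M"
    and cont: "\<And>s x. s \<in> space M \<Longrightarrow> isCont (G s) x"
  shows "(\<lambda>(s, x). G s x) \<in> borel_measurable (M \<Otimes>\<^sub>M borel)"
proof -
  obtain d :: "nat \<Rightarrow> 'x" where d: "\<And>x e. e > 0 \<Longrightarrow> \<exists>n. dist (d n) x < e"
    by (rule dense_sequence) (rule that; assumption)
  define k where "k n x = (LEAST i. dist (d i) x < 1 / Suc n)" for n x
  have k: "dist (d (k n x)) x < 1 / Suc n" for n x
    unfolding k_def by (rule LeastI_ex) (simp add: d)
  have k_meas[measurable]: "k n \<in> measurable borel (count_space UNIV)" for n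
    unfolding k_def by measurable
  have "(\<lambda>w. G (fst w) (d (k n (snd w)))) \<in> borel_measurable (M \<Otimes>\<^sub>M borel)" for n
  proof (rule measurable_compose_countable)
    show "(\<lambda>w. G (fst w) (d i)) \<in> borel_measurable (M \<Otimes>\<^sub>M borel)" for i
      by (rule measurable_compose[OF measurable_fst meas])
  qed measurable
  moreover have "(\<lambda>n. G (fst w) (d (k n (snd w)))) \<longlonglongrightarrow> (case w of (s, x) \<Rightarrow> G s x)"
    if "w \<in> space (M \<Otimes>\<^sub>M borel)" for w
  proof -
    have "(\<lambda>n. dist (d (k n (snd w))) (snd w)) \<longlonglongrightarrow> 0"
      by (rule tendsto_sandwich[of "\<lambda>_. 0" _ _ "\<lambda>n. 1 / Suc n"])
         (use k LIMSEQ_Suc[OF lim_1_over_n[where 'a=real]] in \<open>auto intro!: always_eventually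
           less_imp_le\<close>)
    then have "(\<lambda>n. d (k n (snd w))) \<longlonglongrightarrow> snd w" by (rule tendsto_dist_iff[THEN iffD2])
    then have "(\<lambda>n. G (fst w) (d (k n (snd w)))) \<longlonglongrightarrow> G (fst w) (snd w)"
      using that by (intro isCont_tendsto_compose[OF cont]) (auto simp: space_pair_measure)
    then show ?thesis by (simp add: case_prod_beta)
  qed
  ultimately show ?thesis by (rule borel_measurable_LIMSEQ_metric)
qed

lemma prox_measurable:
  fixes f :: "'e \<Rightarrow> 'h::{real_inner, banach, second_countable_topology} \<Rightarrow> ereal"
  assumes M: "finite_measure M" "complete_measure M" and f: "normal_convex_integrand M f" and c: "c > 0"
  shows "(\<lambda>(s, x). prox c (f s) x) \<in> borel_measurable (M \<Otimes>\<^sub>M borel)"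
proof (rule caratheodory_measurable)
  show "(\<lambda>s. prox c (f s) x) \<in> borel_measurable M" for x
    by (rule prox_measurable_fixed_point[OF M f c])
  fix s x assume s: "s \<in> space M"
  note g = normal_convex_integrandD(2-4)[OF f s]
  have "dist (prox c (f s) y) (prox c (f s) x) \<le> dist y x" for y
    unfolding dist_norm
    by (rule resolvent_nonexpansive[OF g(2) c prox_subgradient[OF g c] prox_subgradient[OF g c]])
  then show "isCont (prox c (f s)) x"
    unfolding continuous_at_eps_delta by (meson order_le_less_trans)
qed

lemma moreau_measurable:
  fixes f :: "'e \<Rightarrow> 'h::{real_inner, banach, second_countable_topology} \<Rightarrow> ereal"
  assumes M: "finite_measure M" "complete_measure M" and f: "normal_convex_integrand M f" and c: "c > 0"
  shows "(\<lambda>(s, x). moreau_envelope c (f s) x) \<in> borel_measurable (M \<Otimes>\<^sub>M borel)"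
proof -
  have [measurable]: "(\<lambda>w. prox c (f (fst w)) (snd w)) \<in> borel_measurable (M \<Otimes>\<^sub>M borel)"
    using prox_measurable[OF M f c] by (simp add: case_prod_beta')
  have "(\<lambda>w. (fst w, prox c (f (fst w)) (snd w))) \<in> M \<Otimes>\<^sub>M borel \<rightarrow>\<^sub>M M \<Otimes>\<^sub>M borel" by measurable
  from measurable_compose[OF this normal_convex_integrandD(1)[OF f]]
  have [measurable]: "(\<lambda>w. f (fst w) (prox c (f (fst w)) (snd w))) \<in> borel_measurable (M \<Otimes>\<^sub>M borel)"
    by simp
  show ?thesis unfolding moreau_envelope_def case_prod_beta' by measurable
qed

section \<open>Integrals of extended-real functions\<close>

lemma ext_integral_mono:
  assumes "AE s in M. g s \<le> h s"
  shows "ext_integral M g \<le> ext_integral M h"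
  unfolding ext_integral_def
proof (rule ereal_minus_mono)
  show "enn2ereal (\<integral>\<^sup>+ s. e2ennreal (max (g s) 0) \<partial>M) \<le> enn2ereal (\<integral>\<^sup>+ s. e2ennreal (max (h s) 0) \<partial>M)"
    unfolding less_eq_ennreal.rep_eq[symmetric]
    by (rule nn_integral_mono_AE, use assms in eventually_elim) (auto intro!: e2ennreal_mono max.mono)
  show "enn2ereal (\<integral>\<^sup>+ s. e2ennreal (max (- h s) 0) \<partial>M)
    \<le> enn2ereal (\<integral>\<^sup>+ s. e2ennreal (max (- g s) 0) \<partial>M)"
    unfolding less_eq_ennreal.rep_eq[symmetric]
    by (rule nn_integral_mono_AE, use assms in eventually_elim) (auto intro!: e2ennreal_mono max.mono)
qed

lemma ext_integral_real:
  assumes h: "integrable M h"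
  shows "ext_integral M (\<lambda>s. ereal (h s)) = ereal (\<integral>s. h s \<partial>M)"
proof -
  have eq: "e2ennreal (max (ereal a) 0) = ennreal a" for a
    by (cases "a \<ge> 0") (auto simp: max_def ennreal_neg)
  have pos: "enn2ereal (\<integral>\<^sup>+ s. ennreal (h s) \<partial>M) = ereal (enn2real (\<integral>\<^sup>+ s. ennreal (h s) \<partial>M))"
    and neg: "enn2ereal (\<integral>\<^sup>+ s. ennreal (- h s) \<partial>M) = ereal (enn2real (\<integral>\<^sup>+ s. ennreal (- h s) \<partial>M))"
  proof -
    have "(\<integral>\<^sup>+ s. ennreal (h s) \<partial>M) \<le> (\<integral>\<^sup>+ s. ennreal (norm (h s)) \<partial>M)"
      "(\<integral>\<^sup>+ s. ennreal (- h s) \<partial>M) \<le> (\<integral>\<^sup>+ s. ennreal (norm (h s)) \<partial>M)"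
      by (auto intro!: nn_integral_mono ennreal_leI)
    moreover have "(\<integral>\<^sup>+ s. ennreal (norm (h s)) \<partial>M) < \<infinity>" using h by (simp add: integrable_iff_bounded)
    ultimately have "(\<integral>\<^sup>+ s. ennreal (h s) \<partial>M) < top" "(\<integral>\<^sup>+ s. ennreal (- h s) \<partial>M) < top"
      by (auto intro: order_le_less_trans)
    then show "enn2ereal (\<integral>\<^sup>+ s. ennreal (h s) \<partial>M) = ereal (enn2real (\<integral>\<^sup>+ s. ennreal (h s) \<partial>M))"
      "enn2ereal (\<integral>\<^sup>+ s. ennreal (- h s) \<partial>M) = ereal (enn2real (\<integral>\<^sup>+ s. ennreal (- h s) \<partial>M))"
      by (metis enn2ereal_ennreal enn2real_nonneg ennreal_enn2real)+
  qed
  have "ext_integral M (\<lambda>s. ereal (h s))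
    = enn2ereal (\<integral>\<^sup>+ s. ennreal (h s) \<partial>M) - enn2ereal (\<integral>\<^sup>+ s. ennreal (- h s) \<partial>M)"
    unfolding ext_integral_def uminus_ereal.simps eq ..
  also have "\<dots> = ereal (\<integral>s. h s \<partial>M)"
    unfolding pos neg by (simp add: real_lebesgue_integral_def[OF h])
  finally show ?thesis .
qed

lemma ext_integral_le_integral:
  assumes "integrable M h" "AE s in M. g s \<le> ereal (h s)"
  shows "ext_integral M g \<le> ereal (\<integral>s. h s \<partial>M)"
  using ext_integral_mono[OF assms(2)] ext_integral_real[OF assms(1)] by simp

text \<open>
  Finiteness of the integral forces both parts to be finite, since \<open>\<infinity> - \<infinity> = \<infinity>\<close>.
\<close>

lemma ext_integral_finite:
  assumes g[measurable]: "g \<in> borel_measurable M" and fin: "ext_integral M g = ereal r"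
  shows "AE s in M. g s = ereal (real_of_ereal (g s))"
    and "integrable M (\<lambda>s. real_of_ereal (g s))"
    and "(\<integral>s. real_of_ereal (g s) \<partial>M) = r"
proof -
  let ?p = "\<integral>\<^sup>+ s. e2ennreal (max (g s) 0) \<partial>M" and ?n = "\<integral>\<^sup>+ s. e2ennreal (max (- g s) 0) \<partial>M"
  have "enn2ereal ?p - enn2ereal ?n = ereal r" using fin by (simp add: ext_integral_def)
  then have "enn2ereal ?p \<noteq> \<infinity>" "enn2ereal ?n \<noteq> \<infinity>"
    by (cases "enn2ereal ?p"; cases "enn2ereal ?n"; auto)+
  then have p: "?p \<noteq> \<infinity>" and n: "?n \<noteq> \<infinity>" by simp_all
  have "AE s in M. e2ennreal (max (g s) 0) \<noteq> \<infinity>" using p by (intro nn_integral_PInf_AE) auto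
  moreover have "AE s in M. e2ennreal (max (- g s) 0) \<noteq> \<infinity>" using n by (intro nn_integral_PInf_AE) auto
  ultimately show fin_AE: "AE s in M. g s = ereal (real_of_ereal (g s))"
  proof eventually_elim
    case (elim s)
    then show ?case by (cases "g s") (auto simp: max_def e2ennreal_infty split: if_splits)
  qed
  have "(\<integral>\<^sup>+ s. ennreal (norm (real_of_ereal (g s))) \<partial>M)
    \<le> (\<integral>\<^sup>+ s. e2ennreal (max (g s) 0) + e2ennreal (max (- g s) 0) \<partial>M)"
  proof (rule nn_integral_mono)
    fix s
    show "ennreal (norm (real_of_ereal (g s))) \<le> e2ennreal (max (g s) 0) + e2ennreal (max (- g s) 0)"
      by (cases "g s") (auto simp: max_def abs_if e2ennreal_neg)
  qed
  also have "\<dots> = ?p + ?n" by (rule nn_integral_add) auto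
  also have "\<dots> < \<infinity>" using p n by (auto simp: less_top)
  finally show int: "integrable M (\<lambda>s. real_of_ereal (g s))" by (intro integrableI_bounded) auto
  have "ext_integral M g = ext_integral M (\<lambda>s. ereal (real_of_ereal (g s)))"
    by (rule antisym; rule ext_integral_mono; use fin_AE in eventually_elim) auto
  then show "(\<integral>s. real_of_ereal (g s) \<partial>M) = r" using fin ext_integral_real[OF int] by simp
qed

section \<open>Square-integrable martingales and independent samples\<close>

lemma integrable_product_of_square_integrable:
  fixes f g :: "'a \<Rightarrow> real"
  assumes [measurable]: "f \<in> borel_measurable M" "g \<in> borel_measurable M"
    and "integrable M (\<lambda>x. (f x)\<^sup>2)" "integrable M (\<lambda>x. (g x)\<^sup>2)"
  shows "integrable M (\<lambda>x. f x * g x)"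
proof (rule Bochner_Integration.integrable_bound)
  show "integrable M (\<lambda>x. (f x)\<^sup>2 + (g x)\<^sup>2)" using assms by simp
  have "\<bar>f x * g x\<bar> \<le> (f x)\<^sup>2 + (g x)\<^sup>2" for x
  proof -
    have "2 * \<bar>f x * g x\<bar> \<le> (f x)\<^sup>2 + (g x)\<^sup>2"
      using sum_squares_bound[of "\<bar>f x\<bar>" "\<bar>g x\<bar>"] by (simp add: abs_mult)
    then show ?thesis by (smt (verit) abs_ge_zero)
  qed
  then show "AE x in M. norm (f x * g x) \<le> norm ((f x)\<^sup>2 + (g x)\<^sup>2)" by simp
qed simp

text \<open>
  Kolmogorov's maximal inequality. \<open>Y\<close> is the martingale stopped when it first leaves the interval
  from \<open>- \<epsilon>\<close> to \<open>\<epsilon>\<close>: it has no larger second moment, and it still exceeds \<open>\<epsilon>\<close> at time \<open>n\<close> if the exit has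
  happened before. The martingale property enters as orthogonality of each increment to the square
  integrable functions of the past.
\<close>

lemma (in prob_space) L2_martingale_maximal_inequality:
  fixes D :: "nat \<Rightarrow> 'a \<Rightarrow> real" and G :: "nat \<Rightarrow> 'a measure"
  assumes G: "\<And>n. subalgebra M (G n)" "\<And>n. subalgebra (G (Suc n)) (G n)"
    and D: "\<And>n. D n \<in> borel_measurable (G (Suc n))"
    and sq: "\<And>n. integrable M (\<lambda>\<omega>. (D n \<omega>)\<^sup>2)"
    and orth: "\<And>n g. g \<in> borel_measurable (G n) \<Longrightarrow> integrable M (\<lambda>\<omega>. (g \<omega>)\<^sup>2) \<Longrightarrow>
                 (\<integral>\<omega>. g \<omega> * D n \<omega> \<partial>M) = 0"
    and e: "\<epsilon> > 0"
  shows "prob {\<omega> \<in> space M. \<exists>j\<le>n. \<epsilon> < \<bar>\<Sum>k<j. D k \<omega>\<bar>} \<le> (\<Sum>k<n. \<integral>\<omega>. (D k \<omega>)\<^sup>2 \<partial>M) / \<epsilon>\<^sup>2"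
proof -
  define T where "T j \<omega> = (\<Sum>k<j. D k \<omega>)" for j \<omega>
  define d where "d k \<omega> = (if \<forall>j\<le>k. \<bar>T j \<omega>\<bar> \<le> \<epsilon> then D k \<omega> else 0)" for k \<omega>
  define Y where "Y n \<omega> = (\<Sum>k<n. d k \<omega>)" for n \<omega>
  have T_Suc: "T (Suc n) \<omega> = T n \<omega> + D n \<omega>" and Y_Suc: "Y (Suc n) \<omega> = Y n \<omega> + d n \<omega>" for n \<omega>
    by (simp_all add: T_def Y_def)
  have up: "h \<in> borel_measurable (G (Suc n))" if "h \<in> borel_measurable (G n)" for h :: "'a \<Rightarrow> real" and n
    using measurable_from_subalg[OF G(2) that] .
  have toM[measurable_dest]: "h \<in> borel_measurable M"
    if "h \<in> borel_measurable (G n)" for h :: "'a \<Rightarrow> real" and n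
    using measurable_from_subalg[OF G(1) that] .
  have G_mono: "h \<in> borel_measurable (G n)"
    if "h \<in> borel_measurable (G m)" "m \<le> n" for h :: "'a \<Rightarrow> real" and m n
    using that(2,1) by (induction n rule: dec_induct) (auto intro: up)
  have T_meas: "T n \<in> borel_measurable (G n)" for n
    unfolding T_def by (intro borel_measurable_sum) (auto intro: G_mono[OF D])
  have I_meas: "Measurable.pred (G n) (\<lambda>\<omega>. \<forall>j\<le>n. \<bar>T j \<omega>\<bar> \<le> \<epsilon>)" for n
  proof -
    have [measurable]: "(\<lambda>\<omega>. T j \<omega>) \<in> borel_measurable (G n)" if "j \<le> n" for j
      using G_mono[OF T_meas that] .
    have "Measurable.pred (G n) (\<lambda>\<omega>. \<forall>j\<in>{..n}. \<bar>T j \<omega>\<bar> \<le> \<epsilon>)"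
      by (intro pred_intros_finite) auto
    then show ?thesis by simp
  qed
  have d_meas: "d n \<in> borel_measurable (G (Suc n))" for n
  proof -
    have "Measurable.pred (G (Suc n)) (\<lambda>\<omega>. \<forall>j\<le>n. \<bar>T j \<omega>\<bar> \<le> \<epsilon>)"
      using measurable_from_subalg[OF G(2) I_meas] .
    then show ?thesis unfolding d_def using D by measurable
  qed
  have Y_meas: "Y n \<in> borel_measurable (G n)" for n
    unfolding Y_def by (intro borel_measurable_sum) (auto intro: G_mono[OF d_meas])
  have DM[measurable]: "D n \<in> borel_measurable M" and YM[measurable]: "Y n \<in> borel_measurable M"
    and dM[measurable]: "d n \<in> borel_measurable M" and TM[measurable]: "T n \<in> borel_measurable M" for n
    using toM D Y_meas d_meas T_meas by blast+
  have d_sq: "integrable M (\<lambda>\<omega>. (d n \<omega>)\<^sup>2)" "(\<integral>\<omega>. (d n \<omega>)\<^sup>2 \<partial>M) \<le> (\<integral>\<omega>. (D n \<omega>)\<^sup>2 \<partial>M)" for n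
  proof -
    show int: "integrable M (\<lambda>\<omega>. (d n \<omega>)\<^sup>2)"
      by (rule Bochner_Integration.integrable_bound[OF sq[of n]]) (auto simp: d_def)
    show "(\<integral>\<omega>. (d n \<omega>)\<^sup>2 \<partial>M) \<le> (\<integral>\<omega>. (D n \<omega>)\<^sup>2 \<partial>M)"
      by (rule integral_mono[OF int sq]) (simp add: d_def)
  qed
  have Y_sq: "integrable M (\<lambda>\<omega>. (Y n \<omega>)\<^sup>2) \<and> (\<integral>\<omega>. (Y n \<omega>)\<^sup>2 \<partial>M) \<le> (\<Sum>k<n. \<integral>\<omega>. (D k \<omega>)\<^sup>2 \<partial>M)" for n
  proof (induction n)
    case (Suc n)
    define g where "g \<omega> = (if \<forall>j\<le>n. \<bar>T j \<omega>\<bar> \<le> \<epsilon> then Y n \<omega> else 0)" for \<omega>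
    have g_meas: "g \<in> borel_measurable (G n)" unfolding g_def using I_meas[of n] Y_meas[of n]
      by measurable
    have Yd: "Y n \<omega> * d n \<omega> = g \<omega> * D n \<omega>" for \<omega>
    proof (cases "\<forall>j\<le>n. \<bar>T j \<omega>\<bar> \<le> \<epsilon>")
      case True
      then have "g \<omega> = Y n \<omega>" "d n \<omega> = D n \<omega>" by (simp_all add: g_def d_def)
      then show ?thesis by simp
    next
      case False
      then have "g \<omega> = 0" "d n \<omega> = 0" by (simp_all only: g_def d_def if_False)
      then show ?thesis by simp
    qed
    have Yn: "integrable M (\<lambda>\<omega>. (Y n \<omega>)\<^sup>2)" using Suc by blast
    have "integrable M (\<lambda>\<omega>. (g \<omega>)\<^sup>2)"
      by (rule Bochner_Integration.integrable_bound[OF Yn]) (use toM[OF g_meas] in \<open>auto simp: g_def\<close>)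
    then have zero: "(\<integral>\<omega>. Y n \<omega> * d n \<omega> \<partial>M) = 0" unfolding Yd by (rule orth[OF g_meas])
    have int: "integrable M (\<lambda>\<omega>. Y n \<omega> * d n \<omega>)"
      using Yn d_sq by (intro integrable_product_of_square_integrable) auto
    have eq: "(Y (Suc n) \<omega>)\<^sup>2 = (Y n \<omega>)\<^sup>2 + 2 * (Y n \<omega> * d n \<omega>) + (d n \<omega>)\<^sup>2" for \<omega>
      by (simp add: Y_Suc power2_eq_square algebra_simps)
    have "(\<integral>\<omega>. (Y (Suc n) \<omega>)\<^sup>2 \<partial>M) = (\<integral>\<omega>. (Y n \<omega>)\<^sup>2 \<partial>M) + (\<integral>\<omega>. (d n \<omega>)\<^sup>2 \<partial>M)"
      unfolding eq using Yn int d_sq zero by simp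
    then show ?case using Suc d_sq[of n] unfolding eq using Yn int by simp
  qed (simp add: Y_def)
  have stop: "((\<forall>j\<le>n. \<bar>T j \<omega>\<bar> \<le> \<epsilon>) \<longrightarrow> Y n \<omega> = T n \<omega>) \<and> (\<not> (\<forall>j\<le>n. \<bar>T j \<omega>\<bar> \<le> \<epsilon>) \<longrightarrow> \<epsilon> < \<bar>Y n \<omega>\<bar>)" for n \<omega>
  proof (induction n)
    case 0
    then show ?case using e by (simp add: T_def Y_def)
  next
    case (Suc n)
    show ?case
    proof (cases "\<forall>j\<le>n. \<bar>T j \<omega>\<bar> \<le> \<epsilon>")
      case True
      then have "Y (Suc n) \<omega> = T (Suc n) \<omega>" using Suc by (simp add: Y_Suc T_Suc d_def)
      then show ?thesis using True by (auto simp: le_Suc_eq)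
    next
      case False
      then have "d n \<omega> = 0" by (simp only: d_def if_False)
      then have "Y (Suc n) \<omega> = Y n \<omega>" by (simp add: Y_Suc)
      moreover have "\<not> (\<forall>j\<le>Suc n. \<bar>T j \<omega>\<bar> \<le> \<epsilon>)" using False le_SucI by blast
      moreover have "\<epsilon> < \<bar>Y n \<omega>\<bar>" using Suc False by blast
      ultimately show ?thesis by (simp only: simp_thms not_True_eq_False)
    qed
  qed
  have "prob {\<omega> \<in> space M. \<exists>j\<le>n. \<epsilon> < \<bar>T j \<omega>\<bar>} \<le> prob {\<omega> \<in> space M. \<epsilon>\<^sup>2 \<le> (Y n \<omega>)\<^sup>2}"
  proof (rule finite_measure_mono)
    show "{\<omega> \<in> space M. \<exists>j\<le>n. \<epsilon> < \<bar>T j \<omega>\<bar>} \<subseteq> {\<omega> \<in> space M. \<epsilon>\<^sup>2 \<le> (Y n \<omega>)\<^sup>2}"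
    proof safe
      fix \<omega> j assume "j \<le> n" "\<epsilon> < \<bar>T j \<omega>\<bar>"
      then have "\<epsilon> < \<bar>Y n \<omega>\<bar>" using stop[of n \<omega>] by (meson not_less)
      then show "\<epsilon>\<^sup>2 \<le> (Y n \<omega>)\<^sup>2" using e by (simp add: abs_le_square_iff[symmetric])
    qed
  qed simp
  also have "\<dots> \<le> (\<integral>\<omega>. (Y n \<omega>)\<^sup>2 \<partial>M) / \<epsilon>\<^sup>2"
    using Y_sq e by (intro integral_Markov_inequality_measure[where A="space M"]) auto
  also have "\<dots> \<le> (\<Sum>k<n. \<integral>\<omega>. (D k \<omega>)\<^sup>2 \<partial>M) / \<epsilon>\<^sup>2"
    using Y_sq by (intro divide_right_mono) auto
  finally show ?thesis unfolding T_def .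
qed

text \<open>
  The maximal inequality for the increments after time \<open>m\<close> shows that oscillations larger than \<open>\<epsilon>\<close>
  beyond every \<open>m\<close> have probability zero, so almost surely the partial sums are Cauchy.
\<close>

lemma (in prob_space) L2_martingale_converges:
  fixes D :: "nat \<Rightarrow> 'a \<Rightarrow> real" and G :: "nat \<Rightarrow> 'a measure"
  assumes G: "\<And>n. subalgebra M (G n)" "\<And>n. subalgebra (G (Suc n)) (G n)"
    and D: "\<And>n. D n \<in> borel_measurable (G (Suc n))"
    and sq: "\<And>n. integrable M (\<lambda>\<omega>. (D n \<omega>)\<^sup>2)"
    and orth: "\<And>n g. g \<in> borel_measurable (G n) \<Longrightarrow> integrable M (\<lambda>\<omega>. (g \<omega>)\<^sup>2) \<Longrightarrow>
                 (\<integral>\<omega>. g \<omega> * D n \<omega> \<partial>M) = 0"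
    and sum: "summable (\<lambda>n. \<integral>\<omega>. (D n \<omega>)\<^sup>2 \<partial>M)"
  shows "AE \<omega> in M. summable (\<lambda>n. D n \<omega>)"
proof -
  have DM[measurable]: "D n \<in> borel_measurable M" for n
    using measurable_from_subalg[OF G(1) D] .
  define R where "R m = (\<Sum>k. \<integral>\<omega>. (D (k + m) \<omega>)\<^sup>2 \<partial>M)" for m
  have R0: "R \<longlonglongrightarrow> 0" unfolding R_def using suminf_exist_split2[OF sum] .
  have tail: "AE \<omega> in M. \<exists>m. \<forall>j. \<bar>\<Sum>k<j. D (m + k) \<omega>\<bar> \<le> \<epsilon>" if e: "\<epsilon> > 0" for \<epsilon>
  proof -
    define A where "A m n = {\<omega> \<in> space M. \<exists>j\<le>n. \<epsilon> < \<bar>\<Sum>k<j. D (m + k) \<omega>\<bar>}" for m n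
    have A_sets[measurable]: "A m n \<in> sets M" for m n unfolding A_def by measurable
    have A_le: "prob (A m n) \<le> R m / \<epsilon>\<^sup>2" for m n
    proof -
      have "prob (A m n) \<le> (\<Sum>k<n. \<integral>\<omega>. (D (m + k) \<omega>)\<^sup>2 \<partial>M) / \<epsilon>\<^sup>2"
        unfolding A_def
      proof (rule L2_martingale_maximal_inequality[where G="\<lambda>n. G (m + n)"])
        show "subalgebra (G (m + Suc n)) (G (m + n))" for n using G(2)[of "m + n"] by simp
        show "D (m + n) \<in> borel_measurable (G (m + Suc n))" for n using D[of "m + n"] by simp
      qed (use G(1) sq orth e in auto)
      also have "(\<Sum>k<n. \<integral>\<omega>. (D (m + k) \<omega>)\<^sup>2 \<partial>M) \<le> R m"
        unfolding R_def using sum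
        by (subst add.commute, intro sum_le_suminf summable_ignore_initial_segment) auto
      finally show ?thesis using e by (simp add: divide_right_mono)
    qed
    have U_le: "prob (\<Union>n. A m n) \<le> R m / \<epsilon>\<^sup>2" for m
    proof -
      have "(\<lambda>n. prob (A m n)) \<longlonglongrightarrow> prob (\<Union>n. A m n)"
        by (rule finite_Lim_measure_incseq) (auto simp: A_def incseq_def intro: order_trans)
      then show ?thesis using A_le by (intro LIMSEQ_le_const2) auto
    qed
    have "prob (\<Inter>m. \<Union>n. A m n) \<le> R m / \<epsilon>\<^sup>2" for m
      using U_le[of m] by (rule order_trans[rotated]) (intro finite_measure_mono, auto)
    moreover have "(\<lambda>m. R m / \<epsilon>\<^sup>2) \<longlonglongrightarrow> 0 / \<epsilon>\<^sup>2" using e by (intro tendsto_intros R0) auto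
    ultimately have "prob (\<Inter>m. \<Union>n. A m n) \<le> 0"
      by (intro LIMSEQ_le_const[of _ 0]) auto
    then have "(\<Inter>m. \<Union>n. A m n) \<in> null_sets M"
      by (auto simp: null_sets_def emeasure_eq_measure measure_le_0_iff)
    then have "AE \<omega> in M. \<omega> \<notin> (\<Inter>m. \<Union>n. A m n)" by (rule AE_not_in)
    then show ?thesis
      using AE_space by eventually_elim (auto simp: A_def not_less)
  qed
  have "AE \<omega> in M. \<forall>i. \<exists>m. \<forall>j. \<bar>\<Sum>k<j. D (m + k) \<omega>\<bar> \<le> 1 / Suc i"
    unfolding AE_all_countable using tail by simp
  then show ?thesis
  proof eventually_elim
    case (elim \<omega>)
    show ?case
      unfolding summable_Cauchy
    proof (intro allI impI)
      fix e :: real assume "e > 0"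
      then obtain i where i: "1 / Suc i < e / 2" using nat_approx_posE[of "e / 2"]
        by (metis half_gt_zero)
      obtain m where m: "\<And>j. \<bar>\<Sum>k<j. D (m + k) \<omega>\<bar> \<le> 1 / Suc i" using elim by blast
      have "norm (\<Sum>k\<in>{p..<q}. D k \<omega>) < e" if "m \<le> p" for p q
      proof (cases "p \<le> q")
        case True
        have shift: "(\<Sum>k<j. D (m + k) \<omega>) = (\<Sum>k\<in>{m..<m+j}. D k \<omega>)" for j
          using sum.shift_bounds_nat_ivl[of "\<lambda>k. D k \<omega>" 0 m j]
            by (simp add: atLeast0LessThan add.commute)
        have "(\<Sum>k\<in>{m..<q}. D k \<omega>) = (\<Sum>k\<in>{m..<p}. D k \<omega>) + (\<Sum>k\<in>{p..<q}. D k \<omega>)"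
          using that True by (simp add: sum.atLeastLessThan_concat)
        then show ?thesis
          using m[of "p - m"] m[of "q - m"] that True i by (simp add: shift)
      qed (use \<open>e > 0\<close> in simp)
      then show "\<exists>N. \<forall>p\<ge>N. \<forall>q. norm (\<Sum>k\<in>{p..<q}. D k \<omega>) < e" by blast
    qed
  qed
qed

text \<open>
  The perturbations \<open>c\<close> may change sign and need only be conditionally summable, as is the case for
  martingale increments.
\<close>

lemma almost_decreasing_convergent:
  fixes V c :: "nat \<Rightarrow> real"
  assumes V: "\<And>n. 0 \<le> V n" and step: "\<And>n. V (Suc n) \<le> V n + c n" and c: "summable c"
  shows "convergent V"
proof -
  define S where "S n = (\<Sum>k<n. c k)" for n
  have S: "S \<longlonglongrightarrow> suminf c" unfolding S_def using summable_LIMSEQ[OF c] .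
  then obtain K where K: "\<And>n. norm (S n) \<le> K"
    using convergent_imp_Bseq[OF convergentI[OF S]] unfolding Bseq_def by blast
  have "decseq (\<lambda>n. V n - S n)" by (rule decseq_SucI) (use step in \<open>simp add: S_def algebra_simps\<close>)
  moreover have "\<forall>n. - K \<le> V n - S n" using V K by (smt (verit) real_norm_def)
  ultimately obtain L where "(\<lambda>n. V n - S n) \<longlonglongrightarrow> L" by (rule decseq_convergent)
  from tendsto_add[OF this S] show ?thesis by (auto simp: convergent_def)
qed

text \<open>
  For an i.i.d. sequence the next sample is independent of the \<open>\<sigma>\<close>-algebra \<open>G n\<close> generated by the first
  \<open>n\<close> samples. This is expressed through the joint law of the outcome \<open>\<omega>\<close>, seen by \<open>G n\<close>, and the next
  sample, so that conditional expectations given \<open>G n\<close> become inner integrals by Fubini's theorem.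
\<close>

lemma (in prob_space) indep_vars_history:
  assumes X: "\<And>n. n \<ge> (1::nat) \<Longrightarrow> X n \<in> measurable M N" and ind: "indep_vars (\<lambda>_. N) X {1..}"
    and dist: "\<And>n. n \<ge> 1 \<Longrightarrow> distr M N (X n) = N" and N: "sigma_finite_measure N"
  defines "G \<equiv> (\<lambda>n. vimage_algebra (space M) (\<lambda>\<omega>. \<lambda>i\<in>{1..n}. X i \<omega>) (PiM {1..n} (\<lambda>_. N)))"
  shows "subalgebra M (G n)" and "subalgebra (G (Suc n)) (G n)" and "X (Suc n)
    \<in> measurable (G (Suc n)) N"
    and "distr M (G n \<Otimes>\<^sub>M N) (\<lambda>\<omega>. (\<omega>, X (Suc n) \<omega>)) = distr M (G n) (\<lambda>\<omega>. \<omega>) \<Otimes>\<^sub>M N"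
proof -
  define W where "W n = (\<lambda>\<omega>. \<lambda>i\<in>{1..n}. X i \<omega>)" for n
  have W: "W n \<in> measurable M (PiM {1..n} (\<lambda>_. N))" for n
    unfolding W_def by (intro measurable_restrict X) auto
  have G_def': "G n = vimage_algebra (space M) (W n) (PiM {1..n} (\<lambda>_. N))" for n
    unfolding G_def W_def ..
  have W_Pi: "W n \<in> space M \<rightarrow> space (PiM {1..n} (\<lambda>_. N))" for n
    using measurable_space[OF W] by (rule Pi_I)
  have WG: "W n \<in> measurable (G n) (PiM {1..n} (\<lambda>_. N))" for n
    unfolding G_def' by (rule measurable_vimage_algebra1[OF W_Pi])
  have G_sets: "sets (G n) = {W n -` A \<inter> space M | A. A \<in> sets (PiM {1..n} (\<lambda>_. N))}" for n
    unfolding G_def' by (rule sets_vimage_algebra2[OF W_Pi])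
  have G_space: "space (G n) = space M" for n unfolding G_def' by simp
  have sub: "subalgebra M (G n)" for n
    unfolding subalgebra_def G_space G_sets by (auto intro!: measurable_sets[OF W])
  show "subalgebra M (G n)" by (rule sub)
  have XG: "X i \<in> measurable (G n) N" if "i \<in> {1..n}" for i n
  proof -
    have "(\<lambda>\<omega>. W n \<omega> i) \<in> measurable (G n) N" using WG that
      by (rule measurable_compose[OF _ measurable_component_singleton])
    moreover have "(\<lambda>\<omega>. W n \<omega> i) = X i" using that by (simp add: W_def)
    ultimately show ?thesis by simp
  qed
  then show "X (Suc n) \<in> measurable (G (Suc n)) N" by simp
  have "W n \<in> measurable (G (Suc n)) (PiM {1..n} (\<lambda>_. N))"
    unfolding W_def using XG by (intro measurable_restrict) auto
  then show "subalgebra (G (Suc n)) (G n)"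
    unfolding subalgebra_def G_sets[of n] G_space
    using measurable_sets[of "W n" "G (Suc n)"] by (auto simp: G_space)
  have ind: "indep_var (PiM {1..n} (\<lambda>_. N)) (W n) (PiM {Suc n} (\<lambda>_. N)) (\<lambda>\<omega>. \<lambda>i\<in>{Suc n}. X i \<omega>)"
    unfolding W_def by (rule indep_var_restrict[OF ind]) auto
  have indD: "prob (W n -` A \<inter> space M \<inter> (X (Suc n) -` B \<inter> space M))
    = prob (W n -` A \<inter> space M) * prob (X (Suc n) -` B \<inter> space M)"
    if A: "A \<in> sets (PiM {1..n} (\<lambda>_. N))" and B: "B \<in> sets N" for A B
  proof -
    let ?V = "\<lambda>\<omega>. \<lambda>i\<in>{Suc n}. X i \<omega>"
    let ?B = "(\<lambda>w. w (Suc n)) -` B \<inter> space (PiM {Suc n} (\<lambda>_. N))"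
    have B': "?B \<in> sets (PiM {Suc n} (\<lambda>_. N))"
      by (rule measurable_sets[OF _ B]) simp
    have V: "?V -` ?B \<inter> space M = X (Suc n) -` B \<inter> space M"
      using measurable_space[OF X[of "Suc n"]] by (auto simp: space_PiM)
    have "(\<lambda>\<omega>. (W n \<omega>, ?V \<omega>)) -` (A \<times> ?B) \<inter> space M = W n -` A \<inter> space M \<inter> (?V -` ?B \<inter> space M)" by auto
    then show ?thesis using indep_varD[OF ind A B'] unfolding V by simp
  qed
  interpret N: sigma_finite_measure N by fact
  have idG: "(\<lambda>\<omega>. \<omega>) \<in> measurable M (G n)"
    by (rule measurable_from_subalg[OF sub measurable_ident_sets[OF refl]])
  interpret D: prob_space "distr M (G n) (\<lambda>\<omega>. \<omega>)" by (rule prob_space_distr[OF idG])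
  have pairG: "(\<lambda>\<omega>. (\<omega>, X (Suc n) \<omega>)) \<in> measurable M (G n \<Otimes>\<^sub>M N)"
    using idG X[of "Suc n"] by (intro measurable_Pair) auto
  show "distr M (G n \<Otimes>\<^sub>M N) (\<lambda>\<omega>. (\<omega>, X (Suc n) \<omega>)) = distr M (G n) (\<lambda>\<omega>. \<omega>) \<Otimes>\<^sub>M N"
  proof (rule pair_measure_eqI[symmetric])
    fix A B assume A: "A \<in> sets (distr M (G n) (\<lambda>\<omega>. \<omega>))" and B: "B \<in> sets N"
    then obtain A' where A': "A' \<in> sets (PiM {1..n} (\<lambda>_. N))" "A = W n -` A' \<inter> space M"
      unfolding sets_distr G_sets by blast
    have "emeasure N B = emeasure (distr M N (X (Suc n))) B" by (simp add: dist)
    also have "\<dots> = emeasure M (X (Suc n) -` B \<inter> space M)" using X B by (intro emeasure_distr) auto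
    finally have NB: "emeasure N B = prob (X (Suc n) -` B \<inter> space M)" by (simp add: emeasure_eq_measure)
    have "emeasure (distr M (G n) (\<lambda>\<omega>. \<omega>)) A = emeasure M A"
      using A sub[of n] by (subst emeasure_distr[OF idG])
        (auto simp: subalgebra_def intro!: arg_cong[where f="emeasure M"] dest: sets.sets_into_space)
    moreover have "emeasure (distr M (G n \<Otimes>\<^sub>M N) (\<lambda>\<omega>. (\<omega>, X (Suc n) \<omega>))) (A \<times> B)
        = emeasure M (A \<inter> (X (Suc n) -` B \<inter> space M))"
      using A B by (subst emeasure_distr[OF pairG]) (auto intro!: arg_cong[where f="emeasure M"])
    moreover have "prob (A \<inter> (X (Suc n) -` B \<inter> space M)) = prob A * prob (X (Suc n) -` B \<inter> space M)"
      unfolding A'(2) by (rule indD[OF A'(1) B])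
    ultimately show "emeasure (distr M (G n) (\<lambda>\<omega>. \<omega>)) A * emeasure N B =
        emeasure (distr M (G n \<Otimes>\<^sub>M N) (\<lambda>\<omega>. (\<omega>, X (Suc n) \<omega>))) (A \<times> B)"
      by (simp add: NB emeasure_eq_measure ennreal_mult')
  qed (auto intro: D.sigma_finite_measure_axioms N)
qed

section \<open>The stochastic proximal point iteration\<close>

lemma AE_summable_of_summable_integrals:
  fixes u :: "nat \<Rightarrow> 'a \<Rightarrow> real"
  assumes u: "\<And>n. integrable M (u n)" "\<And>n x. 0 \<le> u n x" and sum: "summable (\<lambda>n. \<integral>x. u n x \<partial>M)"
  shows "AE x in M. summable (\<lambda>n. u n x)"
proof -
  have [measurable]: "u n \<in> borel_measurable M" for n using u(1) by auto
  have "(\<integral>\<^sup>+x. (\<Sum>n. ennreal (u n x)) \<partial>M) = (\<Sum>n. \<integral>\<^sup>+x. ennreal (u n x) \<partial>M)"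
    by (rule nn_integral_suminf) measurable
  also have "\<dots> = (\<Sum>n. ennreal (\<integral>x. u n x \<partial>M))"
    by (intro suminf_cong nn_integral_eq_integral u) (simp add: u(2))
  also have "\<dots> \<noteq> \<infinity>"
    by (subst suminf_ennreal2[OF _ sum]) (simp_all add: u(2))
  finally have "AE x in M. (\<Sum>n. ennreal (u n x)) \<noteq> \<infinity>"
    by (intro nn_integral_PInf_AE) measurable
  then show ?thesis
    by eventually_elim (rule summable_suminf_not_top, simp_all add: u(2))
qed

text \<open>
  The basic estimate with the envelope bounded below by the minorant at \<open>z\<close>; on average over the
  samples the linear term will vanish.
\<close>

lemma prox_step_subgradient:
  fixes g :: "'h::{real_inner, banach} \<Rightarrow> ereal"
  assumes g: "lsc g" "proper g" "convex_fun g" and c: "c > 0" and u: "u \<in> subdiff g z"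
  shows "(norm (prox c g x - z))\<^sup>2 \<le> (norm (x - z))\<^sup>2 - 2 * c * inner u (x - z) + c\<^sup>2 * (norm u)\<^sup>2"
proof -
  obtain r where r: "g z = ereal r" by (rule subdiff_finite[OF g(2) u])
  have "(norm (prox c g x - z))\<^sup>2 \<le> (norm (x - z))\<^sup>2 - 2 * c * (moreau_envelope c g x - r)"
    by (rule prox_step_inequality[OF g c]) (simp add: r)
  moreover have "2 * c * (r + inner u (x - z) - c / 2 * (norm u)\<^sup>2) \<le> 2 * c * moreau_envelope c g x"
    using moreau_ge_affine[OF g c u, of x] c by (intro mult_left_mono) (auto simp: r)
  ultimately show ?thesis by (simp add: algebra_simps power2_eq_square)
qed

locale stochastic_proximal_point = M: prob_space M + P: prob_space P
  for M :: "'e measure" and P :: "'w measure" +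
  fixes \<xi> :: "nat \<Rightarrow> 'w \<Rightarrow> 'e"
    and f :: "'e \<Rightarrow> 'h::{real_inner, banach, second_countable_topology} \<Rightarrow> ereal"
    and lam :: "nat \<Rightarrow> real" and x0 :: 'h and x :: "nat \<Rightarrow> 'w \<Rightarrow> 'h"
  assumes M_complete: "complete_measure M"
    and lam_pos: "\<And>n. lam n > 0" and lam_sq: "summable (\<lambda>n. (lam n)\<^sup>2)"
    and xi_rv: "\<And>n. n \<ge> 1 \<Longrightarrow> \<xi> n \<in> measurable P M"
    and xi_indep: "P.indep_vars (\<lambda>_. M) \<xi> {1..}"
    and xi_distr: "\<And>n. n \<ge> 1 \<Longrightarrow> distr P M (\<xi> n) = M"
    and f_normal: "normal_convex_integrand M f"
    and x_0: "\<And>\<omega>. \<omega> \<in> space P \<Longrightarrow> x 0 \<omega> = x0"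
    and x_Suc: "\<And>n \<omega>. \<omega> \<in> space P \<Longrightarrow> x (Suc n) \<omega> = prox (lam n) (f (\<xi> (Suc n) \<omega>)) (x n \<omega>)"
begin

definition history :: "nat \<Rightarrow> 'w measure" where
  "history n = vimage_algebra (space P) (\<lambda>\<omega>. \<lambda>i\<in>{1..n}. \<xi> i \<omega>) (PiM {1..n} (\<lambda>_. M))"

lemma history:
  "subalgebra P (history n)" "subalgebra (history (Suc n)) (history n)"
  "\<xi> (Suc n) \<in> measurable (history (Suc n)) M"
  "distr P (history n \<Otimes>\<^sub>M M) (\<lambda>\<omega>. (\<omega>, \<xi> (Suc n) \<omega>)) = distr P (history n) (\<lambda>\<omega>. \<omega>) \<Otimes>\<^sub>M M"
  using P.indep_vars_history[OF xi_rv xi_indep xi_distr M.sigma_finite_measure_axioms]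
  by (simp_all add: history_def)

lemma space_history: "space (history n) = space P"
  using history(1)[of n] by (simp add: subalgebra_def)

lemma measurable_history_P: "h \<in> measurable (history n) N \<Longrightarrow> h \<in> measurable P N"
  using measurable_from_subalg[OF history(1)] .

lemma id_history: "(\<lambda>\<omega>. \<omega>) \<in> measurable P (history n)"
  by (rule measurable_history_P[OF measurable_ident_sets[OF refl]])

lemma pair_history: "(\<lambda>\<omega>. (\<omega>, \<xi> (Suc n) \<omega>)) \<in> measurable P (history n \<Otimes>\<^sub>M M)"
  using id_history xi_rv[of "Suc n"] by (intro measurable_Pair) auto

text \<open>
  Conditioning on the past: the next sample may be integrated out while the past is kept fixed.
\<close>

lemma nn_integral_next:
  assumes h[measurable]: "h \<in> borel_measurable (history n \<Otimes>\<^sub>M M)"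
  shows "(\<integral>\<^sup>+\<omega>. h (\<omega>, \<xi> (Suc n) \<omega>) \<partial>P) = (\<integral>\<^sup>+\<omega>. (\<integral>\<^sup>+s. h (\<omega>, s) \<partial>M) \<partial>P)"
proof -
  have "(\<integral>\<^sup>+\<omega>. h (\<omega>, \<xi> (Suc n) \<omega>) \<partial>P) = (\<integral>\<^sup>+w. h w \<partial>distr P (history n \<Otimes>\<^sub>M M) (\<lambda>\<omega>. (\<omega>, \<xi> (Suc n) \<omega>)))"
    using pair_history h by (subst nn_integral_distr) auto
  also have "\<dots> = (\<integral>\<^sup>+w. h w \<partial>(distr P (history n) (\<lambda>\<omega>. \<omega>) \<Otimes>\<^sub>M M))" by (simp only: history(4))
  also have "\<dots> = (\<integral>\<^sup>+\<omega>. (\<integral>\<^sup>+s. h (\<omega>, s) \<partial>M) \<partial>distr P (history n) (\<lambda>\<omega>. \<omega>))"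
    by (rule M.nn_integral_fst[symmetric]) simp
  also have "\<dots> = (\<integral>\<^sup>+\<omega>. (\<integral>\<^sup>+s. h (\<omega>, s) \<partial>M) \<partial>P)"
    using id_history by (subst nn_integral_distr) auto
  finally show ?thesis .
qed

lemma integral_next:
  fixes h :: "'w \<times> 'e \<Rightarrow> real"
  assumes h[measurable]: "h \<in> borel_measurable (history n \<Otimes>\<^sub>M M)"
    and int: "integrable P (\<lambda>\<omega>. h (\<omega>, \<xi> (Suc n) \<omega>))"
  shows "(\<integral>\<omega>. h (\<omega>, \<xi> (Suc n) \<omega>) \<partial>P) = (\<integral>\<omega>. (\<integral>s. h (\<omega>, s) \<partial>M) \<partial>P)"
proof -
  let ?H = "distr P (history n) (\<lambda>\<omega>. \<omega>)"
  interpret H: prob_space ?H by (rule P.prob_space_distr[OF id_history])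
  interpret HM: pair_sigma_finite ?H M ..
  have "(\<integral>\<omega>. h (\<omega>, \<xi> (Suc n) \<omega>) \<partial>P) = (\<integral>w. h w \<partial>(?H \<Otimes>\<^sub>M M))"
    using pair_history h by (simp add: history(4)[symmetric] integral_distr)
  also have "\<dots> = (\<integral>\<omega>. (\<integral>s. h (\<omega>, s) \<partial>M) \<partial>?H)"
  proof (rule HM.integral_fst'[symmetric])
    show "integrable (?H \<Otimes>\<^sub>M M) h"
      using int pair_history h by (simp add: history(4)[symmetric] integrable_distr_eq)
  qed
  also have "\<dots> = (\<integral>\<omega>. (\<integral>s. h (\<omega>, s) \<partial>M) \<partial>P)"
    using id_history by (subst integral_distr) auto
  finally show ?thesis .
qed

lemma AE_next:
  assumes "AE s in M. Q s"
  shows "AE \<omega> in P. Q (\<xi> (Suc n) \<omega>)"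
proof -
  have rv: "\<xi> (Suc n) \<in> measurable P M" by (rule xi_rv) simp
  have "distr P M (\<xi> (Suc n)) = M" by (rule xi_distr) simp
  then have "AE s in distr P M (\<xi> (Suc n)). Q s" using assms by (simp only:)
  then show ?thesis by (rule AE_distrD[OF rv])
qed

lemma space_xi: "\<omega> \<in> space P \<Longrightarrow> \<xi> (Suc n) \<omega> \<in> space M"
  using measurable_space[OF xi_rv[of "Suc n"]] by simp

lemma iterate_measurable: "x n \<in> borel_measurable (history n)"
proof (induction n)
  case 0
  have "x 0 \<in> borel_measurable (history 0) \<longleftrightarrow> (\<lambda>_. x0) \<in> borel_measurable (history 0)"
    by (rule measurable_cong) (simp add: space_history x_0)
  then show ?case by simp
next
  case (Suc n)
  have "(\<lambda>\<omega>. (\<xi> (Suc n) \<omega>, x n \<omega>)) \<in> measurable (history (Suc n)) (M \<Otimes>\<^sub>M borel)"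
    using history(3) measurable_from_subalg[OF history(2) Suc] by (rule measurable_Pair)
  from measurable_compose[OF this prox_measurable[OF M.finite_measure_axioms M_complete f_normal
    lam_pos]]
  have "(\<lambda>\<omega>. prox (lam n) (f (\<xi> (Suc n) \<omega>)) (x n \<omega>)) \<in> borel_measurable (history (Suc n))" by simp
  moreover have "x (Suc n) \<in> borel_measurable (history (Suc n)) \<longleftrightarrow>
      (\<lambda>\<omega>. prox (lam n) (f (\<xi> (Suc n) \<omega>)) (x n \<omega>)) \<in> borel_measurable (history (Suc n))"
    by (rule measurable_cong) (simp add: space_history x_Suc)
  ultimately show ?case by simp
qed

end

section \<open>Distance to a reference point and mean excess\<close>

text \<open>
  The optimality of a minimizer \<open>z\<close> enters the estimates only through the selection \<open>\<phi>\<close> with mean zero.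
\<close>

locale stochastic_proximal_point_zero = stochastic_proximal_point M P \<xi> f lam x0 x
  for M :: "'e measure" and P :: "'w measure" and \<xi> and f :: "'e \<Rightarrow> 'h::{real_inner, banach,
    second_countable_topology} \<Rightarrow> ereal"
    and lam x0 x +
  fixes z :: 'h and \<phi> :: "'e \<Rightarrow> 'h"
  assumes phi_meas[measurable]: "\<phi> \<in> borel_measurable M"
    and phi_sub: "AE s in M. \<phi> s \<in> subdiff (f s) z"
    and phi_sq: "integrable M (\<lambda>s. (norm (\<phi> s))\<^sup>2)"
    and phi_0: "(\<integral>s. \<phi> s \<partial>M) = 0"
begin

text \<open>
  \<open>noise\<close> is a martingale difference, because \<open>\<phi>\<close> has mean zero and \<open>x n\<close> only depends on the first
  \<open>n\<close> samples. \<open>sel_var\<close> is the variance of \<open>\<phi>\<close>.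
\<close>

definition sq_dist :: "nat \<Rightarrow> 'w \<Rightarrow> real" where "sq_dist n \<omega> = (norm (x n \<omega> - z))\<^sup>2"
definition noise :: "nat \<Rightarrow> 'w \<Rightarrow> real" where "noise n \<omega> = inner (\<phi> (\<xi> (Suc n) \<omega>)) (x n \<omega> - z)"
definition sel_sq :: "nat \<Rightarrow> 'w \<Rightarrow> real" where "sel_sq n \<omega> = (norm (\<phi> (\<xi> (Suc n) \<omega>)))\<^sup>2"
definition sel_var :: real where "sel_var = (\<integral>s. (norm (\<phi> s))\<^sup>2 \<partial>M)"

lemma sq_dist_nonneg: "0 \<le> sq_dist n \<omega>" and sel_sq_nonneg: "0 \<le> sel_sq n \<omega>"
  by (simp_all add: sq_dist_def sel_sq_def)

lemma sel_var_nonneg: "sel_var \<ge> 0" by (simp add: sel_var_def)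

lemma phi_int: "integrable M \<phi>"
proof (rule Bochner_Integration.integrable_bound)
  show "integrable M (\<lambda>s. 1 + (norm (\<phi> s))\<^sup>2)" using phi_sq by simp
  have "norm (\<phi> s) \<le> 1 + (norm (\<phi> s))\<^sup>2" for s
    using sum_squares_bound[of "norm (\<phi> s)" 1] by (smt (verit) mult_1_right norm_ge_zero one_power2)
  then show "AE s in M. norm (\<phi> s) \<le> norm (1 + (norm (\<phi> s))\<^sup>2)" by simp
qed simp

lemma iterate_measurable_P[measurable]: "x n \<in> borel_measurable P"
  by (rule measurable_history_P[OF iterate_measurable])

lemma xi_measurable[measurable]: "\<xi> (Suc n) \<in> measurable P M" by (rule xi_rv) simp

lemma sq_dist_meas[measurable]: "sq_dist n \<in> borel_measurable P" unfolding sq_dist_def by measurable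
lemma noise_meas[measurable]: "noise n \<in> borel_measurable P" unfolding noise_def by measurable
lemma sel_sq_meas[measurable]: "sel_sq n \<in> borel_measurable P" unfolding sel_sq_def by measurable

lemma sel_sq_int: "integrable P (sel_sq n)" and sel_sq_integral: "(\<integral>\<omega>. sel_sq n \<omega> \<partial>P) = sel_var"
proof -
  have "integrable (distr P M (\<xi> (Suc n))) (\<lambda>s. (norm (\<phi> s))\<^sup>2)" using phi_sq xi_distr by simp
  then show "integrable P (sel_sq n)" unfolding sel_sq_def by (subst (asm) integrable_distr_eq) auto
  have "(\<integral>s. (norm (\<phi> s))\<^sup>2 \<partial>distr P M (\<xi> (Suc n))) = (\<integral>\<omega>. sel_sq n \<omega> \<partial>P)"
    unfolding sel_sq_def by (rule integral_distr) auto
  then show "(\<integral>\<omega>. sel_sq n \<omega> \<partial>P) = sel_var" using xi_distr by (simp add: sel_var_def)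
qed

lemma sq_dist_step: "AE \<omega> in P. sq_dist (Suc n) \<omega>
  \<le> sq_dist n \<omega> - 2 * lam n * noise n \<omega> + (lam n)\<^sup>2 * sel_sq n \<omega>"
  using AE_next[OF phi_sub, of n] AE_space
proof eventually_elim
  case (elim \<omega>)
  show ?case
    unfolding sq_dist_def noise_def sel_sq_def x_Suc[OF elim(2)]
    by (rule prox_step_subgradient[OF normal_convex_integrandD(2-4)[OF f_normal space_xi[OF
      elim(2)]] lam_pos elim(1)])
qed

lemma sq_dist_int: "integrable P (sq_dist n)"
proof (induction n)
  case 0
  have "integrable P (sq_dist 0) \<longleftrightarrow> integrable P (\<lambda>_. (norm (x0 - z))\<^sup>2)"
    by (rule Bochner_Integration.integrable_cong) (simp_all add: sq_dist_def x_0)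
  then show ?case by simp
next
  case (Suc n)
  show ?case
  proof (rule Bochner_Integration.integrable_bound)
    show "integrable P (\<lambda>\<omega>. 2 * sq_dist n \<omega> + 2 * ((lam n)\<^sup>2 * sel_sq n \<omega>))" using Suc sel_sq_int
      by simp
    show "AE \<omega> in P. norm (sq_dist (Suc n) \<omega>) \<le> norm (2 * sq_dist n \<omega> + 2 * ((lam n)\<^sup>2 * sel_sq n \<omega>))"
      using sq_dist_step[of n]
    proof eventually_elim
      case (elim \<omega>)
      have "\<bar>noise n \<omega>\<bar> \<le> norm (\<phi> (\<xi> (Suc n) \<omega>)) * norm (x n \<omega> - z)" unfolding noise_def
        by (rule Cauchy_Schwarz_ineq2)
      then have "2 * lam n * \<bar>noise n \<omega>\<bar> \<le> 2 * lam n * (norm (\<phi> (\<xi> (Suc n) \<omega>)) * norm (x n \<omega> - z))"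
        using lam_pos[of n] by (intro mult_left_mono) auto
      also have "\<dots> \<le> (lam n)\<^sup>2 * sel_sq n \<omega> + sq_dist n \<omega>"
        using sum_squares_bound[of "lam n * norm (\<phi> (\<xi> (Suc n) \<omega>))" "norm (x n \<omega> - z)"]
        by (simp add: sel_sq_def sq_dist_def power_mult_distrib mult.assoc)
      finally have "- (2 * lam n * noise n \<omega>) \<le> (lam n)\<^sup>2 * sel_sq n \<omega> + sq_dist n \<omega>"
        using lam_pos[of n] by (smt (verit) mult_minus_right mult_left_mono abs_ge_minus_self)
      moreover have "0 \<le> sq_dist (Suc n) \<omega>" by (simp add: sq_dist_def)
      ultimately show ?case using elim by simp
    qed
  qed simp
qed

text \<open>
  The next sample is independent of \<open>x n\<close>, so the second moment of \<open>noise\<close> is at most the product of the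
  second moments of its two factors.
\<close>

lemma noise_sq_int: "integrable P (\<lambda>\<omega>. (noise n \<omega>)\<^sup>2)"
  and noise_sq_integral: "(\<integral>\<omega>. (noise n \<omega>)\<^sup>2 \<partial>P) \<le> sel_var * (\<integral>\<omega>. sq_dist n \<omega> \<partial>P)"
proof -
  have [measurable]: "x n \<in> borel_measurable (history n)" by (rule iterate_measurable)
  define h where "h w = ennreal ((norm (\<phi> (snd w)))\<^sup>2) * ennreal ((norm (x n (fst w) - z))\<^sup>2)" for w
  have "(\<integral>\<^sup>+\<omega>. ennreal ((noise n \<omega>)\<^sup>2) \<partial>P) \<le> (\<integral>\<^sup>+\<omega>. h (\<omega>, \<xi> (Suc n) \<omega>) \<partial>P)"
  proof (rule nn_integral_mono)
    fix \<omega>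
    have "(noise n \<omega>)\<^sup>2 \<le> (norm (\<phi> (\<xi> (Suc n) \<omega>)) * norm (x n \<omega> - z))\<^sup>2"
      unfolding noise_def by (rule power2_le_iff_abs_le[THEN iffD2]) (auto intro: Cauchy_Schwarz_ineq2)
    then show "ennreal ((noise n \<omega>)\<^sup>2) \<le> h (\<omega>, \<xi> (Suc n) \<omega>)"
      by (simp add: h_def power_mult_distrib ennreal_leI flip: ennreal_mult)
  qed
  also have "\<dots> = (\<integral>\<^sup>+\<omega>. (\<integral>\<^sup>+s. h (\<omega>, s) \<partial>M) \<partial>P)"
    by (rule nn_integral_next) (unfold h_def, measurable)
  also have "\<dots> = (\<integral>\<^sup>+\<omega>. ennreal sel_var * ennreal (sq_dist n \<omega>) \<partial>P)"
    using phi_sq by (simp add: h_def nn_integral_multc nn_integral_eq_integral sel_var_def flip: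
      sq_dist_def)
  also have "\<dots> = ennreal sel_var * ennreal (\<integral>\<omega>. sq_dist n \<omega> \<partial>P)"
    using sq_dist_int by (subst nn_integral_cmult) (auto simp: nn_integral_eq_integral sq_dist_nonneg)
  also have "\<dots> = ennreal (sel_var * (\<integral>\<omega>. sq_dist n \<omega> \<partial>P))"
    using sel_var_nonneg by (intro ennreal_mult[symmetric]) (auto simp: sq_dist_def)
  finally have le: "(\<integral>\<^sup>+\<omega>. ennreal ((noise n \<omega>)\<^sup>2) \<partial>P) \<le> ennreal (sel_var * (\<integral>\<omega>. sq_dist n \<omega> \<partial>P))" .
  then show int: "integrable P (\<lambda>\<omega>. (noise n \<omega>)\<^sup>2)"
    by (intro integrableI_bounded) (auto intro: order_le_less_trans)
  show "(\<integral>\<omega>. (noise n \<omega>)\<^sup>2 \<partial>P) \<le> sel_var * (\<integral>\<omega>. sq_dist n \<omega> \<partial>P)"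
    using le int sel_var_nonneg
    by (simp add: nn_integral_eq_integral ennreal_le_iff sq_dist_def)
qed

lemma noise_orth:
  assumes g: "g \<in> borel_measurable (history n)" "integrable P (\<lambda>\<omega>. (g \<omega>)\<^sup>2)"
  shows "(\<integral>\<omega>. g \<omega> * noise n \<omega> \<partial>P) = 0"
proof -
  note [measurable] = g(1) iterate_measurable[of n]
  define h where "h w = g (fst w) * inner (\<phi> (snd w)) (x n (fst w) - z)" for w
  have "integrable P (\<lambda>\<omega>. g \<omega> * noise n \<omega>)"
    using measurable_history_P[OF g(1)] g(2) noise_sq_int
      by (intro integrable_product_of_square_integrable) auto
  then have "(\<integral>\<omega>. h (\<omega>, \<xi> (Suc n) \<omega>) \<partial>P) = (\<integral>\<omega>. (\<integral>s. h (\<omega>, s) \<partial>M) \<partial>P)"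
    by (intro integral_next) (auto simp: h_def noise_def)
  also have "\<dots> = 0" using phi_int phi_0 by (simp add: h_def)
  finally show ?thesis by (simp add: h_def noise_def)
qed

lemma noise_integrable: "integrable P (noise n)"
  using integrable_product_of_square_integrable[of "\<lambda>_. 1" P "noise n"] noise_sq_int by simp

lemma noise_integral: "(\<integral>\<omega>. noise n \<omega> \<partial>P) = 0"
  using noise_orth[of "\<lambda>_. 1" n] by simp

lemma expected_sq_dist_step: "(\<integral>\<omega>. sq_dist (Suc n) \<omega> \<partial>P) \<le> (\<integral>\<omega>. sq_dist n \<omega> \<partial>P) + (lam n)\<^sup>2 * sel_var"
proof -
  have "(\<integral>\<omega>. sq_dist (Suc n) \<omega> \<partial>P) \<le> (\<integral>\<omega>. sq_dist n \<omega> - 2 * lam n * noise n \<omega>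
    + (lam n)\<^sup>2 * sel_sq n \<omega> \<partial>P)"
    using sq_dist_int sel_sq_int noise_integrable sq_dist_step by (intro integral_mono_AE) auto
  also have "\<dots> = (\<integral>\<omega>. sq_dist n \<omega> \<partial>P) + (lam n)\<^sup>2 * sel_var"
    using sq_dist_int sel_sq_int noise_integrable by (simp add: noise_integral sel_sq_integral)
  finally show ?thesis .
qed

lemma expected_sq_dist_bounded: "(\<integral>\<omega>. sq_dist n \<omega> \<partial>P)
  \<le> (\<integral>\<omega>. sq_dist 0 \<omega> \<partial>P) + (\<Sum>n. (lam n)\<^sup>2) * sel_var"
proof -
  have "(\<integral>\<omega>. sq_dist n \<omega> \<partial>P) \<le> (\<integral>\<omega>. sq_dist 0 \<omega> \<partial>P) + (\<Sum>k<n. (lam k)\<^sup>2) * sel_var" for n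
  proof (induction n)
    case (Suc n) then show ?case using expected_sq_dist_step[of n] by (simp add: algebra_simps)
  qed simp
  moreover have "(\<Sum>k<n. (lam k)\<^sup>2) * sel_var \<le> (\<Sum>n. (lam n)\<^sup>2) * sel_var"
    using sel_var_nonneg lam_sq by (intro mult_right_mono sum_le_suminf) auto
  ultimately show ?thesis by (rule order_trans[OF _ add_left_mono])
qed

text \<open>
  By \<open>sq_dist_step\<close> the squared distance decreases up to a martingale increment and a summable term,
  and the second moments of the martingale increments are summable because the expected squared
  distances stay bounded.
\<close>

lemma distance_converges: "AE \<omega> in P. convergent (\<lambda>n. norm (x n \<omega> - z))"
proof -
  define B where "B = (\<integral>\<omega>. sq_dist 0 \<omega> \<partial>P) + (\<Sum>n. (lam n)\<^sup>2) * sel_var"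
  have "AE \<omega> in P. summable (\<lambda>n. lam n * noise n \<omega>)"
  proof (rule P.L2_martingale_converges[where G=history])
    show "(\<lambda>\<omega>. lam n * noise n \<omega>) \<in> borel_measurable (history (Suc n))" for n
    proof -
      note [measurable] = history(3)[of n] measurable_from_subalg[OF history(2)
        iterate_measurable[of n]]
      show ?thesis unfolding noise_def by measurable
    qed
    show "integrable P (\<lambda>\<omega>. (lam n * noise n \<omega>)\<^sup>2)" for n using noise_sq_int
      by (simp add: power_mult_distrib)
    show "(\<integral>\<omega>. g \<omega> * (lam n * noise n \<omega>) \<partial>P) = 0"
      if "g \<in> borel_measurable (history n)" "integrable P (\<lambda>\<omega>. (g \<omega>)\<^sup>2)" for n g
    proof -
      have "(\<integral>\<omega>. g \<omega> * (lam n * noise n \<omega>) \<partial>P) = (\<integral>\<omega>. lam n * (g \<omega> * noise n \<omega>) \<partial>P)"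
        by (simp add: mult_ac)
      then show ?thesis using noise_orth[OF that] by simp
    qed
    show "summable (\<lambda>n. \<integral>\<omega>. (lam n * noise n \<omega>)\<^sup>2 \<partial>P)"
    proof (rule summable_comparison_test')
      show "summable (\<lambda>n. (lam n)\<^sup>2 * (sel_var * B))" using lam_sq by (rule summable_mult2)
      fix n :: nat
      have "(\<integral>\<omega>. (noise n \<omega>)\<^sup>2 \<partial>P) \<le> sel_var * B"
        using noise_sq_integral[of n] mult_left_mono[OF expected_sq_dist_bounded[of n]
          sel_var_nonneg] by (simp add: B_def)
      then show "norm (\<integral>\<omega>. (lam n * noise n \<omega>)\<^sup>2 \<partial>P) \<le> (lam n)\<^sup>2 * (sel_var * B)"
        by (simp add: power_mult_distrib mult_left_mono)
    qed
  qed (rule history(1,2))+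
  moreover have "AE \<omega> in P. summable (\<lambda>n. (lam n)\<^sup>2 * sel_sq n \<omega>)"
  proof (rule AE_summable_of_summable_integrals)
    show "summable (\<lambda>n. \<integral>\<omega>. (lam n)\<^sup>2 * sel_sq n \<omega> \<partial>P)" using lam_sq
      by (simp add: sel_sq_integral summable_mult2)
  qed (use sel_sq_int in \<open>auto simp: sel_sq_nonneg\<close>)
  moreover have "AE \<omega> in P. \<forall>n. sq_dist (Suc n) \<omega>
    \<le> sq_dist n \<omega> - 2 * lam n * noise n \<omega> + (lam n)\<^sup>2 * sel_sq n \<omega>"
    unfolding AE_all_countable using sq_dist_step by blast
  ultimately show ?thesis
  proof eventually_elim
    case (elim \<omega>)
    have "convergent (\<lambda>n. sq_dist n \<omega>)"
    proof (rule almost_decreasing_convergent)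
      show "summable (\<lambda>n. (lam n)\<^sup>2 * sel_sq n \<omega> - 2 * (lam n * noise n \<omega>))"
        using elim by (intro summable_diff summable_mult)
      show "sq_dist (Suc n) \<omega> \<le> sq_dist n \<omega> + ((lam n)\<^sup>2 * sel_sq n \<omega> - 2 * (lam n * noise n \<omega>))" for n
        using elim(3) by (simp add: algebra_simps)
    qed (simp add: sq_dist_def)
    then obtain l where "(\<lambda>n. sq_dist n \<omega>) \<longlonglongrightarrow> l" unfolding convergent_def by blast
    from tendsto_real_sqrt[OF this] show ?case by (auto simp: sq_dist_def convergent_def)
  qed
qed

text \<open>
  The amount by which the envelope of \<open>f s\<close> at \<open>y\<close> exceeds the envelope of the affine minorant of
  \<open>f s\<close> at \<open>z\<close> given by \<open>\<phi> s\<close>. It is nonnegative, and its mean controls the optimality gap of \<open>y\<close>.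
\<close>

definition excess :: "nat \<Rightarrow> 'e \<Rightarrow> 'h \<Rightarrow> real" where
  "excess n s y = moreau_envelope (lam n) (f s) y - real_of_ereal (f s z) - inner (\<phi> s) (y - z)
    + lam n / 2 * (norm (\<phi> s))\<^sup>2"

definition mean_excess :: "nat \<Rightarrow> 'h \<Rightarrow> ennreal" where "mean_excess n y
  = (\<integral>\<^sup>+s. ennreal (excess n s y) \<partial>M)"

lemmas integrand_section_measurable[measurable] = section_measurable[OF f_normal]

lemma excess_measurable[measurable]: "(\<lambda>w. excess n (fst w) (snd w)) \<in> borel_measurable (M \<Otimes>\<^sub>M borel)"
proof -
  have [measurable]: "(\<lambda>w. moreau_envelope (lam n) (f (fst w)) (snd w))
    \<in> borel_measurable (M \<Otimes>\<^sub>M borel)"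
    using moreau_measurable[OF M.finite_measure_axioms M_complete f_normal lam_pos]
      by (simp add: case_prod_beta')
  show ?thesis unfolding excess_def by measurable
qed

lemma excess_nonneg: "AE s in M. \<forall>n y. 0 \<le> excess n s y"
  using phi_sub AE_space
proof eventually_elim
  case (elim s)
  show ?case
    using moreau_ge_affine[OF normal_convex_integrandD(2-4)[OF f_normal elim(2)] lam_pos elim(1)]
    by (auto simp: excess_def algebra_simps)
qed

lemma excess_step: "AE \<omega> in P. 2 * lam n * excess n (\<xi> (Suc n) \<omega>) (x n \<omega>) \<le>
    sq_dist n \<omega> - sq_dist (Suc n) \<omega> - 2 * lam n * noise n \<omega> + (lam n)\<^sup>2 * sel_sq n \<omega>"
  using AE_next[OF phi_sub, of n] AE_space
proof eventually_elim
  case (elim \<omega>)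
  note g = normal_convex_integrandD(2-4)[OF f_normal space_xi[OF elim(2), of n]]
  obtain r where r: "f (\<xi> (Suc n) \<omega>) z = ereal r" by (rule subdiff_finite[OF g(2) elim(1)])
  have "sq_dist (Suc n) \<omega> \<le> sq_dist n \<omega> - 2 * lam n * (moreau_envelope (lam n) (f (\<xi> (Suc n) \<omega>))
    (x n \<omega>) - r)"
    unfolding sq_dist_def x_Suc[OF elim(2)] by (rule prox_step_inequality[OF g lam_pos]) (simp add: r)
  then show ?case by (simp add: excess_def noise_def sel_sq_def r algebra_simps power2_eq_square)
qed

text \<open>
  Take expectations in \<open>excess_step\<close>: the noise vanishes and the squared distances telescope.
\<close>

lemma mean_excess_summable: "AE \<omega> in P. (\<Sum>n. ennreal (lam n) * mean_excess n (x n \<omega>)) \<noteq> \<infinity>"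
proof -
  define w where "w n = 1/2 * ((\<integral>\<omega>. sq_dist n \<omega> \<partial>P) - (\<integral>\<omega>. sq_dist (Suc n) \<omega> \<partial>P)
    + (lam n)\<^sup>2 * sel_var)" for n
  have w0: "0 \<le> w n" for n using expected_sq_dist_step[of n] by (simp add: w_def)
  have Qm[measurable]: "mean_excess n \<in> borel_measurable borel" for n
  proof -
    have "(\<lambda>p. ennreal (excess n (snd p) (fst p))) \<in> borel_measurable (borel \<Otimes>\<^sub>M M)"
      using measurable_compose[OF measurable_pair_swap' excess_measurable[of n]]
        by (simp add: case_prod_beta')
    from M.borel_measurable_nn_integral_fst[OF this] show ?thesis unfolding mean_excess_def by simp
  qed
  have le: "(\<integral>\<^sup>+\<omega>. ennreal (lam n) * mean_excess n (x n \<omega>) \<partial>P) \<le> ennreal (w n)" for n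
  proof -
    define u where "u = (\<lambda>\<omega>. 1/2 * (sq_dist n \<omega> - sq_dist (Suc n) \<omega> - 2 * lam n * noise n \<omega>
      + (lam n)\<^sup>2 * sel_sq n \<omega>))"
    have u_int: "integrable P u" unfolding u_def using sq_dist_int sel_sq_int noise_integrable by simp
    have u_eq: "(\<integral>\<omega>. u \<omega> \<partial>P) = w n"
      unfolding u_def w_def using sq_dist_int sel_sq_int noise_integrable
        by (simp add: noise_integral sel_sq_integral)
    have q_le: "AE \<omega> in P. 0 \<le> lam n * excess n (\<xi> (Suc n) \<omega>) (x n \<omega>)
      \<and> lam n * excess n (\<xi> (Suc n) \<omega>) (x n \<omega>) \<le> u \<omega>"
      using excess_step[of n] AE_next[OF excess_nonneg, of n]
      by eventually_elim (use lam_pos[of n] in \<open>auto simp: u_def less_imp_le\<close>)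
    define h where "h p = ennreal (lam n) * ennreal (excess n (snd p) (x n (fst p)))" for p
    have h: "h \<in> borel_measurable (history n \<Otimes>\<^sub>M M)"
    proof -
      note [measurable] = iterate_measurable[of n]
      have "(\<lambda>p. (snd p, x n (fst p))) \<in> measurable (history n \<Otimes>\<^sub>M M) (M \<Otimes>\<^sub>M borel)" by measurable
      from measurable_compose[OF this excess_measurable[of n]] show ?thesis unfolding h_def by simp
    qed
    have sec: "(\<lambda>s. ennreal (excess n s y)) \<in> borel_measurable M" for y
    proof -
      have "(\<lambda>s. (s, y)) \<in> measurable M (M \<Otimes>\<^sub>M borel)" by measurable
      from measurable_compose[OF this excess_measurable[of n]] show ?thesis by simp
    qed
    have "(\<integral>\<^sup>+\<omega>. ennreal (lam n) * mean_excess n (x n \<omega>) \<partial>P) = (\<integral>\<^sup>+\<omega>. (\<integral>\<^sup>+s. h (\<omega>, s) \<partial>M) \<partial>P)"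
      unfolding mean_excess_def h_def by (simp add: nn_integral_cmult sec)
    also have "\<dots> = (\<integral>\<^sup>+\<omega>. h (\<omega>, \<xi> (Suc n) \<omega>) \<partial>P)" by (rule nn_integral_next[OF h, symmetric])
    also have "\<dots> \<le> (\<integral>\<^sup>+\<omega>. ennreal (u \<omega>) \<partial>P)"
    proof (rule nn_integral_mono_AE, use q_le in eventually_elim)
      case (elim \<omega>)
      then show ?case using lam_pos[of n] by (simp add: h_def ennreal_leI flip: ennreal_mult')
    qed
    also have "\<dots> = ennreal (w n)"
      unfolding u_eq[symmetric] using q_le
        by (intro nn_integral_eq_integral u_int) (auto elim: eventually_mono)
    finally show ?thesis .
  qed
  have sum_w: "summable w"
  proof (rule summableI_nonneg_bounded[OF w0])
    fix n
    have "(\<Sum>k<n. w k) = 1/2 * ((\<integral>\<omega>. sq_dist 0 \<omega> \<partial>P) - (\<integral>\<omega>. sq_dist n \<omega> \<partial>P)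
      + (\<Sum>k<n. (lam k)\<^sup>2) * sel_var)"
      by (induction n) (simp_all add: w_def algebra_simps)
    also have "\<dots> \<le> 1/2 * ((\<integral>\<omega>. sq_dist 0 \<omega> \<partial>P) + (\<Sum>k. (lam k)\<^sup>2) * sel_var)"
    proof -
      have "(\<Sum>k<n. (lam k)\<^sup>2) * sel_var \<le> (\<Sum>n. (lam n)\<^sup>2) * sel_var"
        using sel_var_nonneg lam_sq by (intro mult_right_mono sum_le_suminf) auto
      moreover have "0 \<le> (\<integral>\<omega>. sq_dist n \<omega> \<partial>P)" by (simp add: sq_dist_def)
      ultimately show ?thesis by simp
    qed
    finally show "(\<Sum>k<n. w k) \<le> 1/2 * ((\<integral>\<omega>. sq_dist 0 \<omega> \<partial>P) + (\<Sum>k. (lam k)\<^sup>2) * sel_var)" .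
  qed
  have "(\<integral>\<^sup>+\<omega>. (\<Sum>n. ennreal (lam n) * mean_excess n (x n \<omega>)) \<partial>P)
    = (\<Sum>n. \<integral>\<^sup>+\<omega>. ennreal (lam n) * mean_excess n (x n \<omega>) \<partial>P)"
    by (rule nn_integral_suminf) measurable
  also have "\<dots> \<le> (\<Sum>n. ennreal (w n))" by (intro suminf_le le) auto
  also have "\<dots> < \<infinity>" using suminf_ennreal2[OF w0 sum_w] by simp
  finally have fin: "(\<integral>\<^sup>+\<omega>. (\<Sum>n. ennreal (lam n) * mean_excess n (x n \<omega>)) \<partial>P) \<noteq> \<infinity>" by simp
  show ?thesis by (rule nn_integral_PInf_AE[OF _ fin]) measurable
qed

end

section \<open>From the mean excess to the values of the mean function\<close>

lemma selections_2D:
  assumes "\<phi> \<in> selections M f 2 z"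
  shows "\<phi> \<in> borel_measurable M" "AE s in M. \<phi> s \<in> subdiff (f s) z" "integrable M (\<lambda>s. (norm (\<phi> s))\<^sup>2)"
proof -
  show meas[measurable]: "\<phi> \<in> borel_measurable M" and "AE s in M. \<phi> s \<in> subdiff (f s) z"
    using assms by (auto simp: selections_def)
  have "(\<integral>\<^sup>+ s. ennreal (norm (\<phi> s) powr 2) \<partial>M) < \<infinity>" using assms by (simp add: selections_def)
  also have "(\<integral>\<^sup>+ s. ennreal (norm (\<phi> s) powr 2) \<partial>M) = (\<integral>\<^sup>+ s. ennreal (norm ((norm (\<phi> s))\<^sup>2)) \<partial>M)"
    by (intro nn_integral_cong) (simp add: powr_numeral)
  finally show "integrable M (\<lambda>s. (norm (\<phi> s))\<^sup>2)" by (intro integrableI_bounded) auto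
qed

lemma integrable_tail:
  fixes \<psi> :: "'a \<Rightarrow> real"
  assumes \<psi>: "integrable M \<psi>" "\<And>s. 0 \<le> \<psi> s" and e: "\<epsilon> > 0"
  obtains b where "b \<ge> 0" "(\<integral>s. \<psi> s * indicator {s. b < \<psi> s} s \<partial>M) \<le> \<epsilon>"
    "integrable M (\<lambda>s. \<psi> s * indicator {s. b < \<psi> s} s)"
proof -
  have [measurable]: "\<psi> \<in> borel_measurable M" using \<psi> by auto
  have int: "integrable M (\<lambda>s. \<psi> s * indicator {s. b < \<psi> s} s)" for b :: real
  proof (rule Bochner_Integration.integrable_bound[OF \<psi>(1)])
    have "(\<lambda>s. if b < \<psi> s then \<psi> s else 0) \<in> borel_measurable M" by measurable
    then show "(\<lambda>s. \<psi> s * indicator {s. b < \<psi> s} s) \<in> borel_measurable M"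
      by (rule measurable_cong[THEN iffD1, rotated]) (simp add: indicator_def)
  qed (auto simp: indicator_def)
  have "(\<lambda>n. \<integral>s. \<psi> s * indicator {s. real n < \<psi> s} s \<partial>M) \<longlonglongrightarrow> (\<integral>s. 0 \<partial>M)"
  proof (rule integral_dominated_convergence[where w="\<lambda>s. \<psi> s"])
    show "AE s in M. (\<lambda>n. \<psi> s * indicator {s. real n < \<psi> s} s) \<longlonglongrightarrow> 0"
    proof (rule AE_I2)
      fix s
      obtain n0 where "\<psi> s \<le> real n0" using real_arch_simple by blast
      then have "\<forall>n\<ge>n0. \<psi> s * indicator {s. real n < \<psi> s} s = 0" by (auto simp: indicator_def)
      then show "(\<lambda>n. \<psi> s * indicator {s. real n < \<psi> s} s) \<longlonglongrightarrow> 0"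
        by (intro tendsto_eventually) (auto simp: eventually_sequentially)
    qed
  qed (use \<psi> int in \<open>auto simp: indicator_def\<close>)
  then have "\<forall>\<^sub>F n in sequentially. (\<integral>s. \<psi> s * indicator {s. real n < \<psi> s} s \<partial>M) < \<epsilon>"
    using e by (intro order_tendstoD) auto
  then obtain n :: nat where "(\<integral>s. \<psi> s * indicator {s. real n < \<psi> s} s \<partial>M) < \<epsilon>"
    unfolding eventually_sequentially by blast
  then show ?thesis using that[of "real n"] int by simp
qed

text \<open>
  Two bounds for the loss in passing from \<open>g\<close> to its envelope, in terms of the smallest subgradient at
  \<open>y\<close>. The first is small for small \<open>c\<close> but quadratic in \<open>u\<close>; the second does not become small but is
  only linear in \<open>u\<close>, as suits integrands that are merely uniformly integrable.
\<close>

lemma moreau_gap_pointwise: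
  fixes g :: "'h::{real_inner, banach} \<Rightarrow> ereal"
  assumes g: "lsc g" "proper g" "convex_fun g" and c: "c > 0"
    and v: "v \<in> subdiff g z" and y: "y \<in> dom_subdiff g" and R: "norm (y - z) \<le> R"
  defines "u \<equiv> norm (subdiff_min g y)"
  shows "g y = ereal (real_of_ereal (g y))"
    and "real_of_ereal (g y) - moreau_envelope c g y \<le> c / 2 * u\<^sup>2"
    and "real_of_ereal (g y) - moreau_envelope c g y \<le> R * u + R * norm v + c / 2 * (norm v)\<^sup>2"
proof -
  have sub: "subdiff_min g y \<in> subdiff g y" by (rule subdiff_min_in[OF g(2) y])
  obtain r where r: "g y = ereal r" by (rule subdiff_finite[OF g(2) sub])
  obtain r' where r': "g z = ereal r'" by (rule subdiff_finite[OF g(2) v])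
  show "g y = ereal (real_of_ereal (g y))" by (simp add: r)
  show "real_of_ereal (g y) - moreau_envelope c g y \<le> c / 2 * u\<^sup>2"
    using moreau_ge_affine[OF g c sub, of y] by (simp add: u_def)
  have "r + inner (subdiff_min g y) (z - y) \<le> r'" using subdiffD[OF g(2) sub, of z r'] r r' by simp
  moreover have "- inner (subdiff_min g y) (z - y) \<le> R * u"
  proof -
    have "- inner (subdiff_min g y) (z - y) \<le> u * norm (z - y)"
      unfolding u_def using norm_cauchy_schwarz[of "- subdiff_min g y" "z - y"] by simp
    also have "\<dots> \<le> u * R" using R by (intro mult_left_mono) (auto simp: u_def norm_minus_commute)
    finally show ?thesis by (simp add: mult.commute)
  qed
  moreover have "r' + inner v (y - z) - c / 2 * (norm v)\<^sup>2 \<le> moreau_envelope c g y"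
    using moreau_ge_affine[OF g c v, of y] r' by simp
  moreover have "- inner v (y - z) \<le> R * norm v"
  proof -
    have "- inner v (y - z) \<le> norm v * norm (y - z)" using norm_cauchy_schwarz[of "- v" "y - z"] by simp
    also have "\<dots> \<le> norm v * R" using R by (intro mult_left_mono) auto
    finally show ?thesis by (simp add: mult.commute)
  qed
  ultimately show "real_of_ereal (g y) - moreau_envelope c g y
    \<le> R * u + R * norm v + c / 2 * (norm v)\<^sup>2"
    using r by simp
qed

context stochastic_proximal_point_zero
begin

text \<open>
  The loss in passing to the envelope is, uniformly on bounded parts of the domain, at most
  \<open>lam n * A + \<epsilon>\<close> on average. Where the smallest subgradient has norm at most \<open>a\<close>, the quadratic bound of
  \<open>moreau_gap_pointwise\<close> gives \<open>lam n * a\<^sup>2 / 2\<close>; elsewhere the linear bound is used, whose integral is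
  small by uniform integrability once \<open>a\<close> is large.
\<close>

lemma expected_gap:
  assumes unif: "\<And>K. bounded K \<Longrightarrow> uniformly_integrable_family M (K \<inter> ess_dom M f) (\<lambda>y s. norm
    (subdiff_min (f s) y))"
    and Fz: "ext_integral M (\<lambda>s. f s z) = ereal m"
    and e: "\<epsilon> > 0" and R: "R \<ge> 0" and \<Lambda>: "\<And>n. lam n \<le> \<Lambda>"
  shows "\<exists>A. \<forall>n. \<forall>y\<in>ess_dom M f. norm (y - z) \<le> R \<longrightarrow> mean_excess n y \<noteq> \<infinity> \<longrightarrow>
           ext_integral M (\<lambda>s. f s y) \<le> ereal (m + enn2real (mean_excess n y) + lam n * A + \<epsilon>)"
proof -
  note fz = ext_integral_finite[OF section_measurable[OF f_normal] Fz]
  have "\<Lambda> > 0" using \<Lambda>[of 0] lam_pos[of 0] by simp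
  \<comment> \<open>The part of the linear bound that does not depend on the point.\<close>
  define \<psi> where "\<psi> s = R * norm (\<phi> s) + \<Lambda> / 2 * (norm (\<phi> s))\<^sup>2" for s
  have \<psi>0: "0 \<le> \<psi> s" for s using R \<open>\<Lambda> > 0\<close> by (simp add: \<psi>_def)
  have "integrable M \<psi>" unfolding \<psi>_def using phi_int phi_sq by simp
  have "\<epsilon> / 2 > 0" using e by simp
  obtain b where b: "b \<ge> 0" "(\<integral>s. \<psi> s * indicator {s. b < \<psi> s} s \<partial>M) \<le> \<epsilon> / 2"
    "integrable M (\<lambda>s. \<psi> s * indicator {s. b < \<psi> s} s)"
    by (rule integrable_tail[OF \<open>integrable M \<psi>\<close> \<psi>0 \<open>\<epsilon> / 2 > 0\<close>]) (rule that; assumption)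
  define d where "d = R + b + 1"
  define \<eta> where "\<eta> = \<epsilon> / (2 * d)"
  have Rb: "d > 0" using R b by (simp add: d_def)
  have \<eta>: "\<eta> > 0" using Rb e by (simp add: \<eta>_def)
  let ?K = "cball z R \<inter> ess_dom M f"
  let ?u = "\<lambda>y s. norm (subdiff_min (f s) y)"
  have "uniformly_integrable_family M ?K ?u" by (rule unif) simp
  then have u_meas: "\<And>y. y \<in> ?K \<Longrightarrow> ?u y \<in> borel_measurable M" and
    "((\<lambda>a::real. SUP y\<in>?K. \<integral>\<^sup>+ s\<in>{s \<in> space M. ?u y s > a}. ennreal (?u y s) \<partial>M) \<longlongrightarrow> 0) at_top"
    unfolding uniformly_integrable_family_def by blast+
  then have "\<forall>\<^sub>F a in at_top. (SUP y\<in>?K. \<integral>\<^sup>+ s\<in>{s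
    \<in> space M. ?u y s > a}. ennreal (?u y s) \<partial>M) < ennreal \<eta>"
    using \<eta> by (intro order_tendstoD) auto
  then obtain a0 where a0: "\<And>a. a \<ge> a0 \<Longrightarrow>
    (SUP y\<in>?K. \<integral>\<^sup>+ s\<in>{s \<in> space M. ?u y s > a}. ennreal (?u y s) \<partial>M) < ennreal \<eta>"
    unfolding eventually_at_top_linorder by blast
  define a where "a = max a0 1"
  have "ext_integral M (\<lambda>s. f s y) \<le> ereal (m + enn2real (mean_excess n y) + lam n * (a\<^sup>2 / 2) + \<epsilon>)"
    if y: "y \<in> ess_dom M f" "norm (y - z) \<le> R" and mean_excess: "mean_excess n y \<noteq> \<infinity>" for n y
  proof -
    have yK: "y \<in> ?K" using y by (simp add: dist_norm norm_minus_commute)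
    note [measurable] = u_meas[OF yK]
    \<comment> \<open>The part of the smallest subgradients that uniform integrability makes negligible.\<close>
    define t where "t s = ?u y s * indicator {s. a < ?u y s} s" for s
    have t_meas: "t \<in> borel_measurable M"
    proof -
      have "(\<lambda>s. if a < ?u y s then ?u y s else 0) \<in> borel_measurable M" by measurable
      then show ?thesis unfolding t_def
        by (rule measurable_cong[THEN iffD1, rotated]) (simp add: indicator_def)
    qed
    have t0: "0 \<le> t s" for s by (simp add: t_def)
    have "(\<integral>\<^sup>+s. ennreal (t s) \<partial>M) = (\<integral>\<^sup>+ s\<in>{s \<in> space M. ?u y s > a}. ennreal (?u y s) \<partial>M)"
      by (intro nn_integral_cong) (auto simp: t_def indicator_def)
    also have "\<dots> \<le> (SUP y\<in>?K. \<integral>\<^sup>+ s\<in>{s \<in> space M. ?u y s > a}. ennreal (?u y s) \<partial>M)"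
      by (rule SUP_upper[OF yK])
    also have "\<dots> \<le> ennreal \<eta>" using a0[of a] by (simp add: a_def less_imp_le)
    finally have t_le: "(\<integral>\<^sup>+s. ennreal (t s) \<partial>M) \<le> ennreal \<eta>" .
    have t_int: "integrable M t"
      using t_meas t_le t0 by (intro integrableI_nonneg) (auto intro: order_le_less_trans)
    have t_integral: "(\<integral>s. t s \<partial>M) \<le> \<eta>"
      using t_le t_int t0 \<eta> by (simp add: nn_integral_eq_integral ennreal_le_iff)
    have q_sec: "(\<lambda>s. excess n s y) \<in> borel_measurable M"
    proof -
      have "(\<lambda>s. (s, y)) \<in> measurable M (M \<Otimes>\<^sub>M borel)" by measurable
      from measurable_compose[OF this excess_measurable[of n]] show ?thesis by simp
    qed
    have q0: "AE s in M. 0 \<le> excess n s y" using excess_nonneg by eventually_elim blast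
    have q_int: "integrable M (\<lambda>s. excess n s y)"
      using q_sec q0 mean_excess by (intro integrableI_nonneg) (auto simp: mean_excess_def less_top)
    have q_integral: "(\<integral>s. excess n s y \<partial>M) = enn2real (mean_excess n y)"
      unfolding mean_excess_def by (rule integral_eq_nn_integral[OF q_sec q0])
    define h where "h s = real_of_ereal (f s z) + inner (\<phi> s) (y - z) + excess n s y
      + (lam n * (a\<^sup>2 / 2) + (R + b) * t s + \<psi> s * indicator {s. b < \<psi> s} s)" for s
    have h_int: "integrable M h" unfolding h_def using fz(2) phi_int q_int t_int b(3) by simp
    have "AE s in M. y \<in> dom_subdiff (f s)" using y(1) by (simp add: ess_dom_def)
    then have "AE s in M. f s y \<le> ereal (h s)"
      using phi_sub AE_space
    proof eventually_elim
      case (elim s)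
      note gap = moreau_gap_pointwise[OF normal_convex_integrandD(2-4)[OF f_normal elim(3)]
        lam_pos[of n] elim(2,1) y(2)]
      have "real_of_ereal (f s y) - moreau_envelope (lam n) (f s) y
        \<le> lam n * (a\<^sup>2 / 2) + (R + b) * t s + \<psi> s * indicator {s. b < \<psi> s} s"
      proof (cases "?u y s \<le> a")
        case True
        have "lam n / 2 * (?u y s)\<^sup>2 \<le> lam n / 2 * a\<^sup>2"
          using True lam_pos[of n] by (intro mult_left_mono power_mono) auto
        moreover have "0 \<le> (R + b) * t s + \<psi> s * indicator {s. b < \<psi> s} s"
          using t0[of s] \<psi>0[of s] R b(1) by simp
        ultimately show ?thesis using gap(2) by simp
      next
        case False
        then have "t s = ?u y s" by (simp add: t_def indicator_def)
        moreover have "1 \<le> a" by (simp add: a_def)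
        ultimately have ts: "t s = ?u y s" "1 \<le> t s" using False by linarith+
        have "lam n / 2 * (norm (\<phi> s))\<^sup>2 \<le> \<Lambda> / 2 * (norm (\<phi> s))\<^sup>2"
          using \<Lambda>[of n] by (intro mult_right_mono) auto
        then have "real_of_ereal (f s y) - moreau_envelope (lam n) (f s) y \<le> R * t s + \<psi> s"
          using gap(3) by (simp add: ts \<psi>_def)
        \<comment> \<open>Here \<open>t s \<ge> 1\<close>, so that \<open>b\<close> is absorbed into \<open>b * t s\<close>.\<close>
        moreover have "\<psi> s \<le> b * t s + \<psi> s * indicator {s. b < \<psi> s} s"
        proof (cases "b < \<psi> s")
          case True then show ?thesis using b(1) ts by simp
        next
          case False
          then have "\<psi> s \<le> b * 1" by simp
          also have "\<dots> \<le> b * t s" using b(1) ts(2) by (rule mult_left_mono[rotated])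
          finally show ?thesis using False by (simp add: indicator_def)
        qed
        moreover have "0 \<le> lam n * (a\<^sup>2 / 2)" using lam_pos[of n] by simp
        ultimately show ?thesis by (simp add: distrib_right)
      qed
      moreover have "moreau_envelope (lam n) (f s) y
        \<le> real_of_ereal (f s z) + inner (\<phi> s) (y - z) + excess n s y"
        using lam_pos[of n] by (simp add: excess_def)
      ultimately have "real_of_ereal (f s y) \<le> h s" by (simp add: h_def)
      then show ?case by (subst gap(1)) simp
    qed
    then have "ext_integral M (\<lambda>s. f s y) \<le> ereal (\<integral>s. h s \<partial>M)"
      by (rule ext_integral_le_integral[OF h_int])
    also have "(\<integral>s. h s \<partial>M) = m + enn2real (mean_excess n y) + (lam n * (a\<^sup>2 / 2) + (R
      + b) * (\<integral>s. t s \<partial>M) + (\<integral>s. \<psi> s * indicator {s. b < \<psi> s} s \<partial>M))"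
      unfolding h_def using fz(2,3) phi_int q_int t_int b(3) phi_0
        by (simp add: q_integral M.prob_space)
    also have "\<dots> \<le> m + enn2real (mean_excess n y) + lam n * (a\<^sup>2 / 2) + \<epsilon>"
    proof -
      have "(R + b) * (\<integral>s. t s \<partial>M) \<le> d * \<eta>"
        using t_integral R b(1) \<eta> t0 unfolding d_def by (intro mult_mono) auto
      also have "\<dots> = \<epsilon> / 2" using Rb by (simp add: \<eta>_def)
      finally show ?thesis using b(2) by simp
    qed
    finally show ?thesis by simp
  qed
  then show ?thesis by blast
qed

end

lemma convex_fun_ext_integral:
  assumes f: "normal_convex_integrand M f" and F: "\<And>y. F y
    = ext_integral M (\<lambda>s. f s y)" and proper: "proper F"
  shows "convex_fun F"
  unfolding convex_fun_def
proof (rule convexI)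
  fix p1 p2 and u v :: real
  assume "p1 \<in> {(x, r). F x \<le> ereal r}" "p2 \<in> {(x, r). F x \<le> ereal r}" and uv: "0 \<le> u" "0
    \<le> v" "u + v = 1"
  then obtain y1 r1 y2 r2 where p: "p1 = (y1, r1)" "p2 = (y2, r2)"
    and le: "F y1 \<le> ereal r1" "F y2 \<le> ereal r2" by blast
  note meas = section_measurable[OF f]
  obtain t1 where t1: "F y1 = ereal t1" using le(1) proper_not_MInf[OF proper, of y1]
    by (cases "F y1") auto
  obtain t2 where t2: "F y2 = ereal t2" using le(2) proper_not_MInf[OF proper, of y2]
    by (cases "F y2") auto
  note f1 = ext_integral_finite[OF meas, of y1 t1] and f2 = ext_integral_finite[OF meas, of y2 t2]
  have i1: "ext_integral M (\<lambda>s. f s y1) = ereal t1" and i2: "ext_integral M (\<lambda>s. f s y2) = ereal t2"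
    using t1 t2 F by auto
  let ?h = "\<lambda>s. u * real_of_ereal (f s y1) + v * real_of_ereal (f s y2)"
  have "AE s in M. f s (u *\<^sub>R y1 + v *\<^sub>R y2) \<le> ereal (?h s)"
    using f1(1)[OF i1] f2(1)[OF i2] AE_space
  proof eventually_elim
    case (elim s)
    have "f s ((1 - v) *\<^sub>R y1 + v *\<^sub>R y2)
      \<le> ereal ((1 - v) * real_of_ereal (f s y1) + v * real_of_ereal (f s y2))"
      using elim uv by (intro convex_funD normal_convex_integrandD[OF f]) auto
    moreover have "1 - v = u" using uv by simp
    ultimately show ?case by simp
  qed
  then have "F (u *\<^sub>R y1 + v *\<^sub>R y2) \<le> ereal (\<integral>s. ?h s \<partial>M)"
    unfolding F using f1(2)[OF i1] f2(2)[OF i2] by (intro ext_integral_le_integral) auto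
  also have "(\<integral>s. ?h s \<partial>M) = u * t1 + v * t2"
    using f1(2,3)[OF i1] f2(2,3)[OF i2] by simp
  also have "ereal (u * t1 + v * t2) \<le> ereal (u * r1 + v * r2)"
    using le t1 t2 uv by (auto intro!: add_mono mult_left_mono)
  finally show "u *\<^sub>R p1 + v *\<^sub>R p2 \<in> {(x, r). F x \<le> ereal r}" by (simp add: p)
qed

text \<open>
  Jensen's inequality, read off from the epigraph.
\<close>

lemma convex_fun_weighted_mean:
  assumes F: "convex_fun F" and lam: "\<And>k. k \<in> S \<Longrightarrow> lam k > 0" and S: "finite S" "S \<noteq> {}"
    and le: "\<And>k. k \<in> S \<Longrightarrow> F (y k) \<le> ereal (r k)"
  shows "F ((\<Sum>k\<in>S. lam k *\<^sub>R y k) /\<^sub>R (\<Sum>k\<in>S. lam k)) \<le> ereal ((\<Sum>k\<in>S. lam k * r k) / (\<Sum>k\<in>S. lam k))"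
proof -
  define T where "T = (\<Sum>k\<in>S. lam k)"
  have T: "T > 0" unfolding T_def using S lam by (intro sum_pos) auto
  have "(\<Sum>k\<in>S. (lam k / T) *\<^sub>R (y k, r k)) \<in> {(x, r). F x \<le> ereal r}"
  proof (rule convex_sum[OF S(1)])
    show "convex {(x, r :: real). F x \<le> ereal r}" using F by (simp add: convex_fun_def)
    show "(\<Sum>k\<in>S. lam k / T) = 1" using T by (simp add: sum_divide_distrib[symmetric] T_def)
  qed (use lam T le in \<open>auto intro: less_imp_le\<close>)
  then have "F (fst (\<Sum>k\<in>S. (lam k / T) *\<^sub>R (y k, r k)))
    \<le> ereal (snd (\<Sum>k\<in>S. (lam k / T) *\<^sub>R (y k, r k)))"
    by (simp add: case_prod_beta)
  moreover have "fst (\<Sum>k\<in>S. (lam k / T) *\<^sub>R (y k, r k)) = (\<Sum>k\<in>S. lam k *\<^sub>R y k) /\<^sub>R T"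
    by (simp add: fst_sum scaleR_sum_right divide_inverse mult.commute)
  moreover have "snd (\<Sum>k\<in>S. (lam k / T) *\<^sub>R (y k, r k)) = (\<Sum>k\<in>S. lam k * r k) / T"
    by (simp add: snd_sum sum_divide_distrib)
  ultimately show ?thesis by (simp add: T_def)
qed

section \<open>Ergodic convergence\<close>

lemma weighted_mean_of_summable:
  fixes lam a :: "nat \<Rightarrow> real"
  assumes sum: "summable (\<lambda>k. lam k * a k)" and S: "filterlim (\<lambda>n. \<Sum>k=1..n. lam k) at_top sequentially"
  shows "(\<lambda>n. (\<Sum>k=1..n. lam k * a k) / (\<Sum>k=1..n. lam k)) \<longlonglongrightarrow> 0"
proof (rule real_tendsto_divide_at_top[OF _ S])
  have "(\<lambda>n. (\<Sum>k<Suc n. lam k * a k) - lam 0 * a 0) \<longlonglongrightarrow> (\<Sum>k. lam k * a k) - lam 0 * a 0"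
    using LIMSEQ_Suc[OF summable_LIMSEQ[OF sum]] by (intro tendsto_diff tendsto_const)
  moreover have "(\<Sum>k<Suc n. lam k * a k) - lam 0 * a 0 = (\<Sum>k=1..n. lam k * a k)" for n
    by (induction n) simp_all
  ultimately show "(\<lambda>n. \<Sum>k=1..n. lam k * a k) \<longlonglongrightarrow> (\<Sum>k. lam k * a k) - lam 0 * a 0" by simp
qed

theorem theorem5:
  fixes M :: "'e measure"
    and P :: "'w measure"
    and \<xi> :: "nat \<Rightarrow> 'w \<Rightarrow> 'e"
    and f :: "'e \<Rightarrow> 'h::{real_inner, banach, second_countable_topology} \<Rightarrow> ereal"
    and F :: "'h \<Rightarrow> ereal"
    and lam :: "nat \<Rightarrow> real"
    and x0 :: 'h
    and x xbar :: "nat \<Rightarrow> 'w \<Rightarrow> 'h"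
  assumes "prob_space M" and "complete_measure M" and "prob_space P"
    and lam_pos: "\<And>n. lam n > 0"
    and lam_sum: "filterlim (\<lambda>n. \<Sum>k<n. lam k) at_top sequentially"
    and lam_sq_sum: "summable (\<lambda>n. (lam n)\<^sup>2)"
    and xi_rv: "\<And>n. n \<ge> 1 \<Longrightarrow> \<xi> n \<in> measurable P M"
    and xi_indep: "prob_space.indep_vars P (\<lambda>_. M) \<xi> {1..}"
    and xi_distr: "\<And>n. n \<ge> 1 \<Longrightarrow> distr P M (\<xi> n) = M"
    and f_normal: "normal_convex_integrand M f"
    and F_def: "\<And>y. F y = ext_integral M (\<lambda>s. f s y)"
    and F_proper: "proper F" and F_lsc: "lsc F"
    and F_subdiff: "\<And>y. subdiff F y = aumann_integral M f y"
    and F_min: "minimizers F \<noteq> {}" and F_min_zero: "minimizers F \<subseteq> zero_set M f 2"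
    and dom_const: "\<exists>N\<in>null_sets M. \<forall>s\<in>space M - N. \<forall>t\<in>space M - N.
                      dom_subdiff (f s) = dom_subdiff (f t)"
    and unif_int: "\<And>K. bounded K \<Longrightarrow>
                     uniformly_integrable_family M (K \<inter> ess_dom M f) (\<lambda>y s. norm (subdiff_min (f s) y))"
    and x_0: "\<And>\<omega>. \<omega> \<in> space P \<Longrightarrow> x 0 \<omega> = x0"
    and x_Suc: "\<And>n \<omega>. \<omega> \<in> space P \<Longrightarrow> x (n + 1) \<omega> = prox (lam n) (f (\<xi> (n + 1) \<omega>)) (x n \<omega>)"
    and xbar_def: "\<And>n \<omega>. \<omega> \<in> space P \<Longrightarrow>
                     xbar n \<omega> = (\<Sum>k=1..n. lam k *\<^sub>R x k \<omega>) /\<^sub>R (\<Sum>k=1..n. lam k)"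
  shows "AE \<omega> in P. \<exists>y\<in>minimizers F. weakly_converges (\<lambda>n. xbar n \<omega>) y"
proof -
  interpret spp: stochastic_proximal_point M P \<xi> f lam x0 x
    by (intro stochastic_proximal_point.intro stochastic_proximal_point_axioms.intro assms)
       (use assms in auto)
  let ?Z = "minimizers F"
  have zero: "\<exists>\<phi>. stochastic_proximal_point_zero M P \<xi> f lam x0 x z \<phi>" if z: "z \<in> ?Z" for z
  proof -
    obtain \<phi> where \<phi>: "\<phi> \<in> selections M f 2 z" "(\<integral>s. \<phi> s \<partial>M) = 0"
      using z F_min_zero by (auto simp: zero_set_def)
    have "stochastic_proximal_point_zero M P \<xi> f lam x0 x z \<phi>"
      by unfold_locales (rule selections_2D[OF \<phi>(1)] \<phi>(2))+
    then show ?thesis by (intro exI[of _ \<phi>])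
  qed
  have S: "filterlim (\<lambda>n. \<Sum>k=1..n. lam k) at_top sequentially"
  proof -
    have "filterlim (\<lambda>n. - lam 0 + (\<Sum>k<Suc n. lam k)) at_top sequentially"
      by (rule filterlim_tendsto_add_at_top[OF tendsto_const])
        (rule filterlim_compose[OF lam_sum filterlim_Suc])
    moreover have "- lam 0 + (\<Sum>k<Suc n. lam k) = (\<Sum>k=1..n. lam k)" for n
      by (induction n) auto
    ultimately show ?thesis by simp
  qed
  obtain z where z: "z \<in> ?Z" using F_min by blast
  then obtain m where m: "F z = ereal m"
  proof -
    obtain y where "F y \<noteq> \<infinity>" using F_proper by (auto simp: proper_def)
    moreover have "F z \<le> F y" using z by (simp add: minimizers_def is_arg_min_linorder)
    ultimately show ?thesis using that proper_not_MInf[OF F_proper, of z] by (cases "F z") auto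
  qed
  have m_le: "ereal m \<le> F y" for y
    using z m by (simp add: minimizers_def is_arg_min_linorder)
  have Z_iff: "y \<in> ?Z" if "F y \<le> ereal m" for y
    using that m_le order_trans by (auto simp: minimizers_def is_arg_min_linorder)
  have F_convex: "convex_fun F" by (rule convex_fun_ext_integral[OF f_normal F_def F_proper])
  obtain \<phi> where "stochastic_proximal_point_zero M P \<xi> f lam x0 x z \<phi>" using zero[OF z] by blast
  then interpret sppz: stochastic_proximal_point_zero M P \<xi> f lam x0 x z \<phi> .
  have lam0: "lam \<longlonglongrightarrow> 0"
  proof -
    have "(\<lambda>n. sqrt ((lam n)\<^sup>2)) \<longlonglongrightarrow> sqrt 0"
      by (intro tendsto_real_sqrt summable_LIMSEQ_zero lam_sq_sum)
    then show ?thesis using lam_pos by (simp add: less_imp_le)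
  qed
  then obtain \<Lambda> where \<Lambda>: "\<And>n. lam n \<le> \<Lambda>"
    using Bseq_def convergent_imp_Bseq[OF convergentI[OF lam0]] by (metis abs_le_D1 real_norm_def)
  \<comment> \<open>Convergence of the distances holds almost surely
    for each minimizer separately; a countable dense set of minimizers yields one exceptional set.\<close>
  obtain Zc where Zc: "countable Zc" "Zc \<subseteq> ?Z" "?Z \<subseteq> closure Zc" using separable by blast
  have "AE \<omega> in P. \<forall>z\<in>Zc. convergent (\<lambda>n. norm (x n \<omega> - z))"
  proof (intro AE_ball_countable[THEN iffD2] Zc ballI)
    fix y assume "y \<in> Zc"
    then obtain \<phi>' where "stochastic_proximal_point_zero M P \<xi> f lam x0 x y \<phi>'" using zero Zc by blast
    then show "AE \<omega> in P. convergent (\<lambda>n. norm (x n \<omega> - y))"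
      by (rule stochastic_proximal_point_zero.distance_converges)
  qed
  moreover have "AE \<omega> in P. \<forall>n. x (Suc n) \<omega> \<in> ess_dom M f"
    unfolding AE_all_countable
  proof
    fix n
    obtain N where N: "N \<in> null_sets M" "\<And>s t. s \<in> space M - N \<Longrightarrow> t \<in> space M - N \<Longrightarrow>
      dom_subdiff (f s) = dom_subdiff (f t)"
      using dom_const by blast
    have N_AE: "AE s in M. s \<notin> N" using N(1) by (rule AE_not_in)
    show "AE \<omega> in P. x (Suc n) \<omega> \<in> ess_dom M f"
      using spp.AE_next[OF N_AE, of n] AE_space
    proof eventually_elim
      case (elim \<omega>)
      have s: "\<xi> (Suc n) \<omega> \<in> space M" by (rule spp.space_xi[OF elim(2)])
      \<comment> \<open>A proximal point lies in the domain of the sampled subdifferential, which is the common one.\<close>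
      have dom: "x (Suc n) \<omega> \<in> dom_subdiff (f (\<xi> (Suc n) \<omega>))"
        unfolding spp.x_Suc[OF elim(2)] dom_subdiff_def
        using prox_subgradient[OF normal_convex_integrandD(2-4)[OF f_normal s] lam_pos[of n]] by blast
      have "AE t in M. x (Suc n) \<omega> \<in> dom_subdiff (f t)"
        using N_AE AE_space[of M] by eventually_elim (use N(2) s elim(1) dom in blast)
      then show ?case by (simp add: ess_dom_def)
    qed
  qed
  ultimately show ?thesis
    using sppz.mean_excess_summable AE_space
  proof eventually_elim
    case (elim \<omega>)
    define X where "X n = x n \<omega>" for n
    have X_dom: "X n \<in> ess_dom M f" if "n \<ge> 1" for n
      using elim(2) that unfolding X_def by (metis Suc_le_D One_nat_def)
    have conv: "convergent (\<lambda>n. norm (X n - y))" if y: "y \<in> ?Z" for y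
    proof (rule Cauchy_convergent, rule metric_CauchyI)
      fix e :: real assume "e > 0"
      obtain y' where y': "y' \<in> Zc" "dist y' y < e / 3"
        using y Zc(3) closure_approachable[of y Zc] \<open>e > 0\<close>
          by (meson divide_pos_pos subsetD zero_less_numeral)
      have "convergent (\<lambda>n. norm (X n - y'))" using elim(1) y'(1) by (simp add: X_def)
      then obtain N where N: "\<And>i j. i \<ge> N \<Longrightarrow> j \<ge> N \<Longrightarrow> dist (norm (X i - y')) (norm (X j - y')) < e / 3"
        using metric_CauchyD[OF convergent_Cauchy, of _ "e / 3"] \<open>e > 0\<close>
          by (metis divide_pos_pos zero_less_numeral)
      have near: "\<bar>norm (X i - y) - norm (X i - y')\<bar> < e / 3" for i
        using norm_triangle_ineq3[of "X i - y" "X i - y'"] y'(2) by (simp add: dist_norm)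
      have "dist (norm (X i - y)) (norm (X j - y)) < e" if "i \<ge> N" "j \<ge> N" for i j
        using near[of i] near[of j] N[OF that] unfolding dist_real_def by linarith
      then show "\<exists>N. \<forall>i\<ge>N. \<forall>j\<ge>N. dist (norm (X i - y)) (norm (X j - y)) < e" by blast
    qed
    obtain R where R: "\<And>n. norm (X n - z) \<le> R"
      using convergent_imp_Bseq[OF conv[OF z]] unfolding Bseq_def by auto
    have R0: "R \<ge> 0" using R[of 0] norm_ge_zero order_trans by blast
    have Q_fin: "sppz.mean_excess n (X n) \<noteq> \<infinity>" for n
    proof
      assume "sppz.mean_excess n (X n) = \<infinity>"
      then have "ennreal (lam n) * sppz.mean_excess n (X n) = \<infinity>" using lam_pos[of n]
        by (simp add: ennreal_mult_top)
      then have "\<infinity> \<le> (\<Sum>k. ennreal (lam k) * sppz.mean_excess k (X k))"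
        using sum_le_suminf[of "\<lambda>k. ennreal (lam k) * sppz.mean_excess k (X k)" "{n}"] by simp
      then show False using elim(3) by (simp add: X_def top_unique)
    qed
    define Qr where "Qr n = enn2real (sppz.mean_excess n (X n))" for n
    have Q_sum: "summable (\<lambda>n. lam n * Qr n)"
    proof (rule summable_suminf_not_top)
      have "ennreal (lam n * Qr n) = ennreal (lam n) * sppz.mean_excess n (X n)" for n
        using lam_pos[of n] Q_fin[of n] by (simp add: Qr_def ennreal_mult less_imp_le less_top)
      then show "(\<Sum>n. ennreal (lam n * Qr n)) \<noteq> \<top>" using elim(3) by (simp add: X_def)
    qed (use lam_pos in \<open>simp add: Qr_def less_imp_le\<close>)
    have gap: "\<exists>A. \<forall>n\<ge>1. F (X n) \<le> ereal (m + Qr n + lam n * A + e)" if e: "e > 0" for e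
    proof -
      have "ext_integral M (\<lambda>s. f s z) = ereal m" using m F_def by simp
      from sppz.expected_gap[OF unif_int this e R0 \<Lambda>] show ?thesis
        using X_dom R Q_fin unfolding F_def Qr_def by blast
    qed
    \<comment> \<open>The optimality gap at the iterates. It is finite for \<open>n \<ge> 1\<close>, whereas \<open>x0\<close> may lie outside
      the domain.\<close>
    define a where "a n = real_of_ereal (F (X n)) - m" for n
    have F_X: "F (X n) = ereal (m + a n)" if n: "n \<ge> 1" for n
    proof -
      obtain A where "F (X n) \<le> ereal (m + Qr n + lam n * A + 1)" using gap[of 1] n by auto
      then show ?thesis using proper_not_MInf[OF F_proper, of "X n"]
        by (cases "F (X n)") (auto simp: a_def)
    qed
    \<comment> \<open>The part of the optimality gap that is not accounted for by the mean excess.\<close>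
    define \<rho> where "\<rho> n = (if n = 0 then 0 else max 0 (a n - Qr n))" for n
    have "\<rho> \<longlonglongrightarrow> 0"
    proof (rule tendstoI)
      fix e :: real assume "e > 0"
      then obtain A where A: "\<And>n. n \<ge> 1 \<Longrightarrow> F (X n) \<le> ereal (m + Qr n + lam n * A + e / 2)"
        using gap[of "e / 2"] by auto
      have "(\<lambda>n. lam n * A) \<longlonglongrightarrow> 0 * A" by (intro tendsto_mult lam0 tendsto_const)
      then have "\<forall>\<^sub>F n in sequentially. lam n * A < e / 2" using \<open>e > 0\<close> by (intro order_tendstoD) auto
      then show "\<forall>\<^sub>F n in sequentially. dist (\<rho> n) 0 < e"
      proof eventually_elim
        case (elim n)
        show ?case
        proof (cases "n = 0")
          case False
          then have "a n \<le> Qr n + lam n * A + e / 2" using A[of n] F_X[of n] by simp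
          then show ?thesis using elim \<open>e > 0\<close> False by (simp add: \<rho>_def)
        qed (use \<open>e > 0\<close> in \<open>simp add: \<rho>_def\<close>)
      qed
    qed
    define c where "c n = (\<Sum>k=1..n. lam k * a k) / (\<Sum>k=1..n. lam k)" for n
    have pos: "(\<Sum>k=1..n. lam k) > 0" if "n \<ge> 1" for n using that lam_pos by (intro sum_pos) auto
    have c0: "c \<longlonglongrightarrow> 0"
    proof (rule tendsto_sandwich)
      have a_nonneg: "0 \<le> a n" if "n \<ge> 1" for n using m_le[of "X n"] F_X[OF that] by simp
      show "\<forall>\<^sub>F n in sequentially. 0 \<le> c n"
        unfolding c_def by (intro always_eventually allI divide_nonneg_nonneg sum_nonneg
          mult_nonneg_nonneg a_nonneg)
          (auto simp: lam_pos less_imp_le)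
      have "c n \<le> (\<Sum>k=1..n. lam k * Qr k) / (\<Sum>k=1..n. lam k)
        + (\<Sum>k=1..n. lam k * \<rho> k) / (\<Sum>k=1..n. lam k)" for n
      proof -
        have "(\<Sum>k=1..n. lam k * a k) \<le> (\<Sum>k=1..n. lam k * Qr k + lam k * \<rho> k)"
        proof (rule sum_mono)
          fix k assume "k \<in> {1..n}"
          then have "a k \<le> Qr k + \<rho> k" by (simp add: \<rho>_def)
          then have "lam k * a k \<le> lam k * (Qr k + \<rho> k)" using lam_pos[of k] by simp
          then show "lam k * a k \<le> lam k * Qr k + lam k * \<rho> k" by (simp add: distrib_left)
        qed
        moreover have "0 \<le> (\<Sum>k=1..n. lam k)" using lam_pos by (intro sum_nonneg) (simp add: less_imp_le)
        ultimately show ?thesis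
          unfolding c_def add_divide_distrib[symmetric] sum.distrib[symmetric]
            by (rule divide_right_mono)
      qed
      then show "\<forall>\<^sub>F n in sequentially. c n \<le> (\<Sum>k=1..n. lam k * Qr k) / (\<Sum>k=1..n. lam k)
          + (\<Sum>k=1..n. lam k * \<rho> k) / (\<Sum>k=1..n. lam k)" by simp
      show "(\<lambda>n. (\<Sum>k=1..n. lam k * Qr k) / (\<Sum>k=1..n. lam k)
          + (\<Sum>k=1..n. lam k * \<rho> k) / (\<Sum>k=1..n. lam k)) \<longlonglongrightarrow> 0"
        using tendsto_add[OF weighted_mean_of_summable[OF Q_sum S] weighted_mean_tendsto[OF lam_pos
          S \<open>\<rho> \<longlonglongrightarrow> 0\<close>]] by simp
    qed simp
    have xbar_X: "xbar n \<omega> = (\<Sum>k=1..n. lam k *\<^sub>R X k) /\<^sub>R (\<Sum>k=1..n. lam k)" for n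
      using xbar_def[OF elim(4)] by (simp add: X_def)
    have F_bar: "F (xbar n \<omega>) \<le> ereal (m + c n)" if n: "n \<ge> 1" for n
    proof -
      have "F (xbar n \<omega>) \<le> ereal ((\<Sum>k=1..n. lam k * (m + a k)) / (\<Sum>k=1..n. lam k))"
        unfolding xbar_X using n F_X lam_pos by (intro convex_fun_weighted_mean F_convex) auto
      also have "(\<Sum>k=1..n. lam k * (m + a k)) / (\<Sum>k=1..n. lam k) = m + c n"
        using pos[OF n] by (simp add: c_def distrib_left sum.distrib add_divide_distrib
          sum_distrib_right[symmetric])
      finally show ?thesis .
    qed
    show "\<exists>y\<in>?Z. weakly_converges (\<lambda>n. xbar n \<omega>) y"
    proof (rule ergodic_opial[OF lam_pos S xbar_X F_min conv])
      fix r y assume r: "strict_mono r" "weakly_converges ((\<lambda>n. xbar n \<omega>) \<circ> r) y"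
      have "F y \<le> ereal m"
      proof (rule weak_limit_of_minimizing_sequence[OF F_lsc F_proper F_convex m_le])
        show "weakly_converges (\<lambda>n. xbar (r (Suc n)) \<omega>) y"
          using r(2) LIMSEQ_Suc unfolding weakly_converges_def comp_def by blast
        have "1 \<le> r (Suc n)" for n using seq_suble[OF r(1), of "Suc n"] by simp
        then show "F (xbar (r (Suc n)) \<omega>) \<le> ereal (m + c (r (Suc n)))" for n by (rule F_bar)
        have "(\<lambda>n. c (r (Suc n))) \<longlonglongrightarrow> 0"
          using LIMSEQ_Suc[OF LIMSEQ_subseq_LIMSEQ[OF c0 r(1)]] by (simp add: o_def)
        then have "(\<lambda>n. m + c (r (Suc n))) \<longlonglongrightarrow> m + 0" by (intro tendsto_add tendsto_const)
        then show "(\<lambda>n. m + c (r (Suc n))) \<longlonglongrightarrow> m" by simp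
      qed
      then show "y \<in> ?Z" by (rule Z_iff)
    qed
  qed
qed

end
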